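(* Let $\alpha\in(0,1)$. For each $n$ let $(\mathbf x_i,y_i)_{i=1}^n$ be independent copies of $(\mathbf x,y)$ with $y=\langle\mathbf x,\beta^*\rangle+\epsilon$, $\beta^*\in\mathbb R^p$, $\|\beta^*\|_0\le s^*$, where $\mathbf x\in\mathbb R^p$ is sub-Gaussian with parameter $K_x$, mean zero and covariance matrix $\boldsymbol\Sigma$, and $\epsilon$ is sub-Gaussian with parameter $K_\epsilon$, mean zero, variance $\sigma_\epsilon^2$, and independent of $\mathbf x$. Let the sparsity tuning parameter satisfy $s\asymp s^*$ and $s\ge s^*$, and let $\phi(\hat f_{L_0})$ be the permutation p-value based on the $L_0$-constrained least-squares estimator with sparsity constraint $s$. Then under $H_0:\beta^*=\mathbf 0$, $$\limsup_{n\to\infty}\mathbb P_{H_0}(\phi(\hat f_{L_0})\le\alpha)\le\alpha.$$ In addition, if $h>0$ is sufficiently large (not depending on $n$), then $$\liminf_{n\to\infty}\mathbb P_{H_1}(\phi(\hat f_{L_0})\le\alpha)>\alpha$$ under the alternative $$H_1:\ \|\beta^*\|_0=s^*>0,\quad(\beta^* )^\top\boldsymbol\Sigma\beta^*=h\Big(\frac1{\sqrt n}+\frac{s^*\log(p)}{n}\Big),$$ and also under the alternative $$H_1:\ \|\beta^*\|_0=s^*>0,\quad(\beta^* )^\top\boldsymbol\Sigma\beta^*=h\,\frac{s^*\log(p)}{n}$$ provided that in addition there exists $\kappa>0$ such that $\|\langle\mathbf x,\mathbf v\rangle\|_{\psi_2}^2\le\kappa\,\mathbb E(\langle\mathbf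 x,\mathbf v\rangle^2)$ for all $\mathbf v\in\mathbb R^p$.
   Context: $\|\xi\|_{\psi_2}=\inf\{t>0:\mathbb E\exp(\xi^2/t^2)\le2\}$; a real random variable $\xi$ is sub-Gaussian with parameter $K$ if $\|\xi\|_{\psi_2}\le K$, and a random vector $\boldsymbol\xi$ is if $\sup_{\|\mathbf v\|_2=1}\|\langle\boldsymbol\xi,\mathbf v\rangle\|_{\psi_2}\le K$. $\|\cdot\|_0$ is the number of nonzero entries. $\Pi_n$ is the set of permutations of $\{1,\dots,n\}$ and $\pi_0$ the identity. For $\pi\in\Pi_n$, $\hat\beta^{(\pi)}_{L_0}$ is a minimizer of $\sum_{i=1}^n(y_{\pi(i)}-\langle\mathbf x_i,\beta\rangle)^2$ over $\beta\in\mathbb R^p$ with $\|\beta\|_0\le s$, chosen by a fixed rule depending only on $(\mathbf x_j,y_{\pi(j)})_{j=1}^n$; $\hat f_{L_0}(\mathbf x_i;(\mathbf x_j,y_j)_{j=1}^n;\pi)=\langle\mathbf x_i,\hat\beta^{(\pi)}_{L_0}\rangle$; $\Lambda^{(\pi)}=\sum_{i=1}^n\langle\mathbf x_i,\hat\beta^{(\pi)}_{L_0}\rangle^2$; and $\phi(\hat f_{L_0})=\frac1{|\Pi_n|}\sum_{\pi\in\Pi_n}\mathbf 1\{\Lambda^{(\pi_0)}\le\Lambda^{(\pi)}\}$. Here $s^*\ge1$ is the sparsity level under the alternative; $a_n\asymp b_n$ means the ratio is bounded above and below by positive constants. $p$, $s^*$, $\beta^*$, $\boldsymbol\Sigma$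 may vary with $n$; $K_x,K_\epsilon,\sigma_\epsilon^2,\kappa$ and a bound $K_\mu$ on $\|\langle\mathbf x,\beta^*\rangle\|_{\psi_2}$ do not depend on $n$. "$h$ sufficiently large (not depending on $n$)" means: there is a threshold $h_0$ not depending on $n$ such that the conclusion holds for every fixed $h\ge h_0$.
   Formalization: For the second alternative, p ≥ 2 is assumed for all large n: if p = 1 then log p = 0, so (β* )ᵀΣβ* = 0 with β* ≠ 0 forces x = 0 almost surely, φ = 1, and the power claim fails. *)

theory Defs
  imports "HOL-Probability.Probability" "HOL-Combinatorics.Permutations"
begin

text \<open>
  Since the dimension varies with the sample size, the space of real vectors of dimension \<open>p\<close> is
  rendered as the carrier of the product measurable space over the index set \<open>{1..p}\<close>, i.e. as
  the functions \<open>nat \<Rightarrow> real\<close> that take the value \<open>undefined\<close> outside \<open>{1..p}\<close>.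
\<close>

abbreviation borel_vec :: "nat \<Rightarrow> (nat \<Rightarrow> real) measure" where
  "borel_vec p \<equiv> (\<Pi>\<^sub>M k\<in>{1..p}. borel)"

abbreviation Rvec :: "nat \<Rightarrow> (nat \<Rightarrow> real) set" where
  "Rvec p \<equiv> (\<Pi>\<^sub>E k\<in>{1..p}. UNIV)"

definition vinner :: "nat \<Rightarrow> (nat \<Rightarrow> real) \<Rightarrow> (nat \<Rightarrow> real) \<Rightarrow> real" where
  "vinner p u v = (\<Sum>k=1..p. u k * v k)"

definition l0_norm :: "nat \<Rightarrow> (nat \<Rightarrow> real) \<Rightarrow> nat" where
  "l0_norm p v = card {k \<in> {1..p}. v k \<noteq> 0}"

definition quad_form :: "nat \<Rightarrow> (nat \<Rightarrow> nat \<Rightarrow> real) \<Rightarrow> (nat \<Rightarrow> real) \<Rightarrow> real" where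
  "quad_form p A v = (\<Sum>j=1..p. \<Sum>k=1..p. v j * A j k * v k)"

definition covariance_matrix :: "'b measure \<Rightarrow> ('b \<Rightarrow> nat \<Rightarrow> real) \<Rightarrow> nat \<Rightarrow> nat \<Rightarrow> real" where
  "covariance_matrix P x j k =
     (\<integral>\<omega>. (x \<omega> j - (\<integral>\<omega>. x \<omega> j \<partial>P)) * (x \<omega> k - (\<integral>\<omega>. x \<omega> k \<partial>P)) \<partial>P)"

text \<open>
  The norm takes values in \<^typ>\<open>ennreal\<close> and uses the non-negative integral: it is infinite
  if no \<open>t\<close> is admissible, and a non-integrable exponential moment counts as infinite.
\<close>

definition psi2_norm :: "'b measure \<Rightarrow> ('b \<Rightarrow> real) \<Rightarrow> ennreal" where
  "psi2_norm P \<xi> =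
     (INF t \<in> {t::real. 0 < t \<and> (\<integral>\<^sup>+ \<omega>. ennreal (exp ((\<xi> \<omega>)\<^sup>2 / t\<^sup>2)) \<partial>P) \<le> 2}. ennreal t)"

definition sub_gaussian :: "'b measure \<Rightarrow> real \<Rightarrow> ('b \<Rightarrow> real) \<Rightarrow> bool" where
  "sub_gaussian P K \<xi> \<longleftrightarrow> psi2_norm P \<xi> \<le> ennreal K"

definition sub_gaussian_vec :: "'b measure \<Rightarrow> nat \<Rightarrow> real \<Rightarrow> ('b \<Rightarrow> nat \<Rightarrow> real) \<Rightarrow> bool" where
  "sub_gaussian_vec P p K \<xi> \<longleftrightarrow>
     (SUP v \<in> {v \<in> Rvec p. L2_set v {1..p} = 1}. psi2_norm P (\<lambda>\<omega>. vinner p (\<xi> \<omega>) v)) \<le> ennreal K"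

definition psi2_variance_bound :: "'b measure \<Rightarrow> nat \<Rightarrow> real \<Rightarrow> ('b \<Rightarrow> nat \<Rightarrow> real) \<Rightarrow> bool" where
  "psi2_variance_bound P p \<kappa> x \<longleftrightarrow>
     (\<forall>v \<in> Rvec p. (psi2_norm P (\<lambda>\<omega>. vinner p (x \<omega>) v))\<^sup>2
                    \<le> ennreal (\<kappa> * (\<integral>\<omega>. (vinner p (x \<omega>) v)\<^sup>2 \<partial>P)))"


text \<open>
  A data set of size \<open>n\<close> is a family of pairs \<open>(x\<^sub>i, y\<^sub>i)\<close> indexed by \<open>{1..n}\<close>. Data sets are
  extensional as well, so that a function of the data set (such as the rule choosing a minimizer)
  has access to nothing but the \<open>n\<close> pairs.
\<close>

type_synonym dataset = "nat \<Rightarrow> (nat \<Rightarrow> real) \<times> real"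

abbreviation datasets :: "nat \<Rightarrow> nat \<Rightarrow> dataset set" where
  "datasets n p \<equiv> (\<Pi>\<^sub>E i\<in>{1..n}. Rvec p \<times> UNIV)"

definition permute_responses :: "nat \<Rightarrow> (nat \<Rightarrow> nat) \<Rightarrow> dataset \<Rightarrow> dataset" where
  "permute_responses n \<pi> d = (\<lambda>i\<in>{1..n}. (fst (d i), snd (d (\<pi> i))))"

definition rss :: "nat \<Rightarrow> nat \<Rightarrow> dataset \<Rightarrow> (nat \<Rightarrow> real) \<Rightarrow> real" where
  "rss n p d b = (\<Sum>i=1..n. (snd (d i) - vinner p (fst (d i)) b)\<^sup>2)"

definition is_L0_estimator :: "nat \<Rightarrow> nat \<Rightarrow> nat \<Rightarrow> (dataset \<Rightarrow> nat \<Rightarrow> real) \<Rightarrow> bool" where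
  "is_L0_estimator n p s est \<longleftrightarrow>
     (\<forall>d \<in> datasets n p. is_arg_min (rss n p d) (\<lambda>b. b \<in> Rvec p \<and> l0_norm p b \<le> s) (est d))"

definition fhat :: "nat \<Rightarrow> nat \<Rightarrow> (dataset \<Rightarrow> nat \<Rightarrow> real) \<Rightarrow> dataset \<Rightarrow> (nat \<Rightarrow> nat) \<Rightarrow> nat \<Rightarrow> real" where
  "fhat n p est d \<pi> i = vinner p (fst (d i)) (est (permute_responses n \<pi> d))"

definition perm_stat :: "nat \<Rightarrow> nat \<Rightarrow> (dataset \<Rightarrow> nat \<Rightarrow> real) \<Rightarrow> dataset \<Rightarrow> (nat \<Rightarrow> nat) \<Rightarrow> real" where
  "perm_stat n p est d \<pi> = (\<Sum>i=1..n. (fhat n p est d \<pi> i)\<^sup>2)"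

definition perm_pvalue :: "nat \<Rightarrow> nat \<Rightarrow> (dataset \<Rightarrow> nat \<Rightarrow> real) \<Rightarrow> dataset \<Rightarrow> real" where
  "perm_pvalue n p est d =
     (\<Sum>\<pi> | \<pi> permutes {1..n}. of_bool (perm_stat n p est d id \<le> perm_stat n p est d \<pi>))
       / real (card {\<pi>. \<pi> permutes {1..n}})"

definition rejection_prob ::
    "'a measure \<Rightarrow> nat \<Rightarrow> nat \<Rightarrow> (dataset \<Rightarrow> nat \<Rightarrow> real) \<Rightarrow> (nat \<Rightarrow> 'a \<Rightarrow> (nat \<Rightarrow> real) \<times> real) \<Rightarrow> real \<Rightarrow> real" where
  "rejection_prob M n p est Z \<alpha> =
     measure M {\<omega> \<in> space M. perm_pvalue n p est (\<lambda>i\<in>{1..n}. Z i \<omega>) \<le> \<alpha>}"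


text \<open>
  The setting at a single sample size \<open>n\<close>. The generic pair \<open>(x, y)\<close> with
  \<open>y = \<langle>x, \<beta>\<rangle> + \<epsilon>\<close> lives on \<open>P\<close>; the sample \<open>Z i = (x\<^sub>i, y\<^sub>i)\<close> lives on \<open>M\<close>. The leading parameters
  \<open>K\<^sub>x\<close>, \<open>K\<^sub>\<epsilon>\<close>, \<open>K\<^sub>\<mu>\<close>, \<open>\<sigma>\<^sub>\<epsilon>\<close>, \<open>c\<close>, \<open>C\<close> are the ones that do not vary with \<open>n\<close>; \<open>c\<close> and \<open>C\<close> are the
  constants of the order relation between \<open>s\<close> and \<open>s_star\<close>. Independence of \<open>x\<close> and \<open>\<epsilon>\<close> is stated
  through the generated sigma-algebras, because \<open>indep_var\<close> needs both variables to have the same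
  value type.
\<close>

locale sparse_regression = pop: prob_space P + smp: prob_space M
  for K\<^sub>x K\<^sub>\<epsilon> K\<^sub>\<mu> \<sigma>\<^sub>\<epsilon> c C :: real
    and n p s_star s :: nat
    and \<beta> :: "nat \<Rightarrow> real"
    and P :: "'b measure" and x :: "'b \<Rightarrow> nat \<Rightarrow> real" and \<epsilon> :: "'b \<Rightarrow> real"
    and M :: "'a measure" and Z :: "nat \<Rightarrow> 'a \<Rightarrow> (nat \<Rightarrow> real) \<times> real"
    and est :: "dataset \<Rightarrow> nat \<Rightarrow> real" +
  assumes sparsity_level: "1 \<le> s_star"
    and tuning_ge: "s_star \<le> s"
    and tuning_order: "c \<le> real s / real s_star" "real s / real s_star \<le> C"
    and beta_vec: "\<beta> \<in> Rvec p"
    and beta_sparse: "l0_norm p \<beta> \<le> s_star"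
    and x_rv: "x \<in> P \<rightarrow>\<^sub>M borel_vec p"
    and x_sub_gaussian: "sub_gaussian_vec P p K\<^sub>x x"
    and x_mean: "\<And>k. k \<in> {1..p} \<Longrightarrow> pop.expectation (\<lambda>\<omega>. x \<omega> k) = 0"
    and eps_rv: "\<epsilon> \<in> borel_measurable P"
    and eps_sub_gaussian: "sub_gaussian P K\<^sub>\<epsilon> \<epsilon>"
    and eps_mean: "pop.expectation \<epsilon> = 0"
    and eps_variance: "pop.variance \<epsilon> = \<sigma>\<^sub>\<epsilon>\<^sup>2"
    and x_eps_indep: "pop.indep_set
      {x -` A \<inter> space P | A. A \<in> sets (borel_vec p)} {\<epsilon> -` B \<inter> space P | B. B \<in> sets borel}"
    and signal_bound: "psi2_norm P (\<lambda>\<omega>. vinner p (x \<omega>) \<beta>) \<le> ennreal K\<^sub>\<mu>"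
    and sample_indep: "smp.indep_vars (\<lambda>_. borel_vec p \<Otimes>\<^sub>M borel) Z {1..n}"
    and sample_distr: "\<And>i. i \<in> {1..n} \<Longrightarrow>
      distr M (borel_vec p \<Otimes>\<^sub>M borel) (Z i) =
      distr P (borel_vec p \<Otimes>\<^sub>M borel) (\<lambda>\<omega>. (x \<omega>, vinner p (x \<omega>) \<beta> + \<epsilon> \<omega>))"
    and estimator: "is_L0_estimator n p s est"

end

theory Submission
  imports Defs
begin

text \<open>
  The least-squares fit is a projection, so by Pythagoras
  \<open>\<Lambda>\<^sup>(\<^sup>\<pi>\<^sup>) = sup\<^sub>b \<Sum>\<^sub>i (2 y\<^sub>\<pi>\<^sub>(\<^sub>i\<^sub>) \<langle>x\<^sub>i, b\<rangle> - \<langle>x\<^sub>i, b\<rangle>\<^sup>2)\<close>, the supremum being over the \<open>s\<close>-sparse vectors \<open>b\<close>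
  (\<open>perm_stat_eq_gain_of_estimator\<close>). Three consequences of this formula carry everything: the
  statistic does not depend on which minimizer the rule picks; it is a supremum over the countably
  many rational \<open>b\<close>, hence measurable (\<open>perm_stat_eq_max_gain\<close>); and it is subadditive when the index
  set \<open>{1..n}\<close> is cut into pieces (\<open>max_gain_subadditive\<close>).

  Level. Under the null the design and the responses are independent, so permuting the responses
  preserves the law of the data (\<open>distr_zip_permuted\<close>). The p-value is then the relative rank of one
  among exchangeable values of the statistic, and at most a fraction \<open>\<alpha>\<close> of a finite family can have
  relative rank at most \<open>\<alpha>\<close> (\<open>permutation_test_level\<close>). This holds for each \<open>n \<ge> 1\<close>.

  Power. By Markov's inequality it suffices that the mean of the p-value, the average over \<open>\<pi>\<close> of
  the probability of \<open>\<Lambda>\<^sup>(\<^sup>i\<^sup>d\<^sup>) \<le> \<Lambda>\<^sup>(\<^sup>\<pi>\<^sup>)\<close>, is small. Write \<open>\<mu>\<^sub>i = \<langle>x\<^sub>i, \<beta>\<rangle>\<close> and let \<open>v\<close> be the variance of \<open>\<mu>\<^sub>i\<close>.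

  For the identity, choosing \<open>b = \<beta>\<close> gives the lower bound \<open>\<Sum>\<^sub>i (2 y\<^sub>i \<mu>\<^sub>i - \<mu>\<^sub>i\<^sup>2)\<close>, a sum of independent
  terms of mean \<open>v\<close>; by Chebyshev's inequality it exceeds \<open>n v / 2\<close> outside an event of probability
  of order \<open>E \<mu>\<^sup>4 / (n v\<^sup>2) + \<sigma>\<^sup>2 / (n v)\<close> (\<open>signal_sum_lower_deviation\<close>). The first term is why the signal must
  be at least of order \<open>1/\<surd>n\<close> in general; if the \<open>\<psi>\<^sub>2\<close>-norm is controlled by the variance, then
  \<open>E \<mu>\<^sup>4\<close> is of order \<open>v\<^sup>2\<close> and that term vanishes without any such requirement.

  For a permutation \<open>\<pi>\<close> the difficulty is that \<open>x\<^sub>i\<close> and \<open>y\<^sub>\<pi>\<^sub>(\<^sub>i\<^sub>)\<close> are not independent across indices. The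
  indices with \<open>\<pi>(i) \<noteq> i\<close> can be coloured with three colours so that \<open>i\<close> and \<open>\<pi>(i)\<close> always
  differ (\<open>three_colouring_inj\<close>); within one colour class \<open>I\<close> the rows \<open>(x\<^sub>i)\<close> and the responses \<open>(y\<^sub>\<pi>\<^sub>(\<^sub>i\<^sub>))\<close> are
  independent, because \<open>\<pi>(I)\<close> avoids \<open>I\<close>. Conditionally on the rows, the gain over vectors with a
  fixed support \<open>S\<close> is the squared norm of the projection of a vector with independent sub-Gaussian
  entries onto a space of dimension at most \<open>|S|\<close>, whose exponential moment is at most \<open>2^|S|\<close>
  (\<open>projection_exp_moment\<close>). Summing over the at most \<open>p^s\<close> supports bounds the mean of the maximum by a
  multiple of \<open>1 + s log p\<close> (\<open>nn_integral_max_gain_le\<close>). The fixed points contribute at most the sum of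
  their \<open>y\<^sub>i\<^sup>2\<close>, and a random permutation has one fixed point on average. So \<open>\<Lambda>\<^sup>(\<^sup>\<pi>\<^sup>) \<ge> n v / 2\<close> has
  probability of order \<open>(1 + s log p) / (n v)\<close> on average over \<open>\<pi>\<close>, which is of order \<open>1/h\<close> under
  either alternative.
\<close>

section \<open>Colourings, ranks and fixed points of permutations\<close>

text \<open>
  Greedy colouring: in the graph joining each \<open>i\<close> to \<open>f i\<close> every vertex has at most two neighbours,
  its image and its preimage, so one of three colours is always free for a new vertex.
\<close>

lemma three_colouring_inj:
  fixes f :: "'a \<Rightarrow> 'a"
  assumes "finite A" "inj f"
  shows "\<exists>c::'a \<Rightarrow> nat. (\<forall>i. c i < 3) \<and> (\<forall>i\<in>A. f i \<in> A \<longrightarrow> f i \<noteq> i \<longrightarrow> c (f i) \<noteq> c i)"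
  using \<open>finite A\<close>
proof (induction A)
  case empty
  show ?case by (intro exI[of _ "\<lambda>_. 0"]) auto
next
  case (insert a A)
  then obtain c :: "'a \<Rightarrow> nat" where c: "\<forall>i. c i < 3" "\<forall>i\<in>A. f i \<in> A \<longrightarrow> f i \<noteq> i \<longrightarrow> c (f i) \<noteq> c i"
    by blast
  \<comment> \<open>the only possible predecessor of the new vertex \<open>a\<close>\<close>
  define b where "b = inv f a"
  have b: "i = b" if "f i = a" for i
    unfolding b_def using that \<open>inj f\<close> by (auto simp: inv_f_eq)
  have "\<exists>k<3::nat. k \<noteq> c (f a) \<and> k \<noteq> c b"
  proof -
    have "card {c (f a), c b} < card {..<3::nat}"
      by (rule le_less_trans[OF card_insert_le_m1]) auto
    then have "\<not> {..<3::nat} \<subseteq> {c (f a), c b}"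
      by (meson card_mono finite.emptyI finite.insertI not_less)
    then show ?thesis by auto
  qed
  then obtain k where k: "k < 3" "k \<noteq> c (f a)" "k \<noteq> c b" by blast
  show ?case
  proof (intro exI[of _ "c(a := k)"] conjI)
    show "\<forall>i. (c(a := k)) i < 3" using c k by auto
    show "\<forall>i\<in>insert a A. f i \<in> insert a A \<longrightarrow> f i \<noteq> i \<longrightarrow> (c(a := k)) (f i) \<noteq> (c(a := k)) i"
      using c k b insert by (auto simp: fun_upd_def)
  qed
qed

text \<open>
  The counting fact behind every permutation test. The element of the set on the left at which \<open>f\<close>
  is smallest is dominated by all the others, so the whole set is contained in the set that its own
  rank counts.
\<close>

lemma card_high_rank_le:
  fixes f :: "'a \<Rightarrow> real"
  assumes "finite G" "0 \<le> k"
  shows "real (card {g\<in>G. real (card {h\<in>G. f g \<le> f h}) \<le> k}) \<le> k"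
proof (cases "{g\<in>G. real (card {h\<in>G. f g \<le> f h}) \<le> k} = {}")
  case False
  let ?R = "{g\<in>G. real (card {h\<in>G. f g \<le> f h}) \<le> k}"
  have fin: "finite ?R" using assms by simp
  define g where "g = arg_min_on f ?R"
  have g: "g \<in> ?R" unfolding g_def by (rule arg_min_if_finite(1)[OF fin False])
  have "?R \<subseteq> {h\<in>G. f g \<le> f h}"
    using arg_min_least[OF fin False, of _ f] by (auto simp: g_def)
  then have "card ?R \<le> card {h\<in>G. f g \<le> f h}"
    using assms by (intro card_mono) auto
  with g show ?thesis by simp
next
  case True
  then show ?thesis using assms(2) by (metis card.empty of_nat_0)
qed

text \<open>
  Double counting: a given point is fixed by \<open>(|A| - 1)!\<close> of the \<open>|A|!\<close> permutations.
\<close>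

lemma sum_card_fixed_points_of_permutations:
  assumes "finite A"
  shows "(\<Sum>\<pi> | \<pi> permutes A. \<Sum>i\<in>A. of_bool (\<pi> i = i)) \<le> real (card {\<pi>. \<pi> permutes A})"
proof -
  let ?G = "{\<pi>. \<pi> permutes A}"
  have finG: "finite ?G" using assms by (rule finite_permutations)
  have "(\<Sum>\<pi>\<in>?G. \<Sum>i\<in>A. of_bool (\<pi> i = i)) = (\<Sum>i\<in>A. \<Sum>\<pi>\<in>?G. of_bool (\<pi> i = i) :: real)"
    by (rule sum.swap)
  also have "\<dots> = (\<Sum>i\<in>A. real (fact (card A - 1)))"
  proof (rule sum.cong[OF refl])
    fix i assume i: "i \<in> A"
    have "?G \<inter> {\<pi>. \<pi> i = i} = {\<pi>. \<pi> permutes (A - {i})}"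
      using i by (auto simp: permutes_def intro!: permutes_superset[of _ A] dest: permutes_not_in)
    then have "(\<Sum>\<pi>\<in>?G. of_bool (\<pi> i = i) :: real) = real (card {\<pi>. \<pi> permutes (A - {i})})"
      using finG by simp
    also have "card {\<pi>. \<pi> permutes (A - {i})} = fact (card A - 1)"
      using assms i by (intro card_permutations) auto
    finally show "(\<Sum>\<pi>\<in>?G. of_bool (\<pi> i = i) :: real) = real (fact (card A - 1))" .
  qed
  also have "\<dots> = real (card A * fact (card A - 1))" by simp
  also have "\<dots> \<le> real (fact (card A))"
    by (cases "card A") (simp_all add: fact_reduce)
  also have "fact (card A) = card ?G" using assms by (intro card_permutations[symmetric]) auto
  finally show ?thesis .
qed

section \<open>Orthogonal systems\<close>

text \<open>
  Gram--Schmidt for the columns \<open>X k\<close>, seen as vectors indexed by \<open>J\<close>. Columns that depend linearly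
  on earlier ones yield zero vectors instead of being dropped, so that the index set \<open>S\<close> is kept.
\<close>

lemma gram_schmidt_orthonormal_or_zero:
  fixes X :: "'k \<Rightarrow> 'i \<Rightarrow> real"
  assumes "finite S" "finite J"
  shows "\<exists>u :: 'k \<Rightarrow> 'i \<Rightarrow> real.
      (\<forall>k\<in>S. \<forall>l\<in>S. k \<noteq> l \<longrightarrow> (\<Sum>i\<in>J. u k i * u l i) = 0) \<and>
      (\<forall>k\<in>S. (\<Sum>i\<in>J. (u k i)\<^sup>2) = 1 \<or> (\<forall>i\<in>J. u k i = 0)) \<and>
      (\<forall>b. \<exists>a. \<forall>i\<in>J. (\<Sum>k\<in>S. b k * X k i) = (\<Sum>k\<in>S. a k * u k i))"
  using assms(1)
proof (induction S)
  case (insert s S)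
  obtain u where u: "(\<forall>k\<in>S. \<forall>l\<in>S. k \<noteq> l \<longrightarrow> (\<Sum>i\<in>J. u k i * u l i) = 0) \<and>
      (\<forall>k\<in>S. (\<Sum>i\<in>J. (u k i)\<^sup>2) = 1 \<or> (\<forall>i\<in>J. u k i = 0)) \<and>
      (\<forall>b. \<exists>a. \<forall>i\<in>J. (\<Sum>k\<in>S. b k * X k i) = (\<Sum>k\<in>S. a k * u k i))"
    using insert.IH by (elim exE) (rule that)
  have orth: "(\<Sum>i\<in>J. u k i * u l i) = 0" if "k \<in> S" "l \<in> S" "k \<noteq> l" for k l
    using u that by simp
  have nrm: "(\<Sum>i\<in>J. (u k i)\<^sup>2) = 1 \<or> (\<forall>i\<in>J. u k i = 0)" if "k \<in> S" for k
    using u that by simp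
  have span: "\<exists>a. \<forall>i\<in>J. (\<Sum>k\<in>S. b k * X k i) = (\<Sum>k\<in>S. a k * u k i)" for b
    using u by simp
  define c where "c k = (\<Sum>i\<in>J. X s i * u k i)" for k
  define w where "w i = X s i - (\<Sum>k\<in>S. c k * u k i)" for i
  define N where "N = sqrt (\<Sum>i\<in>J. (w i)\<^sup>2)"
  \<comment> \<open>for \<open>N = 0\<close> division by zero makes \<open>v\<close> the zero vector, as desired\<close>
  define v where "v i = w i / N" for i
  have w_orth: "(\<Sum>i\<in>J. w i * u l i) = 0" if "l \<in> S" for l
  proof -
    have "(\<Sum>i\<in>J. w i * u l i) = c l - (\<Sum>i\<in>J. \<Sum>k\<in>S. c k * (u k i * u l i))"
      by (simp add: w_def left_diff_distrib sum_subtractf c_def sum_distrib_right mult.assoc)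
    also have "(\<Sum>i\<in>J. \<Sum>k\<in>S. c k * (u k i * u l i)) = (\<Sum>k\<in>S. c k * (\<Sum>i\<in>J. u k i * u l i))"
      by (subst sum.swap) (simp add: sum_distrib_left)
    also have "\<dots> = c l * (\<Sum>i\<in>J. (u l i)\<^sup>2)"
      using that \<open>finite S\<close> by (subst sum.remove[of _ l]) (auto simp: orth power2_eq_square)
    also have "\<dots> = c l"
      using nrm[OF that] by (auto simp: c_def)
    finally show ?thesis by simp
  qed
  have N: "(\<forall>i\<in>J. v i = 0) \<and> (\<forall>i\<in>J. w i = N * v i) \<or> (\<Sum>i\<in>J. (v i)\<^sup>2) = 1 \<and> (\<forall>i\<in>J. w i = N * v i)"
  proof (cases "N = 0")
    case True
    show ?thesis
    proof -
      have "(\<Sum>i\<in>J. (w i)\<^sup>2) = 0" using True by (simp add: N_def)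
      then have "\<forall>i\<in>J. w i = 0" using \<open>finite J\<close> by (simp add: sum_nonneg_eq_0_iff)
      then show ?thesis by (auto simp: v_def)
    qed
  next
    case False
    have "(\<Sum>i\<in>J. (v i)\<^sup>2) = (\<Sum>i\<in>J. (w i)\<^sup>2) / N\<^sup>2"
      by (simp add: v_def power_divide sum_divide_distrib)
    also have "\<dots> = 1" using False by (simp add: N_def sum_nonneg)
    finally show ?thesis using False by (simp add: v_def)
  qed
  define u' where "u' = u(s := v)"
  have [simp]: "u' s = v" by (simp add: u'_def)
  have u': "u' k = u k" if "k \<in> S" for k using that insert by (auto simp: u'_def)
  have sumu': "(\<Sum>k\<in>S. f k * u' k i) = (\<Sum>k\<in>S. f k * u k i)" for f i
    by (simp add: u')
  show ?case
  proof (intro exI[of _ u'] conjI ballI impI allI)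
    fix k l assume "k \<in> insert s S" "l \<in> insert s S" "k \<noteq> l"
    moreover have "(\<Sum>i\<in>J. v i * u l i) = 0" if "l \<in> S" for l
      using w_orth[OF that] by (simp add: v_def flip: sum_divide_distrib)
    ultimately show "(\<Sum>i\<in>J. u' k i * u' l i) = 0"
      by (auto simp: u' orth mult.commute[of "u _ _" "v _"])
  next
    fix k assume "k \<in> insert s S"
    then show "(\<Sum>i\<in>J. (u' k i)\<^sup>2) = 1 \<or> (\<forall>i\<in>J. u' k i = 0)"
      using N nrm[of k] by (cases "k = s") (auto simp: u')
  next
    fix b
    obtain a where a: "\<forall>i\<in>J. (\<Sum>k\<in>S. b k * X k i) = (\<Sum>k\<in>S. a k * u k i)" using span by blast
    define a' where "a' k = (if k = s then b s * N else a k + b s * c k)" for k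
    have "(\<Sum>k\<in>insert s S. b k * X k i) = (\<Sum>k\<in>insert s S. a' k * u' k i)" if "i \<in> J" for i
    proof -
      have "X s i = N * v i + (\<Sum>k\<in>S. c k * u k i)"
        using N that by (auto simp: w_def algebra_simps)
      moreover have "(\<Sum>k\<in>S. a' k * u' k i) = (\<Sum>k\<in>S. (a k + b s * c k) * u k i)"
        using insert by (intro sum.cong) (auto simp: a'_def u')
      ultimately show ?thesis
        using insert a that by (simp add: a'_def sum.distrib distrib_right distrib_left sum_distrib_left mult.assoc)
    qed
    then show "\<exists>a. \<forall>i\<in>J. (\<Sum>k\<in>insert s S. b k * X k i) = (\<Sum>k\<in>insert s S. a k * u' k i)"
      by blast
  qed
qed simp

lemma pythagoras_orthogonal_sum:
  fixes u :: "'k \<Rightarrow> 'i \<Rightarrow> real"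
  assumes "finite S" and orth: "\<And>k l. k \<in> S \<Longrightarrow> l \<in> S \<Longrightarrow> k \<noteq> l \<Longrightarrow> (\<Sum>i\<in>I. u k i * u l i) = 0"
  shows "(\<Sum>i\<in>I. (\<Sum>k\<in>S. a k * u k i)\<^sup>2) = (\<Sum>k\<in>S. (a k)\<^sup>2 * (\<Sum>i\<in>I. (u k i)\<^sup>2))"
proof -
  have "(\<Sum>i\<in>I. (\<Sum>k\<in>S. a k * u k i)\<^sup>2) = (\<Sum>i\<in>I. \<Sum>k\<in>S. \<Sum>l\<in>S. (a k * a l) * (u k i * u l i))"
    by (simp add: power2_eq_square sum_product mult_ac)
  also have "\<dots> = (\<Sum>k\<in>S. \<Sum>i\<in>I. \<Sum>l\<in>S. (a k * a l) * (u k i * u l i))"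
    by (rule sum.swap)
  also have "\<dots> = (\<Sum>k\<in>S. \<Sum>l\<in>S. (a k * a l) * (\<Sum>i\<in>I. u k i * u l i))"
    by (subst sum.swap) (simp add: sum_distrib_left)
  also have "\<dots> = (\<Sum>k\<in>S. (a k)\<^sup>2 * (\<Sum>i\<in>I. (u k i)\<^sup>2))"
  proof (rule sum.cong[OF refl])
    fix k assume k: "k \<in> S"
    have "(\<Sum>l\<in>S - {k}. (a k * a l) * (\<Sum>i\<in>I. u k i * u l i)) = 0"
    proof (intro sum.neutral ballI)
      fix l assume "l \<in> S - {k}"
      then have "(\<Sum>i\<in>I. u k i * u l i) = 0" using k by (intro orth) auto
      then show "(a k * a l) * (\<Sum>i\<in>I. u k i * u l i) = 0" by simp
    qed
    then have "(\<Sum>l\<in>S. (a k * a l) * (\<Sum>i\<in>I. u k i * u l i)) = (a k * a k) * (\<Sum>i\<in>I. u k i * u k i)"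
      using \<open>finite S\<close> k by (subst sum.remove[of _ k]) auto
    then show "(\<Sum>l\<in>S. (a k * a l) * (\<Sum>i\<in>I. u k i * u l i)) = (a k)\<^sup>2 * (\<Sum>i\<in>I. (u k i)\<^sup>2)"
      by (simp add: power2_eq_square)
  qed
  finally show ?thesis .
qed

section \<open>The permutation statistic as a supremum\<close>

text \<open>
  The residual sum of squares saved by \<open>b\<close> compared with the zero vector, restricted to the
  observations in \<open>I\<close> and with responses permuted by \<open>\<pi>\<close>.
\<close>

definition gain :: "nat \<Rightarrow> nat set \<Rightarrow> (nat \<Rightarrow> nat) \<Rightarrow> dataset \<Rightarrow> (nat \<Rightarrow> real) \<Rightarrow> real" where
  "gain p I \<pi> d b =
     (\<Sum>i\<in>I. 2 * snd (d (\<pi> i)) * vinner p (fst (d i)) b - (vinner p (fst (d i)) b)\<^sup>2)"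

text \<open>
  A countable dense set of the \<open>s\<close>-sparse vectors; countability is what makes suprema measurable.
\<close>

definition sparse_rat :: "nat \<Rightarrow> nat \<Rightarrow> (nat \<Rightarrow> real) set" where
  "sparse_rat p s = {b \<in> (\<Pi>\<^sub>E k\<in>{1..p}. \<rat>). l0_norm p b \<le> s}"

text \<open>
  The zero vector has gain \<open>0\<close>, so truncating negative gains, as \<^const>\<open>ennreal\<close> does, leaves the
  supremum unchanged.
\<close>

definition max_gain :: "nat \<Rightarrow> nat \<Rightarrow> nat set \<Rightarrow> (nat \<Rightarrow> nat) \<Rightarrow> dataset \<Rightarrow> ennreal" where
  "max_gain p s I \<pi> d = (SUP b\<in>sparse_rat p s. ennreal (gain p I \<pi> d b))"

lemma countable_sparse_rat: "countable (sparse_rat p s)"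
proof -
  have "countable (\<Pi>\<^sub>E k\<in>{1..p}. (\<rat> :: real set))"
    by (rule countable_PiE) (auto simp: countable_rat)
  then show ?thesis
    by (rule countable_subset[rotated]) (auto simp: sparse_rat_def)
qed

lemma vinner_restrict: "vinner p u (restrict v {1..p}) = vinner p u v"
  by (simp add: vinner_def)

lemma vinner_scale: "vinner p u (\<lambda>k. t * v k) = t * vinner p u v"
  by (simp add: vinner_def sum_distrib_left mult_ac)

lemma permute_responses_in_datasets:
  assumes "d \<in> datasets n p" "\<pi> permutes {1..n}"
  shows "permute_responses n \<pi> d \<in> datasets n p"
  using assms permutes_in_image[OF assms(2)]
  by (auto simp: permute_responses_def PiE_iff mem_Times_iff extensional_def)

lemma rss_permuted:
  assumes "\<pi> permutes {1..n}"
  shows "rss n p (permute_responses n \<pi> d) b = (\<Sum>i=1..n. (snd (d i))\<^sup>2) - gain p {1..n} \<pi> d b"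
proof -
  have "(\<Sum>i=1..n. (snd (d i))\<^sup>2) = (\<Sum>i=1..n. (snd (d (\<pi> i)))\<^sup>2)"
    using sum.permute[OF assms, of "\<lambda>i. (snd (d i))\<^sup>2"] by (simp add: o_def)
  then show ?thesis
    by (simp add: rss_def gain_def permute_responses_def power2_diff sum_subtractf sum.distrib)
qed

text \<open>
  Minimizing the residual sum of squares is maximizing the gain. The sparse vectors form a cone, so
  the minimizer is also optimal along its own ray; stationarity of \<open>t \<mapsto> 2 t A - t\<^sup>2 B\<close> at \<open>t = 1\<close> says that
  the inner product \<open>A\<close> of responses and fit equals the squared norm \<open>B\<close> of the fit. Hence the gain
  \<open>2 A - B\<close> of the minimizer is \<open>B\<close>, the statistic itself.
\<close>

lemma perm_stat_eq_gain_of_estimator: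
  assumes est: "is_L0_estimator n p s est" and d: "d \<in> datasets n p" and \<pi>: "\<pi> permutes {1..n}"
  defines "b0 \<equiv> est (permute_responses n \<pi> d)"
  shows "b0 \<in> Rvec p" "l0_norm p b0 \<le> s"
    and "perm_stat n p est d \<pi> = gain p {1..n} \<pi> d b0"
    and "\<And>b. b \<in> Rvec p \<Longrightarrow> l0_norm p b \<le> s \<Longrightarrow> gain p {1..n} \<pi> d b \<le> gain p {1..n} \<pi> d b0"
proof -
  have am: "is_arg_min (rss n p (permute_responses n \<pi> d)) (\<lambda>b. b \<in> Rvec p \<and> l0_norm p b \<le> s) b0"
    using est permute_responses_in_datasets[OF d \<pi>] unfolding is_L0_estimator_def b0_def by blast
  then show b0: "b0 \<in> Rvec p" "l0_norm p b0 \<le> s" by (auto simp: is_arg_min_def)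
  show opt: "gain p {1..n} \<pi> d b \<le> gain p {1..n} \<pi> d b0" if "b \<in> Rvec p" "l0_norm p b \<le> s" for b
    using am that unfolding is_arg_min_linorder rss_permuted[OF \<pi>] by auto
  define A where "A = (\<Sum>i=1..n. snd (d (\<pi> i)) * vinner p (fst (d i)) b0)"
  define B where "B = (\<Sum>i=1..n. (vinner p (fst (d i)) b0)\<^sup>2)"
  have scaled: "2 * t * A - t\<^sup>2 * B \<le> 2 * A - B" for t
  proof -
    let ?b = "restrict (\<lambda>k. t * b0 k) {1..p}"
    have "l0_norm p ?b \<le> l0_norm p b0"
      unfolding l0_norm_def by (rule card_mono) auto
    then have "gain p {1..n} \<pi> d ?b \<le> gain p {1..n} \<pi> d b0"
      using b0 by (intro opt) auto
    moreover have "gain p {1..n} \<pi> d ?b = 2 * t * A - t\<^sup>2 * B"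
      by (simp add: gain_def A_def B_def vinner_restrict vinner_scale sum_subtractf
          sum_distrib_left power_mult_distrib mult_ac del: One_nat_def)
    moreover have "gain p {1..n} \<pi> d b0 = 2 * A - B"
      by (simp add: gain_def A_def B_def sum_subtractf sum_distrib_left mult_ac)
    ultimately show ?thesis by simp
  qed
  have "B \<ge> 0" unfolding B_def by (intro sum_nonneg) auto
  have "A = B"
  proof (cases "B = 0")
    case True
    then show ?thesis using scaled[of 0] scaled[of 2] by simp
  next
    case False
    \<comment> \<open>\<open>t = A / B\<close> is the vertex of the parabola\<close>
    have "2 * (A/B) * A - (A/B)\<^sup>2 * B \<le> 2 * A - B" by (rule scaled)
    also have "2 * (A/B) * A - (A/B)\<^sup>2 * B = A\<^sup>2 / B"
      using False by (simp add: field_simps power2_eq_square)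
    finally have "A\<^sup>2 \<le> (2 * A - B) * B"
      using False \<open>B \<ge> 0\<close> by (simp add: field_simps)
    then have "(A - B)\<^sup>2 \<le> 0" by (simp add: power2_eq_square algebra_simps)
    then show ?thesis by simp
  qed
  show "perm_stat n p est d \<pi> = gain p {1..n} \<pi> d b0"
  proof -
    have "perm_stat n p est d \<pi> = B"
      by (simp add: perm_stat_def fhat_def B_def b0_def)
    moreover have "gain p {1..n} \<pi> d b0 = 2 * A - B"
      by (simp add: gain_def A_def B_def sum_subtractf sum_distrib_left mult_ac)
    ultimately show ?thesis using \<open>A = B\<close> by simp
  qed
qed

text \<open>
  The gain is continuous in \<open>b\<close>, and rational approximations with the same zero pattern are as sparse
  as \<open>b\<close>, so rational vectors reach the maximum in the limit.
\<close>

lemma perm_stat_eq_max_gain: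
  assumes est: "is_L0_estimator n p s est" and d: "d \<in> datasets n p" and \<pi>: "\<pi> permutes {1..n}"
  shows "ennreal (perm_stat n p est d \<pi>) = max_gain p s {1..n} \<pi> d"
proof (rule antisym)
  define b0 where "b0 = est (permute_responses n \<pi> d)"
  note b0 = perm_stat_eq_gain_of_estimator[OF est d \<pi>, folded b0_def]
  have "\<exists>r. (\<forall>m. r m \<in> \<rat>) \<and> (b0 k = 0 \<longrightarrow> (\<forall>m. r m = 0)) \<and> r \<longlonglongrightarrow> b0 k" for k
  proof (cases "b0 k = 0")
    case True
    then show ?thesis by (intro exI[of _ "\<lambda>_. 0"]) auto
  next
    case False
    have "b0 k \<in> closure \<rat>" by (simp add: Rats_closure_real)
    then show ?thesis using False unfolding closure_sequential by auto
  qed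
  then obtain r where r: "\<And>k m. r k m \<in> (\<rat> :: real set)" "\<And>k m. b0 k = 0 \<Longrightarrow> r k m = 0"
    "\<And>k. r k \<longlonglongrightarrow> b0 k" by metis
  define b where "b m = (\<lambda>k\<in>{1..p}. r k m)" for m
  have b_in: "b m \<in> sparse_rat p s" for m
  proof -
    have "l0_norm p (b m) \<le> l0_norm p b0"
      unfolding l0_norm_def by (rule card_mono) (auto simp: b_def r(2) intro!: Collect_mono)
    then show ?thesis using b0(2) r(1) by (auto simp: sparse_rat_def b_def)
  qed
  have lim: "(\<lambda>m. vinner p u (b m)) \<longlonglongrightarrow> vinner p u b0" for u
    unfolding vinner_def by (intro tendsto_intros) (simp add: b_def r(3))
  have "(\<lambda>m. gain p {1..n} \<pi> d (b m)) \<longlonglongrightarrow> gain p {1..n} \<pi> d b0"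
    unfolding gain_def by (intro tendsto_intros lim)
  then have "(\<lambda>m. ennreal (gain p {1..n} \<pi> d (b m))) \<longlonglongrightarrow> ennreal (gain p {1..n} \<pi> d b0)"
    by (rule tendsto_ennrealI)
  then show "ennreal (perm_stat n p est d \<pi>) \<le> max_gain p s {1..n} \<pi> d"
    unfolding b0(3) by (rule LIMSEQ_le_const2) (auto simp: max_gain_def intro!: SUP_upper b_in)
  show "max_gain p s {1..n} \<pi> d \<le> ennreal (perm_stat n p est d \<pi>)"
    unfolding max_gain_def b0(3)
    by (intro SUP_least ennreal_leI b0(4)) (auto simp: sparse_rat_def PiE_iff)
qed

lemma perm_stat_nonneg: "0 \<le> perm_stat n p est d \<pi>"
  unfolding perm_stat_def by (intro sum_nonneg) auto

lemma measurable_gain: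
  assumes "I \<subseteq> J" "\<pi> ` I \<subseteq> J"
  shows "(\<lambda>d. gain p I \<pi> d b) \<in> borel_measurable (\<Pi>\<^sub>M i\<in>J. borel_vec p \<Otimes>\<^sub>M borel)"
  unfolding gain_def vinner_def
proof (intro borel_measurable_sum borel_measurable_diff borel_measurable_times borel_measurable_power
    borel_measurable_const)
  fix i assume "i \<in> I"
  with assms have i: "i \<in> J" "\<pi> i \<in> J" by auto
  show "(\<lambda>d. snd (d (\<pi> i))) \<in> borel_measurable (\<Pi>\<^sub>M i\<in>J. borel_vec p \<Otimes>\<^sub>M borel)"
    using i by measurable
  show "(\<lambda>d. fst (d i) k) \<in> borel_measurable (\<Pi>\<^sub>M i\<in>J. borel_vec p \<Otimes>\<^sub>M borel)" if "k \<in> {1..p}" for k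
    using i that by measurable
  then show "(\<lambda>d. fst (d i) k) \<in> borel_measurable (\<Pi>\<^sub>M i\<in>J. borel_vec p \<Otimes>\<^sub>M borel)" if "k \<in> {1..p}" for k
    using that .
qed

lemma measurable_max_gain:
  assumes "I \<subseteq> J" "\<pi> ` I \<subseteq> J"
  shows "max_gain p s I \<pi> \<in> borel_measurable (\<Pi>\<^sub>M i\<in>J. borel_vec p \<Otimes>\<^sub>M borel)"
  unfolding max_gain_def
  by (intro borel_measurable_SUP countable_sparse_rat measurable_compose[OF _ measurable_ennreal]
      measurable_gain assms)

lemma space_dataset: "space (\<Pi>\<^sub>M i\<in>{1..n}. borel_vec p \<Otimes>\<^sub>M borel) = datasets n p"
  by (simp add: space_PiM space_pair_measure)

text \<open>
  The statistic is a function of the optimal value, a countable supremum of measurable functions.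
\<close>

lemma measurable_perm_stat:
  assumes est: "is_L0_estimator n p s est" and \<pi>: "\<pi> permutes {1..n}"
  shows "(\<lambda>d. perm_stat n p est d \<pi>) \<in> borel_measurable (\<Pi>\<^sub>M i\<in>{1..n}. borel_vec p \<Otimes>\<^sub>M borel)"
proof -
  have "(\<lambda>d. enn2real (max_gain p s {1..n} \<pi> d)) \<in> borel_measurable (\<Pi>\<^sub>M i\<in>{1..n}. borel_vec p \<Otimes>\<^sub>M borel)"
    using permutes_image[OF \<pi>]
    by (intro measurable_compose[OF measurable_max_gain borel_measurable_enn2real]) auto
  then show ?thesis
    by (rule measurable_cong[THEN iffD1, rotated])
       (simp only: space_dataset perm_stat_eq_max_gain[OF est _ \<pi>, symmetric] enn2real_ennreal perm_stat_nonneg)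
qed

lemma measurable_perm_pvalue:
  assumes est: "is_L0_estimator n p s est"
  shows "perm_pvalue n p est \<in> borel_measurable (\<Pi>\<^sub>M i\<in>{1..n}. borel_vec p \<Otimes>\<^sub>M borel)"
proof -
  have [measurable]: "(\<lambda>d. perm_stat n p est d id) \<in> borel_measurable (\<Pi>\<^sub>M i\<in>{1..n}. borel_vec p \<Otimes>\<^sub>M borel)"
    by (rule measurable_perm_stat[OF est permutes_id])
  show ?thesis
    unfolding perm_pvalue_def[abs_def]
  proof (intro borel_measurable_divide borel_measurable_sum borel_measurable_const)
    fix \<pi> assume "\<pi> \<in> {\<pi>. \<pi> permutes {1..n}}"
    then have [measurable]: "(\<lambda>d. perm_stat n p est d \<pi>) \<in> borel_measurable (\<Pi>\<^sub>M i\<in>{1..n}. borel_vec p \<Otimes>\<^sub>M borel)"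
      by (intro measurable_perm_stat[OF est]) auto
    have "{d \<in> space (\<Pi>\<^sub>M i\<in>{1..n}. borel_vec p \<Otimes>\<^sub>M borel). perm_stat n p est d id \<le> perm_stat n p est d \<pi>}
       \<in> sets (\<Pi>\<^sub>M i\<in>{1..n}. borel_vec p \<Otimes>\<^sub>M borel)"
      by (rule borel_measurable_le) measurable
    then show "(\<lambda>d. of_bool (perm_stat n p est d id \<le> perm_stat n p est d \<pi>))
        \<in> borel_measurable (\<Pi>\<^sub>M i\<in>{1..n}. borel_vec p \<Otimes>\<^sub>M borel)"
      by (simp add: of_bool_def[abs_def] pred_def measurable_If)
  qed
qed

text \<open>
  A supremum of sums is at most the sum of the suprema over the colour classes. At a fixed point of
  \<open>\<pi>\<close> response and row belong to the same observation, and the gain of that observation is at most the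
  squared response, whatever \<open>b\<close> is.
\<close>

lemma max_gain_subadditive:
  assumes \<pi>: "\<pi> permutes {1..n}"
    and c: "\<And>i. c i < (3::nat)" "\<And>i. i \<in> {1..n} \<Longrightarrow> \<pi> i \<noteq> i \<Longrightarrow> c (\<pi> i) \<noteq> c i"
  shows "max_gain p s {1..n} \<pi> d \<le> (\<Sum>i\<in>{1..n}. of_bool (\<pi> i = i) * ennreal ((snd (d i))\<^sup>2))
     + (\<Sum>k<3. max_gain p s {i\<in>{1..n}. \<pi> i \<noteq> i \<and> c i = k} \<pi> d)"
  unfolding max_gain_def[of p s "{1..n}"]
proof (rule SUP_least)
  fix b assume b: "b \<in> sparse_rat p s"
  let ?g = "\<lambda>i. 2 * snd (d (\<pi> i)) * vinner p (fst (d i)) b - (vinner p (fst (d i)) b)\<^sup>2"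
  let ?F = "{i\<in>{1..n}. \<pi> i = i}" and ?I = "\<lambda>k. {i\<in>{1..n}. \<pi> i \<noteq> i \<and> c i = k}"
  have "gain p {1..n} \<pi> d b = sum ?g ?F + sum ?g {i\<in>{1..n}. \<pi> i \<noteq> i}"
    unfolding gain_def by (subst sum.union_disjoint[symmetric]) (auto intro!: sum.cong)
  also have "sum ?g {i\<in>{1..n}. \<pi> i \<noteq> i} = (\<Sum>k<3. gain p (?I k) \<pi> d b)"
  proof -
    have "(\<Sum>k<3. sum ?g (?I k)) = sum ?g (\<Union>k\<in>{..<3}. ?I k)"
      by (intro sum.UNION_disjoint[symmetric]) auto
    also have "(\<Union>k\<in>{..<3}. ?I k) = {i\<in>{1..n}. \<pi> i \<noteq> i}" using c(1) by auto
    finally show ?thesis by (simp add: gain_def)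
  qed
  finally have eq: "gain p {1..n} \<pi> d b = sum ?g ?F + (\<Sum>k<3. gain p (?I k) \<pi> d b)" .
  have "sum ?g ?F \<le> (\<Sum>i\<in>?F. (snd (d i))\<^sup>2)"
  proof (rule sum_mono)
    fix i assume "i \<in> ?F"
    moreover have "2 * a * v - v\<^sup>2 \<le> a\<^sup>2" for a v :: real
      using zero_le_power2[of "a - v"] by (simp add: power2_diff)
    ultimately show "?g i \<le> (snd (d i))\<^sup>2" by simp
  qed
  with eq have *: "gain p {1..n} \<pi> d b \<le> (\<Sum>i\<in>?F. (snd (d i))\<^sup>2) + (\<Sum>k<3. gain p (?I k) \<pi> d b)"
    by simp
  have "(\<Sum>k<3. gain p (?I k) \<pi> d b) \<le> (\<Sum>k<3. max 0 (gain p (?I k) \<pi> d b))"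
    by (intro sum_mono) simp
  with * have "gain p {1..n} \<pi> d b \<le> (\<Sum>i\<in>?F. (snd (d i))\<^sup>2) + (\<Sum>k<3. max 0 (gain p (?I k) \<pi> d b))"
    by linarith
  then have "ennreal (gain p {1..n} \<pi> d b)
      \<le> ennreal ((\<Sum>i\<in>?F. (snd (d i))\<^sup>2) + (\<Sum>k<3. max 0 (gain p (?I k) \<pi> d b)))"
    by (rule ennreal_leI)
  also have "\<dots> = (\<Sum>i\<in>?F. ennreal ((snd (d i))\<^sup>2)) + (\<Sum>k<3. ennreal (gain p (?I k) \<pi> d b))"
    by (simp add: ennreal_plus sum_nonneg flip: sum_ennreal)
  also have "(\<Sum>i\<in>?F. ennreal ((snd (d i))\<^sup>2)) = (\<Sum>i\<in>{1..n}. of_bool (\<pi> i = i) * ennreal ((snd (d i))\<^sup>2))"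
    by (rule sum.mono_neutral_cong_left) auto
  finally have "ennreal (gain p {1..n} \<pi> d b) \<le> (\<Sum>i\<in>{1..n}. of_bool (\<pi> i = i) * ennreal ((snd (d i))\<^sup>2))
     + (\<Sum>k<3. ennreal (gain p (?I k) \<pi> d b))" .
  also have "\<dots> \<le> (\<Sum>i\<in>{1..n}. of_bool (\<pi> i = i) * ennreal ((snd (d i))\<^sup>2))
     + (\<Sum>k<3. max_gain p s (?I k) \<pi> d)"
    unfolding max_gain_def by (intro add_left_mono sum_mono SUP_upper b)
  finally show "ennreal (gain p {1..n} \<pi> d b) \<le> (\<Sum>i\<in>{1..n}. of_bool (\<pi> i = i) * ennreal ((snd (d i))\<^sup>2))
     + (\<Sum>k<3. max_gain p s (?I k) \<pi> d)" .
qed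

text \<open>
  Among the vectors supported on \<open>S\<close>, no gain exceeds the squared norm of the projection of the
  responses onto the span of the columns in \<open>S\<close>, here written in the orthonormal-or-zero basis \<open>u\<close>.
\<close>

lemma gain_le_projection:
  fixes y :: "nat \<Rightarrow> real"
  assumes I: "finite I" and S: "finite S" "S \<subseteq> {1..p}" and b: "\<And>k. k \<in> {1..p} - S \<Longrightarrow> b k = 0"
    and orth: "\<And>k l. k \<in> S \<Longrightarrow> l \<in> S \<Longrightarrow> k \<noteq> l \<Longrightarrow> (\<Sum>i\<in>I. u k i * u l i) = 0"
    and nrm: "\<And>k. k \<in> S \<Longrightarrow> (\<Sum>i\<in>I. (u k i)\<^sup>2) = 1 \<or> (\<forall>i\<in>I. u k i = 0)"
    and span: "\<And>b. \<exists>a. \<forall>i\<in>I. (\<Sum>k\<in>S. b k * fst (d i) k) = (\<Sum>k\<in>S. a k * u k i)"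
  shows "gain p I \<pi> d b \<le> (\<Sum>k\<in>S. (\<Sum>i\<in>I. u k i * snd (d (\<pi> i)))\<^sup>2)"
proof -
  obtain a where a: "\<And>i. i \<in> I \<Longrightarrow> (\<Sum>k\<in>S. b k * fst (d i) k) = (\<Sum>k\<in>S. a k * u k i)"
    using span[of b] by blast
  have v: "vinner p (fst (d i)) b = (\<Sum>k\<in>S. a k * u k i)" if "i \<in> I" for i
  proof -
    have "vinner p (fst (d i)) b = (\<Sum>k\<in>S. fst (d i) k * b k)"
      unfolding vinner_def using S b by (intro sum.mono_neutral_right) auto
    then show ?thesis using a[OF that] by (simp add: mult.commute)
  qed
  define z where "z k = (\<Sum>i\<in>I. u k i * snd (d (\<pi> i)))" for k
  have sq: "(\<Sum>i\<in>I. (\<Sum>k\<in>S. a k * u k i)\<^sup>2) = (\<Sum>k\<in>S. (a k)\<^sup>2 * (\<Sum>i\<in>I. (u k i)\<^sup>2))"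
    by (rule pythagoras_orthogonal_sum[OF S(1) orth])
  have "gain p I \<pi> d b = 2 * (\<Sum>i\<in>I. snd (d (\<pi> i)) * (\<Sum>k\<in>S. a k * u k i)) - (\<Sum>i\<in>I. (\<Sum>k\<in>S. a k * u k i)\<^sup>2)"
    unfolding gain_def by (simp add: v sum_subtractf sum_distrib_left mult_ac)
  also have "(\<Sum>i\<in>I. snd (d (\<pi> i)) * (\<Sum>k\<in>S. a k * u k i)) = (\<Sum>k\<in>S. a k * z k)"
    unfolding z_def sum_distrib_left by (subst sum.swap) (simp add: mult_ac)
  also have "2 * (\<Sum>k\<in>S. a k * z k) - (\<Sum>i\<in>I. (\<Sum>k\<in>S. a k * u k i)\<^sup>2)
     = (\<Sum>k\<in>S. 2 * a k * z k - (a k)\<^sup>2 * (\<Sum>i\<in>I. (u k i)\<^sup>2))"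
    unfolding sq by (simp add: sum_subtractf sum_distrib_left mult_ac)
  also have "\<dots> \<le> (\<Sum>k\<in>S. (z k)\<^sup>2)"
  proof (rule sum_mono)
    fix k assume "k \<in> S"
    from nrm[OF this] show "2 * a k * z k - (a k)\<^sup>2 * (\<Sum>i\<in>I. (u k i)\<^sup>2) \<le> (z k)\<^sup>2"
    proof
      assume "(\<Sum>i\<in>I. (u k i)\<^sup>2) = 1"
      then show ?thesis using zero_le_power2[of "a k - z k"] by (simp add: power2_diff)
    qed (simp add: z_def)
  qed
  finally show ?thesis by (simp add: z_def)
qed

section \<open>Level of the permutation test\<close>

lemma perm_stat_permute_responses:
  assumes \<pi>: "\<pi> permutes {1..n}" and \<sigma>: "\<sigma> permutes {1..n}"
  shows "perm_stat n p est (permute_responses n \<pi> d) \<sigma> = perm_stat n p est d (\<pi> \<circ> \<sigma>)"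
proof -
  have "permute_responses n \<sigma> (permute_responses n \<pi> d) = permute_responses n (\<pi> \<circ> \<sigma>) d"
    unfolding permute_responses_def
  proof (rule restrict_ext)
    fix i assume i: "i \<in> {1..n}"
    then have "\<sigma> i \<in> {1..n}" by (rule permutes_in_image[OF \<sigma>, THEN iffD2])
    with i show "(fst ((\<lambda>i\<in>{1..n}. (fst (d i), snd (d (\<pi> i)))) i),
        snd ((\<lambda>i\<in>{1..n}. (fst (d i), snd (d (\<pi> i)))) (\<sigma> i))) = (fst (d i), snd (d ((\<pi> \<circ> \<sigma>) i)))"
      by simp
  qed
  moreover have "fst (permute_responses n \<pi> d i) = fst (d i)" if "i \<in> {1..n}" for i
    using that by (simp add: permute_responses_def)
  ultimately show ?thesis
    unfolding perm_stat_def fhat_def by (intro sum.cong) auto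
qed

text \<open>
  Since \<open>\<sigma> \<mapsto> \<pi> \<circ> \<sigma>\<close> is a bijection of the permutations, data permuted by \<open>\<pi>\<close> are compared with the same
  family of statistics as the original data; only the reference value changes.
\<close>

lemma perm_pvalue_permute_responses:
  assumes \<pi>: "\<pi> permutes {1..n}"
  shows "perm_pvalue n p est (permute_responses n \<pi> d)
    = real (card {\<tau>\<in>{\<pi>. \<pi> permutes {1..n}}. perm_stat n p est d \<pi> \<le> perm_stat n p est d \<tau>})
      / real (card {\<pi>. \<pi> permutes {1..n}})"
proof -
  let ?T = "perm_stat n p est d"
  have "(\<Sum>\<sigma> | \<sigma> permutes {1..n}. of_bool (perm_stat n p est (permute_responses n \<pi> d) id
          \<le> perm_stat n p est (permute_responses n \<pi> d) \<sigma>)) = (\<Sum>\<sigma> | \<sigma> permutes {1..n}. of_bool (?T \<pi> \<le> ?T (\<pi> \<circ> \<sigma>)) :: real)"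
    by (intro sum.cong) (auto simp: perm_stat_permute_responses[OF \<pi>] permutes_id)
  also have "\<dots> = (\<Sum>\<tau> | \<tau> permutes {1..n}. of_bool (?T \<pi> \<le> ?T \<tau>))"
    by (rule setum_permutations_compose_left[OF \<pi>, symmetric])
  also have "\<dots> = real (card {\<tau>\<in>{\<pi>. \<pi> permutes {1..n}}. ?T \<pi> \<le> ?T \<tau>})"
    using finite_permutations[of "{1..n}"] by (simp add: Collect_conj_eq)
  finally show ?thesis by (simp add: perm_pvalue_def)
qed

text \<open>
  By invariance the rejection probability is the same for every permuted data set, so it equals the
  mean fraction of permutations whose rank is at most \<open>\<alpha>\<close>; that fraction is at most \<open>\<alpha>\<close> for every
  single data set.
\<close>

lemma permutation_test_level:
  assumes L: "prob_space L" and sets_L: "sets L = sets (\<Pi>\<^sub>M i\<in>{1..n}. borel_vec p \<Otimes>\<^sub>M borel)"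
    and est: "is_L0_estimator n p s est" and \<alpha>: "0 \<le> \<alpha>"
    and perm: "\<And>\<pi>. \<pi> permutes {1..n} \<Longrightarrow> permute_responses n \<pi> \<in> L \<rightarrow>\<^sub>M L"
    and inv: "\<And>\<pi>. \<pi> permutes {1..n} \<Longrightarrow> distr L L (permute_responses n \<pi>) = L"
  shows "measure L {d \<in> space L. perm_pvalue n p est d \<le> \<alpha>} \<le> \<alpha>"
proof -
  interpret L: prob_space L by (rule L)
  let ?G = "{\<pi>. \<pi> permutes {1..n}}"
  let ?N = "real (card ?G)"
  have finG: "finite ?G" by (rule finite_permutations) simp
  have "id \<in> ?G" using permutes_id by simp
  then have "?G \<noteq> {}" by blast
  then have N: "0 < ?N" using finG by (simp add: card_gt_0_iff)
  let ?E = "{d \<in> space L. perm_pvalue n p est d \<le> \<alpha>}"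
  have pv[measurable]: "perm_pvalue n p est \<in> borel_measurable L"
    using measurable_perm_pvalue[OF est] measurable_cong_sets[OF sets_L refl] by blast
  have E: "?E \<in> sets L" by measurable
  define E' where "E' \<pi> = {d \<in> space L. perm_pvalue n p est (permute_responses n \<pi> d) \<le> \<alpha>}" for \<pi>
  have E'_sets: "E' \<pi> \<in> sets L" if "\<pi> \<in> ?G" for \<pi>
  proof -
    have [measurable]: "permute_responses n \<pi> \<in> L \<rightarrow>\<^sub>M L" using perm that by simp
    show ?thesis unfolding E'_def by measurable
  qed
  have E': "emeasure L (E' \<pi>) = emeasure L ?E" if "\<pi> \<in> ?G" for \<pi>
  proof -
    have "emeasure L ?E = emeasure (distr L L (permute_responses n \<pi>)) ?E" using inv that by simp
    also have "\<dots> = emeasure L (permute_responses n \<pi> -` ?E \<inter> space L)"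
      using perm that E by (intro emeasure_distr) auto
    also have "permute_responses n \<pi> -` ?E \<inter> space L = E' \<pi>"
      using measurable_space[OF perm] that by (auto simp: E'_def)
    finally show ?thesis by simp
  qed
  have "ennreal ?N * emeasure L ?E = (\<Sum>\<pi>\<in>?G. emeasure L (E' \<pi>))"
    using E' by (simp add: ennreal_of_nat_eq_real_of_nat)
  also have "\<dots> = (\<integral>\<^sup>+d. (\<Sum>\<pi>\<in>?G. indicator (E' \<pi>) d) \<partial>L)"
    using E'_sets by (subst nn_integral_sum) auto
  also have "\<dots> \<le> (\<integral>\<^sup>+d. ennreal (\<alpha> * ?N) \<partial>L)"
  proof (rule nn_integral_mono)
    fix d assume d: "d \<in> space L"
    let ?T = "perm_stat n p est d"
    have "(\<Sum>\<pi>\<in>?G. indicator (E' \<pi>) d) = (\<Sum>\<pi>\<in>?G. of_bool (real (card {\<tau>\<in>?G. ?T \<pi> \<le> ?T \<tau>}) \<le> \<alpha> * ?N) :: ennreal)"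
      using N d by (intro sum.cong refl) (auto simp: E'_def indicator_def perm_pvalue_permute_responses divide_le_eq)
    also have "\<dots> = ennreal (real (card {\<pi>\<in>?G. real (card {\<tau>\<in>?G. ?T \<pi> \<le> ?T \<tau>}) \<le> \<alpha> * ?N}))"
      using finG by (simp add: Collect_conj_eq ennreal_of_nat_eq_real_of_nat)
    also have "\<dots> \<le> ennreal (\<alpha> * ?N)"
      using \<alpha> by (intro ennreal_leI card_high_rank_le[OF finG]) auto
    finally show "(\<Sum>\<pi>\<in>?G. indicator (E' \<pi>) d) \<le> ennreal (\<alpha> * ?N)" .
  qed
  also have "\<dots> = ennreal (\<alpha> * ?N)" by (simp add: L.emeasure_space_1)
  finally have "ennreal (?N * measure L ?E) \<le> ennreal (\<alpha> * ?N)"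
    by (simp add: L.emeasure_eq_measure ennreal_mult')
  then have "?N * measure L ?E \<le> \<alpha> * ?N" using \<alpha> by (subst (asm) ennreal_le_iff) auto
  then show ?thesis using N by (simp add: mult.commute)
qed

text \<open>
  Pairing independent rows with independent labels after permuting the labels gives the same law as
  pairing them in order: for fixed rows, the probability of a product event factorizes over the
  labels, and \<open>\<pi>\<close> only reorders the factors.
\<close>

lemma distr_zip_permuted:
  assumes X: "prob_space X" and Y: "prob_space Y" and \<pi>: "\<pi> permutes I" and fin: "finite I"
  shows "distr ((\<Pi>\<^sub>M i\<in>I. X) \<Otimes>\<^sub>M (\<Pi>\<^sub>M i\<in>I. Y)) (\<Pi>\<^sub>M i\<in>I. X \<Otimes>\<^sub>M Y) (\<lambda>(a, b). \<lambda>i\<in>I. (a i, b (\<pi> i)))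
    = (\<Pi>\<^sub>M i\<in>I. X \<Otimes>\<^sub>M Y)"
proof -
  interpret X: prob_space X by (rule X)
  interpret Y: prob_space Y by (rule Y)
  interpret XY: pair_prob_space X Y ..
  interpret PX: product_sigma_finite "\<lambda>_. X" by unfold_locales
  interpret PY: product_sigma_finite "\<lambda>_. Y" by unfold_locales
  interpret PXY: product_sigma_finite "\<lambda>_. X \<Otimes>\<^sub>M Y" by unfold_locales
  interpret A: prob_space "\<Pi>\<^sub>M i\<in>I. X" by (rule prob_space_PiM) (rule X)
  interpret B: prob_space "\<Pi>\<^sub>M i\<in>I. Y" by (rule prob_space_PiM) (rule Y)
  have \<pi>I: "\<pi> i \<in> I" if "i \<in> I" for i using permutes_in_image[OF \<pi>] that by simp
  have \<pi>inv: "inv \<pi> permutes I" by (rule permutes_inv[OF \<pi>])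
  let ?AB = "(\<Pi>\<^sub>M i\<in>I. X) \<Otimes>\<^sub>M (\<Pi>\<^sub>M i\<in>I. Y)" and ?z = "\<lambda>(a, b). \<lambda>i\<in>I. (a i, b (\<pi> i))"
  have [measurable]: "(\<lambda>w. fst w i) \<in> ?AB \<rightarrow>\<^sub>M X" "(\<lambda>w. snd w i) \<in> ?AB \<rightarrow>\<^sub>M Y" if "i \<in> I" for i
    using measurable_compose[OF measurable_fst measurable_component_singleton[OF that]]
      measurable_compose[OF measurable_snd measurable_component_singleton[OF that]] by auto
  have z: "?z \<in> ?AB \<rightarrow>\<^sub>M (\<Pi>\<^sub>M i\<in>I. X \<Otimes>\<^sub>M Y)"
    unfolding case_prod_beta by (intro measurable_restrict measurable_Pair) (simp_all add: \<pi>I)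
  show ?thesis
  proof (rule PXY.PiM_eqI[OF fin])
    show "sets (distr ?AB (\<Pi>\<^sub>M i\<in>I. X \<Otimes>\<^sub>M Y) ?z) = sets (\<Pi>\<^sub>M i\<in>I. X \<Otimes>\<^sub>M Y)" by simp
    fix A assume A: "\<And>i. i \<in> I \<Longrightarrow> A i \<in> sets (X \<Otimes>\<^sub>M Y)"
    have PiE: "Pi\<^sub>E I A \<in> sets (\<Pi>\<^sub>M i\<in>I. X \<Otimes>\<^sub>M Y)" using A fin by (intro sets_PiM_I_finite) auto
    have ind: "indicator (Pi\<^sub>E I A) (?z (a, b)) = (\<Prod>i\<in>I. indicator (A i) (a i, b (\<pi> i)) :: ennreal)" for a b
      using fin by (auto simp: indicator_def prod_zero_iff PiE_iff)
    have slice: "(\<lambda>y. indicator (A i) (x, y) :: ennreal) \<in> borel_measurable Y" if "i \<in> I" "x \<in> space X" for i x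
      using A[OF that(1)] that(2) by measurable
    have "emeasure (distr ?AB (\<Pi>\<^sub>M i\<in>I. X \<Otimes>\<^sub>M Y) ?z) (Pi\<^sub>E I A)
       = (\<integral>\<^sup>+w. indicator (Pi\<^sub>E I A) (?z w) \<partial>?AB)"
      using PiE z by (simp add: nn_integral_distr flip: nn_integral_indicator)
    also have "\<dots> = (\<integral>\<^sup>+a. (\<integral>\<^sup>+b. indicator (Pi\<^sub>E I A) (?z (a, b)) \<partial>(\<Pi>\<^sub>M i\<in>I. Y)) \<partial>(\<Pi>\<^sub>M i\<in>I. X))"
      using PiE z by (subst B.nn_integral_fst[symmetric]) (auto intro!: measurable_compose[OF z])
    also have "\<dots> = (\<integral>\<^sup>+a. (\<Prod>i\<in>I. emeasure Y (Pair (a i) -` A i)) \<partial>(\<Pi>\<^sub>M i\<in>I. X))"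
    proof (rule nn_integral_cong)
      fix a assume "a \<in> space (\<Pi>\<^sub>M i\<in>I. X)"
      then have a: "a i \<in> space X" if "i \<in> I" for i using that by (auto simp: space_PiM)
      have "(\<integral>\<^sup>+b. indicator (Pi\<^sub>E I A) (?z (a, b)) \<partial>(\<Pi>\<^sub>M i\<in>I. Y))
         = (\<integral>\<^sup>+b. (\<Prod>j\<in>I. indicator (A (inv \<pi> j)) (a (inv \<pi> j), b j)) \<partial>(\<Pi>\<^sub>M i\<in>I. Y))"
        unfolding ind
        by (subst prod.permute[OF \<pi>inv]) (simp add: o_def permutes_inverses[OF \<pi>])
      also have "\<dots> = (\<Prod>j\<in>I. (\<integral>\<^sup>+y. indicator (A (inv \<pi> j)) (a (inv \<pi> j), y) \<partial>Y))"
        by (rule PY.product_nn_integral_prod[OF fin]) (auto intro!: slice a simp: permutes_in_image[OF \<pi>inv])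
      also have "\<dots> = (\<Prod>i\<in>I. (\<integral>\<^sup>+y. indicator (A i) (a i, y) \<partial>Y))"
        by (subst (2) prod.permute[OF \<pi>inv]) (simp add: o_def)
      also have "\<dots> = (\<Prod>i\<in>I. emeasure Y (Pair (a i) -` A i))"
      proof (rule prod.cong[OF refl])
        fix i assume i: "i \<in> I"
        have "Pair (a i) -` A i \<in> sets Y" using A[OF i] by (rule sets_Pair1)
        have "(\<integral>\<^sup>+y. indicator (A i) (a i, y) \<partial>Y) = (\<integral>\<^sup>+y. indicator (Pair (a i) -` A i) y \<partial>Y)"
          by (intro nn_integral_cong) (simp add: indicator_def)
        also have "\<dots> = emeasure Y (Pair (a i) -` A i)"
          using \<open>Pair (a i) -` A i \<in> sets Y\<close> by (rule nn_integral_indicator)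
        finally show "(\<integral>\<^sup>+y. indicator (A i) (a i, y) \<partial>Y) = emeasure Y (Pair (a i) -` A i)" .
      qed
      finally show "(\<integral>\<^sup>+b. indicator (Pi\<^sub>E I A) (?z (a, b)) \<partial>(\<Pi>\<^sub>M i\<in>I. Y)) = \<dots>" .
    qed
    also have "\<dots> = (\<Prod>i\<in>I. (\<integral>\<^sup>+x. emeasure Y (Pair x -` A i) \<partial>X))"
      using A by (intro PX.product_nn_integral_prod[OF fin] Y.measurable_emeasure_Pair) auto
    also have "\<dots> = (\<Prod>i\<in>I. emeasure (X \<Otimes>\<^sub>M Y) (A i))"
      using A by (intro prod.cong refl Y.emeasure_pair_measure_alt[symmetric]) auto
    finally show "emeasure (distr ?AB (\<Pi>\<^sub>M i\<in>I. X \<Otimes>\<^sub>M Y) ?z) (Pi\<^sub>E I A) = (\<Prod>i\<in>I. emeasure (X \<Otimes>\<^sub>M Y) (A i))" .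
  qed
qed

section \<open>Sub-Gaussian random variables\<close>

lemma exp_le_id_plus_exp_square: "exp x \<le> x + exp (x\<^sup>2)" for x :: real
proof -
  have sq: "1 + x\<^sup>2 \<le> exp (x\<^sup>2)" by (rule exp_ge_add_one_self)
  consider "x \<le> 0" | "0 \<le> x" "x \<le> 1" | "1 \<le> x" by linarith
  then show ?thesis
  proof cases
    case 1
    define y where "y = - x"
    have y: "0 \<le> y" using 1 by (simp add: y_def)
    have "1 + y + y\<^sup>2 / 2 \<le> exp y" by (rule exp_lower_Taylor_quadratic[OF y])
    moreover have "0 < 1 - y + y\<^sup>2"
      using zero_le_power2[of "y - 1"] zero_le_power2[of y] y by (simp add: power2_diff)
         (smt (verit) zero_le_power2 power2_eq_square)
    ultimately have "(1 - y + y\<^sup>2) * (1 + y + y\<^sup>2 / 2) \<le> (1 - y + y\<^sup>2) * exp y"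
      by (intro mult_left_mono) auto
    moreover have "(1 - y + y\<^sup>2) * (1 + y + y\<^sup>2 / 2) = 1 + (y^2 + y^3 + y^4) / 2"
      by (simp add: field_simps power2_eq_square power3_eq_cube power4_eq_xxxx)
    ultimately have "1 \<le> (1 - y + y\<^sup>2) * exp y" using y by (smt (verit) divide_nonneg_nonneg zero_le_power)
    then have "exp (- y) \<le> 1 - y + y\<^sup>2"
      by (simp add: exp_minus field_simps)
    then have "exp x \<le> 1 + x + x\<^sup>2" by (simp add: y_def)
    then show ?thesis using sq by linarith
  next
    case 2
    then show ?thesis using exp_bound[of x] sq by linarith
  next
    case 3
    then have "x \<le> x\<^sup>2" by (simp add: power2_eq_square mult_le_cancel_right1)
    then have "exp x \<le> exp (x\<^sup>2)" by simp
    then show ?thesis using 3 by linarith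
  qed
qed

text \<open>
  The infimum in the definition of the norm need not be attained a priori; allowing the factor \<open>2\<close>
  avoids the question.
\<close>

lemma psi2_norm_le_imp_exp_moment:
  assumes "psi2_norm P \<xi> \<le> ennreal K" "0 < K"
  shows "(\<integral>\<^sup>+\<omega>. ennreal (exp ((\<xi> \<omega>)\<^sup>2 / (2 * K)\<^sup>2)) \<partial>P) \<le> 2"
proof -
  have "psi2_norm P \<xi> < ennreal (2 * K)"
    using assms by (intro le_less_trans[OF assms(1)]) (simp add: ennreal_less_iff)
  then obtain t where t: "0 < t" "(\<integral>\<^sup>+ \<omega>. ennreal (exp ((\<xi> \<omega>)\<^sup>2 / t\<^sup>2)) \<partial>P) \<le> 2" "ennreal t < ennreal (2 * K)"
    unfolding psi2_norm_def by (auto simp: INF_less_iff)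
  have "t \<le> 2 * K" using t by (simp add: ennreal_less_iff)
  have "(\<integral>\<^sup>+\<omega>. ennreal (exp ((\<xi> \<omega>)\<^sup>2 / (2 * K)\<^sup>2)) \<partial>P) \<le> (\<integral>\<^sup>+ \<omega>. ennreal (exp ((\<xi> \<omega>)\<^sup>2 / t\<^sup>2)) \<partial>P)"
    using t \<open>t \<le> 2 * K\<close> by (intro nn_integral_mono ennreal_leI) (auto intro!: divide_left_mono power_mono[of t "2 * K" 2, simplified])
  with t show ?thesis by order
qed

context prob_space
begin

lemma exp_moment_imp_moments:
  fixes \<xi> :: "'a \<Rightarrow> real"
  assumes [measurable]: "\<xi> \<in> borel_measurable M" and k: "0 < k"
    and E: "(\<integral>\<^sup>+\<omega>. ennreal (exp ((\<xi> \<omega>)\<^sup>2 / k\<^sup>2)) \<partial>M) \<le> 2"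
  shows "integrable M (\<lambda>\<omega>. exp ((\<xi> \<omega>)\<^sup>2 / k\<^sup>2))" "expectation (\<lambda>\<omega>. exp ((\<xi> \<omega>)\<^sup>2 / k\<^sup>2)) \<le> 2"
    and "integrable M \<xi>" "integrable M (\<lambda>\<omega>. (\<xi> \<omega>)\<^sup>2)" "integrable M (\<lambda>\<omega>. (\<xi> \<omega>)^4)"
    and "expectation (\<lambda>\<omega>. (\<xi> \<omega>)\<^sup>2) \<le> 2 * k\<^sup>2" "expectation (\<lambda>\<omega>. (\<xi> \<omega>)^4) \<le> 4 * k^4"
proof -
  let ?e = "\<lambda>\<omega>. exp ((\<xi> \<omega>)\<^sup>2 / k\<^sup>2)"
  show int: "integrable M ?e"
  proof (rule integrableI_nonneg)
    show "(\<integral>\<^sup>+x. ennreal (?e x) \<partial>M) < \<infinity>" using E by (rule order_le_less_trans) simp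
  qed auto
  have "ennreal (expectation ?e) \<le> ennreal 2"
    using E int by (simp add: nn_integral_eq_integral)
  then show e2: "expectation ?e \<le> 2" by (subst (asm) ennreal_le_iff) auto
  have b2: "(\<xi> \<omega>)\<^sup>2 \<le> k\<^sup>2 * ?e \<omega>" for \<omega>
  proof -
    have "(\<xi> \<omega>)\<^sup>2 / k\<^sup>2 \<le> ?e \<omega>" using exp_ge_add_one_self[of "(\<xi> \<omega>)\<^sup>2 / k\<^sup>2"] by linarith
    then show ?thesis using k by (simp add: field_simps)
  qed
  have b4: "(\<xi> \<omega>)^4 \<le> 2 * k^4 * ?e \<omega>" for \<omega>
  proof -
    let ?w = "(\<xi> \<omega>)\<^sup>2 / k\<^sup>2"
    have "1 + ?w + ?w\<^sup>2 / 2 \<le> exp ?w" by (rule exp_lower_Taylor_quadratic) simp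
    moreover have "0 \<le> ?w" by simp
    ultimately have "?w\<^sup>2 \<le> 2 * exp ?w" by linarith
    moreover have "?w\<^sup>2 = (\<xi> \<omega>)^4 / k^4" by (simp add: power_divide flip: power_mult)
    ultimately show ?thesis using k by (simp add: field_simps)
  qed
  show i2: "integrable M (\<lambda>\<omega>. (\<xi> \<omega>)\<^sup>2)"
    by (rule Bochner_Integration.integrable_bound[OF integrable_mult_right[OF int, of "k\<^sup>2"]])
       (use b2 in auto)
  show i4: "integrable M (\<lambda>\<omega>. (\<xi> \<omega>)^4)"
    by (rule Bochner_Integration.integrable_bound[OF integrable_mult_right[OF int, of "2 * k^4"]])
       (use b4 in auto)
  show "integrable M \<xi>"
    by (rule square_integrable_imp_integrable[OF _ i2]) simp
  have "expectation (\<lambda>\<omega>. (\<xi> \<omega>)\<^sup>2) \<le> expectation (\<lambda>\<omega>. k\<^sup>2 * ?e \<omega>)"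
    using i2 int b2 by (intro integral_mono) auto
  also have "\<dots> \<le> k\<^sup>2 * 2" using e2 by (simp add: mult_left_mono)
  finally show "expectation (\<lambda>\<omega>. (\<xi> \<omega>)\<^sup>2) \<le> 2 * k\<^sup>2" by simp
  have "expectation (\<lambda>\<omega>. (\<xi> \<omega>)^4) \<le> expectation (\<lambda>\<omega>. 2 * k^4 * ?e \<omega>)"
    using i4 int b4 by (intro integral_mono) auto
  also have "\<dots> = 2 * k^4 * expectation ?e" by simp
  also have "\<dots> \<le> 2 * k^4 * 2" using e2 k by (intro mult_left_mono) auto
  finally show "expectation (\<lambda>\<omega>. (\<xi> \<omega>)^4) \<le> 4 * k^4" by simp
qed

text \<open>
  Jensen's inequality \<open>E (e\<^sup>w)\<^sup>a \<le> (E e\<^sup>w)\<^sup>a \<le> 2\<^sup>a \<le> e\<^sup>a\<close>, given through the pointwise majorant that proves it, since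
  the majorant is needed inside other integrals.
\<close>

lemma exp_power_moment_le:
  fixes w :: "'a \<Rightarrow> real"
  assumes int: "integrable M (\<lambda>\<omega>. exp (w \<omega>))" and e2: "expectation (\<lambda>\<omega>. exp (w \<omega>)) \<le> 2"
    and a: "0 \<le> a" "a \<le> 1"
  shows "integrable M (\<lambda>\<omega>. (1 - a) + a * exp (w \<omega>) / 2)"
    and "exp (a * w \<omega>) \<le> exp a * ((1 - a) + a * exp (w \<omega>) / 2)"
    and "expectation (\<lambda>\<omega>. exp a * ((1 - a) + a * exp (w \<omega>) / 2)) \<le> exp a"
proof -
  show i: "integrable M (\<lambda>\<omega>. (1 - a) + a * exp (w \<omega>) / 2)" using int by auto
  have "exp (a * (w \<omega> - ln 2)) \<le> (1 - a) * exp 0 + a * exp (w \<omega> - ln 2)"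
    using convex_onD[OF exp_convex, of a 0 "w \<omega> - ln 2"] a by simp
  also have "\<dots> = (1 - a) + a * exp (w \<omega>) / 2" by (simp add: exp_diff)
  finally have "exp (a * ln 2) * exp (a * (w \<omega> - ln 2)) \<le> exp (a * ln 2) * ((1 - a) + a * exp (w \<omega>) / 2)"
    by (rule mult_left_mono) simp
  moreover have "exp (a * ln 2) * exp (a * (w \<omega> - ln 2)) = exp (a * w \<omega>)"
    by (simp add: algebra_simps flip: exp_add)
  moreover have "exp (a * ln 2) * ((1 - a) + a * exp (w \<omega>) / 2) \<le> exp a * ((1 - a) + a * exp (w \<omega>) / 2)"
    using a ln_2_less_1 mult_left_mono[of "ln 2" 1 a] by (intro mult_right_mono) auto
  ultimately show "exp (a * w \<omega>) \<le> exp a * ((1 - a) + a * exp (w \<omega>) / 2)" by linarith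
  have "expectation (\<lambda>\<omega>. exp a * ((1 - a) + a * exp (w \<omega>) / 2))
      = exp a * ((1 - a) + a * expectation (\<lambda>\<omega>. exp (w \<omega>)) / 2)"
    using int by (simp add: prob_space)
  also have "\<dots> \<le> exp a * 1"
    using e2 a mult_left_mono[OF e2 a(1)] by (intro mult_left_mono) auto
  finally show "expectation (\<lambda>\<omega>. exp a * ((1 - a) + a * exp (w \<omega>) / 2)) \<le> exp a" by simp
qed

text \<open>
  For \<open>k |t| \<le> 1\<close> the linear term of \<open>e^z \<le> z + e^(z^2)\<close> integrates to zero, leaving a power at most one of
  the given exponential moment. For \<open>k |t| > 1\<close> the mean is irrelevant: \<open>t \<xi> \<le> k\<^sup>2 t\<^sup>2 / 2 + \<xi>\<^sup>2 / (2 k\<^sup>2)\<close>, and the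
  constant lost is absorbed by \<open>k\<^sup>2 t\<^sup>2 / 2 > 1/2\<close>.
\<close>

lemma sub_gaussian_mgf:
  fixes \<xi> :: "'a \<Rightarrow> real"
  assumes [measurable]: "\<xi> \<in> borel_measurable M" and k: "0 < k"
    and E: "(\<integral>\<^sup>+\<omega>. ennreal (exp ((\<xi> \<omega>)\<^sup>2 / k\<^sup>2)) \<partial>M) \<le> 2"
    and mean: "expectation \<xi> = 0"
  shows "(\<integral>\<^sup>+\<omega>. ennreal (exp (t * \<xi> \<omega>)) \<partial>M) \<le> ennreal (exp (k\<^sup>2 * t\<^sup>2))"
proof -
  note mom = exp_moment_imp_moments[OF assms(1-3)]
  let ?w = "\<lambda>\<omega>. (\<xi> \<omega>)\<^sup>2 / k\<^sup>2"
  note pw = exp_power_moment_le[OF mom(1,2)]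
  show ?thesis
  proof (cases "k\<^sup>2 * t\<^sup>2 \<le> 1")
    case True
    define a where "a = k\<^sup>2 * t\<^sup>2"
    have a: "0 \<le> a" "a \<le> 1" using True by (auto simp: a_def)
    let ?g = "\<lambda>\<omega>. t * \<xi> \<omega> + exp a * ((1 - a) + a * exp (?w \<omega>) / 2)"
    have le: "exp (t * \<xi> \<omega>) \<le> ?g \<omega>" for \<omega>
    proof -
      have "(t * \<xi> \<omega>)\<^sup>2 = a * ?w \<omega>" using k by (simp add: a_def power_mult_distrib)
      then show ?thesis
        using exp_le_id_plus_exp_square[of "t * \<xi> \<omega>"] pw(2)[OF a, of \<omega>] by simp
    qed
    have int: "integrable M ?g" using pw(1)[OF a] mom(3) by (intro Bochner_Integration.integrable_add) auto
    have "(\<integral>\<^sup>+\<omega>. ennreal (exp (t * \<xi> \<omega>)) \<partial>M) \<le> (\<integral>\<^sup>+\<omega>. ennreal (?g \<omega>) \<partial>M)"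
      by (intro nn_integral_mono ennreal_leI le)
    also have "\<dots> = ennreal (expectation ?g)"
      using le by (intro nn_integral_eq_integral int AE_I2) (meson exp_ge_zero order_trans)
    also have "expectation ?g = expectation (\<lambda>\<omega>. exp a * ((1 - a) + a * exp (?w \<omega>) / 2))"
      using mom(3) pw(1)[OF a] by (subst Bochner_Integration.integral_add) (auto simp: mean)
    also have "ennreal \<dots> \<le> ennreal (exp a)" by (intro ennreal_leI pw(3) a)
    finally show ?thesis by (simp add: a_def)
  next
    case False
    define s where "s = k\<^sup>2 * t\<^sup>2"
    let ?g = "\<lambda>\<omega>. exp (s/2) * (exp (1/2) * ((1 - 1/2) + 1/2 * exp (?w \<omega>) / 2))"
    have le: "exp (t * \<xi> \<omega>) \<le> ?g \<omega>" for \<omega>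
    proof -
      have "2 * ((k * t) * (\<xi> \<omega> / k)) \<le> (k * t)\<^sup>2 + (\<xi> \<omega> / k)\<^sup>2"
        using zero_le_power2[of "k * t - \<xi> \<omega> / k"] unfolding power2_diff by linarith
      then have "t * \<xi> \<omega> \<le> s / 2 + 1/2 * ?w \<omega>"
        using k by (simp add: s_def power_mult_distrib power_divide)
      then have "exp (t * \<xi> \<omega>) \<le> exp (s / 2) * exp (1/2 * ?w \<omega>)"
        by (simp flip: exp_add)
      also have "\<dots> \<le> ?g \<omega>" using pw(2)[of "1/2" \<omega>] by (intro mult_left_mono) auto
      finally show ?thesis .
    qed
    have int: "integrable M ?g" using pw(1)[of "1/2"] by auto
    have "(\<integral>\<^sup>+\<omega>. ennreal (exp (t * \<xi> \<omega>)) \<partial>M) \<le> (\<integral>\<^sup>+\<omega>. ennreal (?g \<omega>) \<partial>M)"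
      by (intro nn_integral_mono ennreal_leI le)
    also have "\<dots> = ennreal (expectation ?g)"
      using le by (intro nn_integral_eq_integral int AE_I2) (meson exp_ge_zero order_trans)
    also have "ennreal (expectation ?g) \<le> ennreal (exp (s/2) * exp (1/2))"
      unfolding integral_mult_right_zero using pw(3)[of "1/2"] by (intro ennreal_leI mult_left_mono) auto
    also have "ennreal (exp (s/2) * exp (1/2)) \<le> ennreal (exp s)"
      using False by (intro ennreal_leI) (simp add: s_def flip: exp_add)
    finally show ?thesis by (simp add: s_def)
  qed
qed

text \<open>
  The product of exponentials is split by \<open>e^(t X) e^(t Y) \<le> (e^(2 t X) + e^(2 t Y)) / 2\<close>, which doubles the scale.
\<close>

lemma sub_gaussian_sum_mgf:
  fixes X Y :: "'a \<Rightarrow> real"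
  assumes [measurable]: "X \<in> borel_measurable M" "Y \<in> borel_measurable M" and k: "0 < k"
    and X: "(\<integral>\<^sup>+\<omega>. ennreal (exp ((X \<omega>)\<^sup>2 / k\<^sup>2)) \<partial>M) \<le> 2" "expectation X = 0"
    and Y: "(\<integral>\<^sup>+\<omega>. ennreal (exp ((Y \<omega>)\<^sup>2 / k\<^sup>2)) \<partial>M) \<le> 2" "expectation Y = 0"
  shows "(\<integral>\<^sup>+\<omega>. ennreal (exp (t * (X \<omega> + Y \<omega>))) \<partial>M) \<le> ennreal (exp ((2 * k)\<^sup>2 * t\<^sup>2))"
proof -
  have "(\<integral>\<^sup>+\<omega>. ennreal (exp (t * (X \<omega> + Y \<omega>))) \<partial>M)
      \<le> (\<integral>\<^sup>+\<omega>. ennreal (1/2) * ennreal (exp (2 * t * X \<omega>)) + ennreal (1/2) * ennreal (exp (2 * t * Y \<omega>)) \<partial>M)"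
  proof (rule nn_integral_mono)
    fix \<omega>
    have "2 * (exp (t * X \<omega>) * exp (t * Y \<omega>)) \<le> (exp (t * X \<omega>))\<^sup>2 + (exp (t * Y \<omega>))\<^sup>2"
      using zero_le_power2[of "exp (t * X \<omega>) - exp (t * Y \<omega>)"] by (simp add: power2_diff)
    then have "exp (t * (X \<omega> + Y \<omega>)) \<le> 1/2 * exp (2 * t * X \<omega>) + 1/2 * exp (2 * t * Y \<omega>)"
      by (simp add: exp_double distrib_left exp_add mult.assoc)
    then have "ennreal (exp (t * (X \<omega> + Y \<omega>))) \<le> ennreal (1/2 * exp (2 * t * X \<omega>) + 1/2 * exp (2 * t * Y \<omega>))"
      by (rule ennreal_leI)
    then show "ennreal (exp (t * (X \<omega> + Y \<omega>)))
       \<le> ennreal (1/2) * ennreal (exp (2 * t * X \<omega>)) + ennreal (1/2) * ennreal (exp (2 * t * Y \<omega>))"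
      by (subst (asm) ennreal_plus) (simp_all only: ennreal_mult' zero_le_mult_iff exp_ge_zero, simp_all)
  qed
  also have "\<dots> = ennreal (1/2) * (\<integral>\<^sup>+\<omega>. ennreal (exp (2 * t * X \<omega>)) \<partial>M) + ennreal (1/2) * (\<integral>\<^sup>+\<omega>. ennreal (exp (2 * t * Y \<omega>)) \<partial>M)"
    by (subst nn_integral_add) (auto simp: nn_integral_cmult)
  also have "\<dots> \<le> ennreal (1/2) * ennreal (exp (k\<^sup>2 * (2 * t)\<^sup>2)) + ennreal (1/2) * ennreal (exp (k\<^sup>2 * (2 * t)\<^sup>2))"
    by (intro add_mono mult_left_mono sub_gaussian_mgf assms) auto
  also have "\<dots> = (ennreal (1/2) + ennreal (1/2)) * ennreal (exp (k\<^sup>2 * (2 * t)\<^sup>2))"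
    by (simp only: distrib_right)
  also have "ennreal (1/2) + ennreal (1/2) = 1"
    by (subst ennreal_plus[symmetric]) auto
  finally show ?thesis by (simp add: power_mult_distrib mult_ac)
qed

lemma second_moment_sum_indep:
  fixes X :: "'i \<Rightarrow> 'a \<Rightarrow> real"
  assumes "finite I" "indep_vars (\<lambda>_. borel) X I"
    and "\<And>i. i \<in> I \<Longrightarrow> integrable M (\<lambda>\<omega>. (X i \<omega>)\<^sup>2)" "\<And>i. i \<in> I \<Longrightarrow> expectation (X i) = 0"
  shows "integrable M (\<lambda>\<omega>. (\<Sum>i\<in>I. X i \<omega>)\<^sup>2)
    \<and> expectation (\<lambda>\<omega>. (\<Sum>i\<in>I. X i \<omega>)\<^sup>2) = (\<Sum>i\<in>I. expectation (\<lambda>\<omega>. (X i \<omega>)\<^sup>2))"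
  using assms
proof (induction I)
  case (insert i I)
  have [measurable]: "X j \<in> borel_measurable M" if "j \<in> insert i I" for j
    using insert.prems(1) that by (auto simp: indep_vars_def)
  have I: "indep_vars (\<lambda>_. borel) X I" using insert.prems(1) by (rule indep_vars_subset) auto
  have meas: "(\<lambda>\<omega>. \<Sum>i\<in>I. X i \<omega>) \<in> borel_measurable M" by (intro borel_measurable_sum) simp
  have IH: "integrable M (\<lambda>\<omega>. (\<Sum>i\<in>I. X i \<omega>)\<^sup>2)"
    "expectation (\<lambda>\<omega>. (\<Sum>i\<in>I. X i \<omega>)\<^sup>2) = (\<Sum>i\<in>I. expectation (\<lambda>\<omega>. (X i \<omega>)\<^sup>2))"
    using insert.IH[OF I] insert.prems by auto
  have ind: "indep_var borel (X i) borel (\<lambda>\<omega>. \<Sum>i\<in>I. X i \<omega>)"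
    using insert by (intro indep_vars_sum) auto
  have i1: "integrable M (X i)" by (rule square_integrable_imp_integrable[OF _ insert.prems(2)]) auto
  have i2: "integrable M (\<lambda>\<omega>. \<Sum>i\<in>I. X i \<omega>)" by (rule square_integrable_imp_integrable[OF meas IH(1)])
  have c: "integrable M (\<lambda>\<omega>. X i \<omega> * (\<Sum>i\<in>I. X i \<omega>))"
    "expectation (\<lambda>\<omega>. X i \<omega> * (\<Sum>i\<in>I. X i \<omega>)) = 0"
    using indep_var_integrable[OF ind i1 i2] indep_var_lebesgue_integral[OF ind i1 i2] insert.prems(3)[of i] by auto
  have eq: "(\<lambda>\<omega>. (\<Sum>i\<in>insert i I. X i \<omega>)\<^sup>2)
      = (\<lambda>\<omega>. (X i \<omega>)\<^sup>2 + (2 * (X i \<omega> * (\<Sum>i\<in>I. X i \<omega>)) + (\<Sum>i\<in>I. X i \<omega>)\<^sup>2))"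
    using insert.hyps by (simp add: power2_sum algebra_simps)
  have iX: "integrable M (\<lambda>\<omega>. (X i \<omega>)\<^sup>2)" using insert.prems(2) by simp
  show ?case
    unfolding eq using iX c IH insert.hyps by simp
qed simp

text \<open>
  Chebyshev's inequality for a sum of independent variables with common mean \<open>q\<close>.
\<close>

lemma iid_sum_lower_deviation:
  fixes X :: "'i \<Rightarrow> 'a \<Rightarrow> real" and q V :: real
  assumes I: "finite I" "I \<noteq> {}" and ind: "indep_vars (\<lambda>_. borel) X I" and q: "0 < q"
    and sq: "\<And>i. i \<in> I \<Longrightarrow> integrable M (\<lambda>\<omega>. (X i \<omega>)\<^sup>2)" "\<And>i. i \<in> I \<Longrightarrow> expectation (\<lambda>\<omega>. (X i \<omega>)\<^sup>2) \<le> V"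
    and mean: "\<And>i. i \<in> I \<Longrightarrow> expectation (X i) = q"
  shows "prob {\<omega> \<in> space M. (\<Sum>i\<in>I. X i \<omega>) \<le> card I * q / 2} \<le> 4 * V / (card I * q\<^sup>2)"
proof -
  let ?n = "real (card I)"
  have n: "0 < ?n" using I by (simp add: card_gt_0_iff)
  have [measurable]: "X j \<in> borel_measurable M" if "j \<in> I" for j
    using ind that by (auto simp: indep_vars_def)
  have int: "integrable M (X i)" if "i \<in> I" for i
    by (rule square_integrable_imp_integrable[OF _ sq(1)[OF that]]) (simp add: that)
  let ?Y = "\<lambda>i \<omega>. X i \<omega> - q"
  have indY: "indep_vars (\<lambda>_. borel) ?Y I"
    by (rule indep_vars_compose2[OF ind, of "\<lambda>_ x. x - q"]) simp
  have e: "(\<lambda>\<omega>. (?Y i \<omega>)\<^sup>2) = (\<lambda>\<omega>. (X i \<omega>)\<^sup>2 - 2 * q * X i \<omega> + q\<^sup>2)" for i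
    by (simp add: power2_diff algebra_simps)
  have iY: "integrable M (\<lambda>\<omega>. (?Y i \<omega>)\<^sup>2)" if "i \<in> I" for i
    unfolding e using sq(1)[OF that] int[OF that] by auto
  have vY: "expectation (\<lambda>\<omega>. (?Y i \<omega>)\<^sup>2) \<le> V" if "i \<in> I" for i
  proof -
    have "expectation (\<lambda>\<omega>. (?Y i \<omega>)\<^sup>2) = expectation (\<lambda>\<omega>. (X i \<omega>)\<^sup>2) - 2 * q * q + q\<^sup>2"
      unfolding e using sq(1)[OF that] int[OF that] mean[OF that] by (simp add: prob_space)
    also have "\<dots> \<le> expectation (\<lambda>\<omega>. (X i \<omega>)\<^sup>2)" by (simp add: power2_eq_square)
    finally show ?thesis using sq(2)[OF that] by linarith
  qed
  have mY: "expectation (?Y i) = 0" if "i \<in> I" for i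
    using int[OF that] mean[OF that] by (simp add: prob_space)
  have sm: "integrable M (\<lambda>\<omega>. (\<Sum>i\<in>I. ?Y i \<omega>)\<^sup>2)"
     "expectation (\<lambda>\<omega>. (\<Sum>i\<in>I. ?Y i \<omega>)\<^sup>2) = (\<Sum>i\<in>I. expectation (\<lambda>\<omega>. (?Y i \<omega>)\<^sup>2))"
    using second_moment_sum_indep[OF I(1) indY iY mY] by auto
  have sm_le: "expectation (\<lambda>\<omega>. (\<Sum>i\<in>I. ?Y i \<omega>)\<^sup>2) \<le> ?n * V"
    unfolding sm(2) using sum_mono[of I _ "\<lambda>_. V", OF vY] by simp
  define c where "c = (?n * q / 2)\<^sup>2"
  have c: "0 < c" using n q by (simp add: c_def)
  have "prob {\<omega> \<in> space M. (\<Sum>i\<in>I. X i \<omega>) \<le> ?n * q / 2} \<le> prob {\<omega> \<in> space M. c \<le> (\<Sum>i\<in>I. ?Y i \<omega>)\<^sup>2}"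
  proof (rule finite_measure_mono)
    show "{\<omega> \<in> space M. c \<le> (\<Sum>i\<in>I. ?Y i \<omega>)\<^sup>2} \<in> events" by measurable
    show "{\<omega> \<in> space M. (\<Sum>i\<in>I. X i \<omega>) \<le> ?n * q / 2} \<subseteq> {\<omega> \<in> space M. c \<le> (\<Sum>i\<in>I. ?Y i \<omega>)\<^sup>2}"
    proof safe
      fix \<omega> assume "(\<Sum>i\<in>I. X i \<omega>) \<le> ?n * q / 2"
      then have "?n * q / 2 \<le> - (\<Sum>i\<in>I. ?Y i \<omega>)" by (simp add: sum_subtractf mult.commute)
      then have "c \<le> (- (\<Sum>i\<in>I. ?Y i \<omega>))\<^sup>2" unfolding c_def using n q by (intro power_mono) auto
      then show "c \<le> (\<Sum>i\<in>I. ?Y i \<omega>)\<^sup>2" by simp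
    qed
  qed
  also have "\<dots> \<le> expectation (\<lambda>\<omega>. (\<Sum>i\<in>I. ?Y i \<omega>)\<^sup>2) / c"
    using c by (intro integral_Markov_inequality_measure[where A = "{}"] sm) auto
  also have "\<dots> \<le> ?n * V / c" using sm_le c by (intro divide_right_mono) auto
  also have "\<dots> = 4 * V / (?n * q\<^sup>2)" using n q by (simp add: c_def power2_eq_square field_simps)
  finally show ?thesis .
qed

end

section \<open>Projections of sub-Gaussian vectors\<close>

abbreviation std_normal :: "real measure" where
  "std_normal \<equiv> density lborel std_normal_density"

lemma nn_integral_normal_density_one: "0 < \<sigma> \<Longrightarrow> (\<integral>\<^sup>+x. ennreal (normal_density \<mu> \<sigma> x) \<partial>lborel) = 1"
  by (subst nn_integral_eq_integral) auto

lemma std_normal_mgf: "(\<integral>\<^sup>+g. ennreal (exp (c * g)) \<partial>std_normal) = ennreal (exp (c\<^sup>2 / 2))"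
proof -
  have "std_normal_density g * exp (c * g) = exp (c\<^sup>2 / 2) * normal_density c 1 g" for g
    by (simp add: normal_density_def power2_diff field_simps flip: exp_add)
  then have "(\<integral>\<^sup>+g. ennreal (exp (c * g)) \<partial>std_normal) = (\<integral>\<^sup>+g. ennreal (exp (c\<^sup>2 / 2)) * ennreal (normal_density c 1 g) \<partial>lborel)"
    by (subst nn_integral_density) (auto simp flip: ennreal_mult')
  also have "\<dots> = ennreal (exp (c\<^sup>2 / 2))"
    by (subst nn_integral_cmult) (auto simp: nn_integral_normal_density_one)
  finally show ?thesis .
qed

lemma std_normal_exp_square: "(\<integral>\<^sup>+g. ennreal (exp (g\<^sup>2 / 4)) \<partial>std_normal) = ennreal (sqrt 2)"
proof -
  have "std_normal_density g * exp (g\<^sup>2 / 4) = sqrt 2 * normal_density 0 (sqrt 2) g" for g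
    by (simp add: normal_density_def real_sqrt_mult field_simps flip: exp_add)
  then have "(\<integral>\<^sup>+g. ennreal (exp (g\<^sup>2 / 4)) \<partial>std_normal) = (\<integral>\<^sup>+g. ennreal (sqrt 2) * ennreal (normal_density 0 (sqrt 2) g) \<partial>lborel)"
    by (subst nn_integral_density) (auto simp flip: ennreal_mult')
  also have "\<dots> = ennreal (sqrt 2)"
    by (subst nn_integral_cmult) (auto simp: nn_integral_normal_density_one)
  finally show ?thesis .
qed

text \<open>
  The exponent is a quadratic form with coefficients \<open>Z\<^sub>k\<close>, and \<open>exp (Z\<^sub>k\<^sup>2 / (8 K\<^sup>2))\<close> is the mean of \<open>exp (Z\<^sub>k g / (2 K))\<close>
  over a standard normal \<open>g\<close>. After introducing one normal variable per \<open>k\<close> and exchanging the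
  integrals, the exponent is linear in the independent \<open>y (z j)\<close> and their generating functions can be
  used one by one; by Bessel's inequality what remains is \<open>E exp (g\<^sup>2 / 4) = \<surd>2\<close> for each \<open>k\<close>. The bound depends
  on the number of vectors \<open>a k\<close> only, not on the number of coordinates.
\<close>

lemma projection_exp_moment:
  fixes D :: "'c measure" and y :: "'c \<Rightarrow> real" and a :: "'k \<Rightarrow> 'j \<Rightarrow> real"
  assumes D: "prob_space D" and y[measurable]: "y \<in> borel_measurable D" and K: "0 < K"
    and mgf: "\<And>t. (\<integral>\<^sup>+z. ennreal (exp (t * y z)) \<partial>D) \<le> ennreal (exp (K\<^sup>2 * t\<^sup>2))"
    and fin: "finite J" "finite S"
    and bessel: "\<And>g. (\<Sum>j\<in>J. (\<Sum>k\<in>S. g k * a k j)\<^sup>2) \<le> (\<Sum>k\<in>S. (g k)\<^sup>2)"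
  shows "(\<integral>\<^sup>+z. ennreal (exp ((\<Sum>k\<in>S. (\<Sum>j\<in>J. a k j * y (z j))\<^sup>2) / (8 * K\<^sup>2))) \<partial>(\<Pi>\<^sub>M j\<in>J. D)) \<le> 2 ^ card S"
proof -
  interpret D: prob_space D by (rule D)
  interpret N: prob_space std_normal by (rule prob_space_normal_density) simp
  interpret DJ: product_prob_space "\<lambda>_. D" J by unfold_locales
  interpret NS: product_prob_space "\<lambda>_. std_normal" S by unfold_locales
  interpret PD: prob_space "\<Pi>\<^sub>M j\<in>J. D" by (rule prob_space_PiM) (rule D)
  interpret PN: prob_space "\<Pi>\<^sub>M k\<in>S. std_normal" by (rule prob_space_PiM) unfold_locales
  interpret PP: pair_sigma_finite "\<Pi>\<^sub>M k\<in>S. std_normal" "\<Pi>\<^sub>M j\<in>J. D" by unfold_locales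
  \<comment> \<open>chosen so that \<open>c\<^sup>2 / 2 = 1 / (8 K\<^sup>2)\<close>\<close>
  define c where "c = 1 / (2 * K)"
  define Zk where "Zk k z = (\<Sum>j\<in>J. a k j * y (z j))" for k z
  have Zk[measurable]: "Zk k \<in> borel_measurable (\<Pi>\<^sub>M j\<in>J. D)" for k
    unfolding Zk_def[abs_def] by measurable
  have c2: "c\<^sup>2 / 2 = 1 / (8 * K\<^sup>2)" "K\<^sup>2 * c\<^sup>2 = 1/4" using K by (simp_all add: c_def power2_eq_square)
  let ?f = "\<lambda>g z. (\<Prod>k\<in>S. ennreal (exp (c * Zk k z * g k)))"
  have "(\<integral>\<^sup>+z. ennreal (exp ((\<Sum>k\<in>S. (Zk k z)\<^sup>2) / (8 * K\<^sup>2))) \<partial>(\<Pi>\<^sub>M j\<in>J. D))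
      = (\<integral>\<^sup>+z. (\<integral>\<^sup>+g. ?f g z \<partial>(\<Pi>\<^sub>M k\<in>S. std_normal)) \<partial>(\<Pi>\<^sub>M j\<in>J. D))"
  proof (rule nn_integral_cong)
    fix z
    have "(\<integral>\<^sup>+g. ?f g z \<partial>(\<Pi>\<^sub>M k\<in>S. std_normal)) = (\<Prod>k\<in>S. (\<integral>\<^sup>+g. ennreal (exp (c * Zk k z * g)) \<partial>std_normal))"
      by (rule NS.product_nn_integral_prod[OF fin(2)]) simp
    also have "\<dots> = (\<Prod>k\<in>S. ennreal (exp ((Zk k z)\<^sup>2 / (8 * K\<^sup>2))))"
      unfolding std_normal_mgf using c2(1)
      by (intro prod.cong refl) (simp add: power_mult_distrib field_simps)
    also have "\<dots> = ennreal (exp ((\<Sum>k\<in>S. (Zk k z)\<^sup>2) / (8 * K\<^sup>2)))"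
      using fin by (simp add: prod_ennreal exp_sum sum_divide_distrib)
    finally show "ennreal (exp ((\<Sum>k\<in>S. (Zk k z)\<^sup>2) / (8 * K\<^sup>2))) = (\<integral>\<^sup>+g. ?f g z \<partial>(\<Pi>\<^sub>M k\<in>S. std_normal))" ..
  qed
  also have "\<dots> = (\<integral>\<^sup>+g. (\<integral>\<^sup>+z. ?f g z \<partial>(\<Pi>\<^sub>M j\<in>J. D)) \<partial>(\<Pi>\<^sub>M k\<in>S. std_normal))"
  proof (rule PP.Fubini')
    have [measurable]: "(\<lambda>x. fst x k) \<in> borel_measurable ((\<Pi>\<^sub>M k\<in>S. std_normal) \<Otimes>\<^sub>M (\<Pi>\<^sub>M j\<in>J. D))" if "k \<in> S" for k
      using that measurable_compose[OF measurable_fst measurable_component_singleton[of k S "\<lambda>_. std_normal"]] by simp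
    show "case_prod ?f \<in> borel_measurable ((\<Pi>\<^sub>M k\<in>S. std_normal) \<Otimes>\<^sub>M (\<Pi>\<^sub>M j\<in>J. D))"
      unfolding case_prod_beta by (intro borel_measurable_prod_ennreal) measurable
  qed
  also have "\<dots> \<le> (\<integral>\<^sup>+g. (\<Prod>k\<in>S. ennreal (exp ((g k)\<^sup>2 / 4))) \<partial>(\<Pi>\<^sub>M k\<in>S. std_normal))"
  proof (rule nn_integral_mono)
    fix g
    define w where "w j = (\<Sum>k\<in>S. g k * a k j)" for j
    have "(\<Sum>k\<in>S. c * Zk k z * g k) = (\<Sum>j\<in>J. c * w j * y (z j))" for z
      unfolding Zk_def w_def sum_distrib_left sum_distrib_right by (subst sum.swap) (simp add: mult_ac)
    then have "?f g z = (\<Prod>j\<in>J. ennreal (exp (c * w j * y (z j))))" for z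
      using fin by (simp add: prod_ennreal flip: exp_sum)
    then have "(\<integral>\<^sup>+z. ?f g z \<partial>(\<Pi>\<^sub>M j\<in>J. D)) = (\<Prod>j\<in>J. (\<integral>\<^sup>+z. ennreal (exp (c * w j * y z)) \<partial>D))"
      by (simp only:) (rule DJ.product_nn_integral_prod[OF fin(1)], simp)
    also have "\<dots> \<le> (\<Prod>j\<in>J. ennreal (exp (K\<^sup>2 * (c * w j)\<^sup>2)))"
      by (intro prod_mono_ennreal mgf)
    also have "\<dots> = ennreal (exp (\<Sum>j\<in>J. K\<^sup>2 * c\<^sup>2 * (w j)\<^sup>2))"
      using fin by (simp add: prod_ennreal exp_sum power_mult_distrib mult_ac)
    also have "(\<Sum>j\<in>J. K\<^sup>2 * c\<^sup>2 * (w j)\<^sup>2) = (\<Sum>j\<in>J. (w j)\<^sup>2) / 4"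
      unfolding c2 by (simp add: sum_divide_distrib)
    also have "ennreal (exp ((\<Sum>j\<in>J. (w j)\<^sup>2) / 4)) \<le> ennreal (exp ((\<Sum>k\<in>S. (g k)\<^sup>2) / 4))"
      using bessel[of g] by (intro ennreal_leI) (simp add: w_def)
    also have "\<dots> = (\<Prod>k\<in>S. ennreal (exp ((g k)\<^sup>2 / 4)))"
      using fin by (simp add: prod_ennreal exp_sum sum_divide_distrib)
    finally show "(\<integral>\<^sup>+z. ?f g z \<partial>(\<Pi>\<^sub>M j\<in>J. D)) \<le> (\<Prod>k\<in>S. ennreal (exp ((g k)\<^sup>2 / 4)))" .
  qed
  also have "\<dots> = (\<Prod>k\<in>S. (\<integral>\<^sup>+g. ennreal (exp (g\<^sup>2 / 4)) \<partial>std_normal))"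
    by (rule NS.product_nn_integral_prod[OF fin(2)]) simp
  also have "\<dots> \<le> (\<Prod>k\<in>S. 2)"
    unfolding std_normal_exp_square
  proof (intro prod_mono_ennreal)
    have "sqrt 2 \<le> 2" by (rule real_le_lsqrt) auto
    then have "ennreal (sqrt 2) \<le> ennreal 2" by (rule ennreal_leI)
    then show "ennreal (sqrt 2) \<le> 2" by simp
  qed
  also have "\<dots> = 2 ^ card S" by simp
  finally show ?thesis by (simp add: Zk_def)
qed

text \<open>
  A linearized union bound. Every \<open>s\<close>-sparse vector is supported on a set of exactly \<open>min s p\<close> indices;
  applying \<open>t \<le> L + exp (t - L)\<close> to the scaled gain replaces the maximum over the supports by a sum of
  exponentials, whose mean is at most \<open>exp L\<close> for the right \<open>L\<close>.
\<close>

lemma max_gain_le_exp_sum: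
  assumes fin: "finite I" and K: "0 < K"
    and orth: "\<And>S k l. S \<subseteq> {1..p} \<Longrightarrow> k \<in> S \<Longrightarrow> l \<in> S \<Longrightarrow> k \<noteq> l \<Longrightarrow> (\<Sum>i\<in>I. u S k i * u S l i) = 0"
    and nrm: "\<And>S k. S \<subseteq> {1..p} \<Longrightarrow> k \<in> S \<Longrightarrow> (\<Sum>i\<in>I. (u S k i)\<^sup>2) = 1 \<or> (\<forall>i\<in>I. u S k i = 0)"
    and span: "\<And>S b. S \<subseteq> {1..p} \<Longrightarrow> \<exists>a. \<forall>i\<in>I. (\<Sum>k\<in>S. b k * fst (d i) k) = (\<Sum>k\<in>S. a k * u S k i)"
    and L: "0 \<le> L"
  shows "max_gain p s I \<pi> d \<le> ennreal (8 * K\<^sup>2) * (ennreal L + ennreal (exp (- L)) *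
     (\<Sum>S | S \<subseteq> {1..p} \<and> card S = min s p.
        ennreal (exp ((\<Sum>k\<in>S. (\<Sum>i\<in>I. u S k i * snd (d (\<pi> i)))\<^sup>2) / (8 * K\<^sup>2)))))"
  unfolding max_gain_def
proof (rule SUP_least)
  fix b assume b: "b \<in> sparse_rat p s"
  let ?\<S> = "{S. S \<subseteq> {1..p} \<and> card S = min s p}"
  let ?Q = "\<lambda>S. (\<Sum>k\<in>S. (\<Sum>i\<in>I. u S k i * snd (d (\<pi> i)))\<^sup>2) / (8 * K\<^sup>2)"
  have finS: "finite ?\<S>" by simp
  have "card {k \<in> {1..p}. b k \<noteq> 0} \<le> card {1..p}" by (rule card_mono) auto
  then have "card {k \<in> {1..p}. b k \<noteq> 0} \<le> min s p"
    using b by (simp add: sparse_rat_def l0_norm_def)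
  then have "\<exists>S. {k \<in> {1..p}. b k \<noteq> 0} \<subseteq> S \<and> S \<subseteq> {1..p} \<and> card S = min s p"
    by (rule exists_subset_between) auto
  then obtain S where S: "{k \<in> {1..p}. b k \<noteq> 0} \<subseteq> S" "S \<subseteq> {1..p}" "card S = min s p" by blast
  have "gain p I \<pi> d b \<le> (\<Sum>k\<in>S. (\<Sum>i\<in>I. u S k i * snd (d (\<pi> i)))\<^sup>2)"
    using S by (intro gain_le_projection fin orth nrm span) (auto intro: finite_subset)
  also have "\<dots> = 8 * K\<^sup>2 * ?Q S" using K by simp
  also have "\<dots> \<le> 8 * K\<^sup>2 * (L + exp (- L) * (\<Sum>S\<in>?\<S>. exp (?Q S)))"
  proof (rule mult_left_mono)
    have "?Q S - L \<le> exp (?Q S - L)" using exp_ge_add_one_self[of "?Q S - L"] by linarith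
    also have "\<dots> = exp (- L) * exp (?Q S)" by (simp flip: exp_add)
    also have "\<dots> \<le> exp (- L) * (\<Sum>S\<in>?\<S>. exp (?Q S))"
      using S finS by (intro mult_left_mono member_le_sum[of S ?\<S> "\<lambda>S. exp (?Q S)"]) auto
    finally show "?Q S \<le> L + exp (- L) * (\<Sum>S\<in>?\<S>. exp (?Q S))" by linarith
  qed simp
  finally have "ennreal (gain p I \<pi> d b) \<le> ennreal (8 * K\<^sup>2 * (L + exp (- L) * (\<Sum>S\<in>?\<S>. exp (?Q S))))"
    by (rule ennreal_leI)
  also have "\<dots> = ennreal (8 * K\<^sup>2) * (ennreal L + ennreal (exp (- L)) * (\<Sum>S\<in>?\<S>. ennreal (exp (?Q S))))"
    using L by (simp only: ennreal_mult' ennreal_plus sum_ennreal zero_le_mult_iff sum_nonneg exp_ge_zero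
        zero_le_power2 zero_le_numeral simp_thms)
  finally show "ennreal (gain p I \<pi> d b) \<le> ennreal (8 * K\<^sup>2) * (ennreal L + ennreal (exp (- L)) *
      (\<Sum>S\<in>?\<S>. ennreal (exp (?Q S))))" .
qed

text \<open>
  Since \<open>\<pi> ` I\<close> avoids \<open>I\<close>, the rows used are functions of the observations in \<open>I\<close> and the responses
  used are functions of the others. Freezing the former fixes the projections, and only the responses
  are integrated.
\<close>

lemma nn_integral_max_gain_le:
  fixes D :: "((nat \<Rightarrow> real) \<times> real) measure" and p s n :: nat
  assumes D: "prob_space D" and sets_D: "sets D = sets (borel_vec p \<Otimes>\<^sub>M borel)" and K: "0 < K"
    and mgf: "\<And>t. (\<integral>\<^sup>+z. ennreal (exp (t * snd z)) \<partial>D) \<le> ennreal (exp (K\<^sup>2 * t\<^sup>2))"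
    and \<pi>: "\<pi> permutes {1..n}" and I: "I \<subseteq> {1..n}" "\<pi> ` I \<inter> I = {}" and p: "1 \<le> p"
  defines "L \<equiv> real (min s p) * (ln (real p) + ln 2)"
  shows "(\<integral>\<^sup>+d. max_gain p s I \<pi> d \<partial>(\<Pi>\<^sub>M i\<in>{1..n}. D)) \<le> ennreal (8 * K\<^sup>2 * (1 + L))"
proof -
  interpret D: prob_space D by (rule D)
  interpret product_sigma_finite "\<lambda>_. D" by unfold_locales
  define J where "J = {1..n} - I"
  have IJ: "I \<inter> J = {}" "finite I" "finite J" "{1..n} = I \<union> J"
    using I finite_subset[OF I(1)] by (auto simp: J_def)
  have \<pi>I: "\<pi> ` I \<subseteq> J" using I permutes_image[OF \<pi>] by (auto simp: J_def)
  have inj: "inj_on \<pi> I" using permutes_inj[OF \<pi>] by (rule inj_on_subset) auto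
  interpret PI: prob_space "\<Pi>\<^sub>M i\<in>I. D" by (rule prob_space_PiM) (rule D)
  interpret PJ: prob_space "\<Pi>\<^sub>M i\<in>J. D" by (rule prob_space_PiM) (rule D)
  let ?\<S> = "{S. S \<subseteq> {1..p} \<and> card S = min s p}"
  have L0: "0 \<le> L" using p by (auto simp: L_def intro!: mult_nonneg_nonneg add_nonneg_nonneg)
  have snd_D: "snd \<in> borel_measurable D"
    using measurable_cong_sets[OF sets_D refl, of borel] measurable_snd by blast
  have meas: "max_gain p s I \<pi> \<in> borel_measurable (\<Pi>\<^sub>M i\<in>I\<union>J. D)"
  proof -
    have "sets (\<Pi>\<^sub>M i\<in>I\<union>J. D) = sets (\<Pi>\<^sub>M i\<in>I\<union>J. borel_vec p \<Otimes>\<^sub>M borel)"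
      by (intro sets_PiM_cong refl sets_D)
    then show ?thesis
      using measurable_max_gain[of I "I \<union> J" \<pi> p s] \<pi>I measurable_cong_sets[of _ _ borel borel] by blast
  qed
  have inner: "(\<integral>\<^sup>+z. max_gain p s I \<pi> (merge I J (x, z)) \<partial>(\<Pi>\<^sub>M i\<in>J. D)) \<le> ennreal (8 * K\<^sup>2 * (1 + L))" for x
  proof -
    define basis where "basis S v \<longleftrightarrow>
      (\<forall>k\<in>S. \<forall>l\<in>S. k \<noteq> l \<longrightarrow> (\<Sum>i\<in>I. v k i * v l i) = 0) \<and>
      (\<forall>k\<in>S. (\<Sum>i\<in>I. (v k i)\<^sup>2) = 1 \<or> (\<forall>i\<in>I. v k i = 0)) \<and>
      (\<forall>b. \<exists>a. \<forall>i\<in>I. (\<Sum>k\<in>S. b k * fst (x i) k) = (\<Sum>k\<in>S. a k * v k i))"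
      for S and v :: "nat \<Rightarrow> nat \<Rightarrow> real"
    define u where "u S = (SOME v. basis S v)" for S
    have u': "basis S (u S)" if "S \<subseteq> {1..p}" for S
    proof -
      have "\<exists>v. basis S v"
        unfolding basis_def using finite_subset[OF that] IJ(2)
        by (intro gram_schmidt_orthonormal_or_zero) simp_all
      then show ?thesis unfolding u_def by (rule someI_ex)
    qed
    have u: "(\<Sum>i\<in>I. u S k i * u S l i) = 0" if "S \<subseteq> {1..p}" "k \<in> S" "l \<in> S" "k \<noteq> l" for S k l
      using u'[OF that(1)] that unfolding basis_def by blast
    have u2: "(\<Sum>i\<in>I. (u S k i)\<^sup>2) = 1 \<or> (\<forall>i\<in>I. u S k i = 0)" if "S \<subseteq> {1..p}" "k \<in> S" for S k
      using u'[OF that(1)] that unfolding basis_def by blast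
    have u3: "\<exists>a. \<forall>i\<in>I. (\<Sum>k\<in>S. b k * fst (x i) k) = (\<Sum>k\<in>S. a k * u S k i)" if "S \<subseteq> {1..p}" for S b
      using u'[OF that(1)] unfolding basis_def by blast
    define E where "E S z = exp ((\<Sum>k\<in>S. (\<Sum>i\<in>I. u S k i * snd (z (\<pi> i)))\<^sup>2) / (8 * K\<^sup>2))"
      for S and z :: "nat \<Rightarrow> (nat \<Rightarrow> real) \<times> real"
    have E_meas[measurable]: "E S \<in> borel_measurable (\<Pi>\<^sub>M i\<in>J. D)" for S
    proof -
      have "(\<lambda>z. snd (z (\<pi> i))) \<in> borel_measurable (\<Pi>\<^sub>M i\<in>J. D)" if "i \<in> I" for i
        by (rule measurable_compose[OF _ snd_D], rule measurable_component_singleton) (use \<pi>I that in auto)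
      then show ?thesis unfolding E_def[abs_def] by measurable
    qed
    have E_le: "(\<integral>\<^sup>+z. ennreal (E S z) \<partial>(\<Pi>\<^sub>M i\<in>J. D)) \<le> 2 ^ min s p" if S: "S \<in> ?\<S>" for S
    proof -
      \<comment> \<open>the basis vectors are indexed by the rows in \<open>I\<close>; the response paired with row \<open>i\<close> sits at \<open>\<pi> i\<close>\<close>
      define a where "a k j = (if j \<in> \<pi> ` I then u S k (inv \<pi> j) else 0)" for k j
      have reidx: "(\<Sum>j\<in>J. if j \<in> \<pi> ` I then h j else 0) = (\<Sum>i\<in>I. h (\<pi> i))" for h :: "nat \<Rightarrow> real"
      proof -
        have "(\<Sum>j\<in>J. if j \<in> \<pi> ` I then h j else 0) = sum h (\<pi> ` I)"
          using \<pi>I IJ by (simp add: sum.If_cases Int_absorb1)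
        then show ?thesis using inj by (simp add: sum.reindex)
      qed
      have inv: "inv \<pi> (\<pi> i) = i" for i using permutes_inverses(2)[OF \<pi>] .
      have "(\<Sum>j\<in>J. a k j * snd (z j)) = (\<Sum>i\<in>I. u S k i * snd (z (\<pi> i)))" for k and z :: "nat \<Rightarrow> (nat \<Rightarrow> real) \<times> real"
      proof -
        have "(\<Sum>j\<in>J. a k j * snd (z j)) = (\<Sum>j\<in>J. if j \<in> \<pi> ` I then u S k (inv \<pi> j) * snd (z j) else 0)"
          by (intro sum.cong) (auto simp: a_def)
        then show ?thesis by (simp add: reidx inv)
      qed
      moreover have "(\<Sum>j\<in>J. (\<Sum>k\<in>S. g k * a k j)\<^sup>2) \<le> (\<Sum>k\<in>S. (g k)\<^sup>2)" for g
      proof -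
        have "(\<Sum>j\<in>J. (\<Sum>k\<in>S. g k * a k j)\<^sup>2) = (\<Sum>j\<in>J. if j \<in> \<pi> ` I then (\<Sum>k\<in>S. g k * u S k (inv \<pi> j))\<^sup>2 else 0)"
          by (intro sum.cong) (auto simp: a_def)
        also have "\<dots> = (\<Sum>i\<in>I. (\<Sum>k\<in>S. g k * u S k i)\<^sup>2)" by (simp add: reidx inv)
        also have "\<dots> = (\<Sum>k\<in>S. (g k)\<^sup>2 * (\<Sum>i\<in>I. (u S k i)\<^sup>2))"
          using u S by (intro pythagoras_orthogonal_sum) (auto intro: finite_subset)
        also have "\<dots> \<le> (\<Sum>k\<in>S. (g k)\<^sup>2)"
        proof (rule sum_mono)
          fix k assume "k \<in> S"
          then have "(\<Sum>i\<in>I. (u S k i)\<^sup>2) = 1 \<or> (\<forall>i\<in>I. u S k i = 0)" using u2 S by blast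
          then show "(g k)\<^sup>2 * (\<Sum>i\<in>I. (u S k i)\<^sup>2) \<le> (g k)\<^sup>2" by auto
        qed
        finally show ?thesis .
      qed
      ultimately have "(\<integral>\<^sup>+z. ennreal (E S z) \<partial>(\<Pi>\<^sub>M i\<in>J. D)) \<le> 2 ^ card S"
        using projection_exp_moment[OF D snd_D K mgf IJ(3) finite_subset[of S "{1..p}"], of a] S
        by (simp add: E_def)
      then show ?thesis using S by simp
    qed
    have "(\<integral>\<^sup>+z. max_gain p s I \<pi> (merge I J (x, z)) \<partial>(\<Pi>\<^sub>M i\<in>J. D))
      \<le> (\<integral>\<^sup>+z. ennreal (8 * K\<^sup>2) * (ennreal L + ennreal (exp (- L)) * (\<Sum>S\<in>?\<S>. ennreal (E S z))) \<partial>(\<Pi>\<^sub>M i\<in>J. D))"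
    proof (rule nn_integral_mono)
      fix z
      let ?d = "merge I J (x, z)"
      have m: "fst (?d i) = fst (x i)" "snd (?d (\<pi> i)) = snd (z (\<pi> i))" if "i \<in> I" for i
        using that \<pi>I IJ(1) by (auto simp: merge_def)
      have "max_gain p s I \<pi> ?d \<le> ennreal (8 * K\<^sup>2) * (ennreal L + ennreal (exp (- L)) *
         (\<Sum>S\<in>?\<S>. ennreal (exp ((\<Sum>k\<in>S. (\<Sum>i\<in>I. u S k i * snd (?d (\<pi> i)))\<^sup>2) / (8 * K\<^sup>2)))))"
        using u u2 u3 by (intro max_gain_le_exp_sum IJ(2) K L0) (simp_all only: m cong: ball_cong)
      then show "max_gain p s I \<pi> ?d \<le> ennreal (8 * K\<^sup>2) * (ennreal L + ennreal (exp (- L)) * (\<Sum>S\<in>?\<S>. ennreal (E S z)))"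
        by (simp add: E_def m)
    qed
    also have "\<dots> = ennreal (8 * K\<^sup>2) * (ennreal L + ennreal (exp (- L)) * (\<Sum>S\<in>?\<S>. (\<integral>\<^sup>+z. ennreal (E S z) \<partial>(\<Pi>\<^sub>M i\<in>J. D))))"
      by (simp add: nn_integral_cmult nn_integral_add nn_integral_sum PJ.emeasure_space_1)
    also have "\<dots> \<le> ennreal (8 * K\<^sup>2) * (ennreal L + ennreal (exp (- L)) * (\<Sum>S\<in>?\<S>. 2 ^ min s p))"
      by (intro mult_left_mono add_left_mono sum_mono E_le) auto
    also have "(\<Sum>S\<in>?\<S>. (2::ennreal) ^ min s p) = ennreal (real (p choose min s p) * 2 ^ min s p)"
      using n_subsets[of "{1..p}" "min s p"] by (simp add: ennreal_mult' ennreal_of_nat_eq_real_of_nat flip: ennreal_power ennreal_numeral)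
    also have "ennreal (8 * K\<^sup>2) * (ennreal L + ennreal (exp (- L)) * \<dots>)
       = ennreal (8 * K\<^sup>2 * (L + exp (- L) * (real (p choose min s p) * 2 ^ min s p)))"
      using L0 by (simp add: ennreal_mult' ennreal_plus)
    also have "\<dots> \<le> ennreal (8 * K\<^sup>2 * (1 + L))"
    proof (intro ennreal_leI mult_left_mono)
      have "real (p choose min s p) \<le> real p ^ min s p"
        using binomial_le_pow[of "min s p" p] by (simp flip: of_nat_power)
      moreover have "exp L = real p ^ min s p * 2 ^ min s p"
        using p by (simp add: L_def exp_of_nat_mult exp_add power_mult_distrib)
      ultimately have "real (p choose min s p) * 2 ^ min s p \<le> exp L" by (simp add: mult_right_mono)
      then have "exp (- L) * (real (p choose min s p) * 2 ^ min s p) \<le> exp (- L) * exp L"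
        by (rule mult_left_mono) simp
      then show "L + exp (- L) * (real (p choose min s p) * 2 ^ min s p) \<le> 1 + L"
        by (simp flip: exp_add)
    qed simp
    finally show ?thesis .
  qed
  have "(\<integral>\<^sup>+d. max_gain p s I \<pi> d \<partial>(\<Pi>\<^sub>M i\<in>{1..n}. D))
     = (\<integral>\<^sup>+x. (\<integral>\<^sup>+z. max_gain p s I \<pi> (merge I J (x, z)) \<partial>(\<Pi>\<^sub>M i\<in>J. D)) \<partial>(\<Pi>\<^sub>M i\<in>I. D))"
    unfolding IJ(4) by (rule product_nn_integral_fold[OF IJ(1-3) meas])
  also have "\<dots> \<le> (\<integral>\<^sup>+x. ennreal (8 * K\<^sup>2 * (1 + L)) \<partial>(\<Pi>\<^sub>M i\<in>I. D))"
    by (intro nn_integral_mono inner)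
  also have "\<dots> = ennreal (8 * K\<^sup>2 * (1 + L))" by (simp add: PI.emeasure_space_1)
  finally show ?thesis .
qed

section \<open>The regression model\<close>

context sparse_regression
begin

definition signal :: "'b \<Rightarrow> real" where "signal \<omega> = vinner p (x \<omega>) \<beta>"

definition signal_var :: real where "signal_var = pop.expectation (\<lambda>\<omega>. (signal \<omega>)\<^sup>2)"

definition pair_law :: "((nat \<Rightarrow> real) \<times> real) measure" where
  "pair_law = distr P (borel_vec p \<Otimes>\<^sub>M borel) (\<lambda>\<omega>. (x \<omega>, vinner p (x \<omega>) \<beta> + \<epsilon> \<omega>))"

definition sample_law :: "dataset measure" where
  "sample_law = (\<Pi>\<^sub>M i\<in>{1..n}. pair_law)"

lemma measurable_vinner: "(\<lambda>u. vinner p u v) \<in> borel_measurable (borel_vec p)"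
  unfolding vinner_def by measurable

lemma measurable_x_coord: "k \<in> {1..p} \<Longrightarrow> (\<lambda>\<omega>. x \<omega> k) \<in> borel_measurable P"
  by (rule measurable_compose[OF x_rv measurable_component_singleton])

lemma measurable_vinner_x[measurable]: "(\<lambda>\<omega>. vinner p (x \<omega>) v) \<in> borel_measurable P"
  by (rule measurable_compose[OF x_rv measurable_vinner])

lemma measurable_signal[measurable]: "signal \<in> borel_measurable P"
  unfolding signal_def[abs_def] by measurable

declare eps_rv[measurable]

lemma measurable_pair: "(\<lambda>\<omega>. (x \<omega>, vinner p (x \<omega>) \<beta> + \<epsilon> \<omega>)) \<in> P \<rightarrow>\<^sub>M borel_vec p \<Otimes>\<^sub>M borel"
  by (intro measurable_Pair x_rv) measurable

lemma sets_pair_law: "sets pair_law = sets (borel_vec p \<Otimes>\<^sub>M borel)"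
  by (simp add: pair_law_def)

lemma prob_space_pair_law: "prob_space pair_law"
  unfolding pair_law_def by (rule pop.prob_space_distr[OF measurable_pair])

lemma sets_sample_law: "sets sample_law = sets (\<Pi>\<^sub>M i\<in>{1..n}. borel_vec p \<Otimes>\<^sub>M borel)"
  unfolding sample_law_def by (intro sets_PiM_cong refl sets_pair_law)

lemma space_sample_law: "space sample_law = datasets n p"
  using sets_eq_imp_space_eq[OF sets_sample_law] by (simp only: space_dataset)

lemma prob_space_sample_law: "prob_space sample_law"
  unfolding sample_law_def by (intro prob_space_PiM prob_space_pair_law)

lemma measurable_sample_law:
  "f \<in> (\<Pi>\<^sub>M i\<in>{1..n}. borel_vec p \<Otimes>\<^sub>M borel) \<rightarrow>\<^sub>M N \<Longrightarrow> f \<in> sample_law \<rightarrow>\<^sub>M N"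
  using measurable_cong_sets[OF sets_sample_law refl] by blast

lemma coord_sample_law:
  assumes "i \<in> {1..n}"
  shows "(\<lambda>d. d i) \<in> sample_law \<rightarrow>\<^sub>M pair_law" "distr sample_law pair_law (\<lambda>d. d i) = pair_law"
proof -
  show "(\<lambda>d. d i) \<in> sample_law \<rightarrow>\<^sub>M pair_law"
    unfolding sample_law_def using assms by (rule measurable_component_singleton)
  show "distr sample_law pair_law (\<lambda>d. d i) = pair_law"
    unfolding sample_law_def by (rule distr_PiM_component[OF prob_space_pair_law assms])
qed

lemma Z_rv: "i \<in> {1..n} \<Longrightarrow> Z i \<in> M \<rightarrow>\<^sub>M borel_vec p \<Otimes>\<^sub>M borel"
  using sample_indep by (auto simp: smp.indep_vars_def)

lemma distr_sample:
  assumes "1 \<le> n"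
  shows "distr M (\<Pi>\<^sub>M i\<in>{1..n}. borel_vec p \<Otimes>\<^sub>M borel) (\<lambda>\<omega>. \<lambda>i\<in>{1..n}. Z i \<omega>) = sample_law"
proof -
  have "distr M (\<Pi>\<^sub>M i\<in>{1..n}. borel_vec p \<Otimes>\<^sub>M borel) (\<lambda>\<omega>. \<lambda>i\<in>{1..n}. Z i \<omega>)
      = (\<Pi>\<^sub>M i\<in>{1..n}. distr M (borel_vec p \<Otimes>\<^sub>M borel) (Z i))"
    using assms by (intro smp.indep_vars_iff_distr_eq_PiM'[THEN iffD1] Z_rv sample_indep) auto
  also have "\<dots> = sample_law"
    unfolding sample_law_def pair_law_def by (intro PiM_cong refl sample_distr)
  finally show ?thesis .
qed

lemma rejection_prob_sample_law:
  assumes "1 \<le> n"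
  shows "rejection_prob M n p est Z \<alpha> = measure sample_law {d \<in> space sample_law. perm_pvalue n p est d \<le> \<alpha>}"
proof -
  let ?B = "\<Pi>\<^sub>M i\<in>{1..n}. borel_vec p \<Otimes>\<^sub>M borel"
  note [measurable] = measurable_perm_pvalue[OF estimator]
  have Zm: "(\<lambda>\<omega>. \<lambda>i\<in>{1..n}. Z i \<omega>) \<in> M \<rightarrow>\<^sub>M ?B"
    by (intro measurable_restrict Z_rv)
  have "measure sample_law {d \<in> space sample_law. perm_pvalue n p est d \<le> \<alpha>}
     = measure (distr M ?B (\<lambda>\<omega>. \<lambda>i\<in>{1..n}. Z i \<omega>)) {d \<in> space ?B. perm_pvalue n p est d \<le> \<alpha>}"
    unfolding distr_sample[OF assms] sets_eq_imp_space_eq[OF sets_sample_law] ..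
  also have "\<dots> = measure M ((\<lambda>\<omega>. \<lambda>i\<in>{1..n}. Z i \<omega>) -` {d \<in> space ?B. perm_pvalue n p est d \<le> \<alpha>} \<inter> space M)"
    by (rule measure_distr[OF Zm]) measurable
  also have "(\<lambda>\<omega>. \<lambda>i\<in>{1..n}. Z i \<omega>) -` {d \<in> space ?B. perm_pvalue n p est d \<le> \<alpha>} \<inter> space M
     = {\<omega> \<in> space M. perm_pvalue n p est (\<lambda>i\<in>{1..n}. Z i \<omega>) \<le> \<alpha>}"
    using measurable_space[OF Zm] by blast
  finally show ?thesis unfolding rejection_prob_def by simp
qed

lemma emeasure_x_eps_Int:
  assumes "A \<in> sets (borel_vec p)" "B \<in> sets borel"
  shows "pop.prob ((x -` A \<inter> space P) \<inter> (\<epsilon> -` B \<inter> space P))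
    = pop.prob (x -` A \<inter> space P) * pop.prob (\<epsilon> -` B \<inter> space P)"
  using assms by (intro pop.indep_setD[OF x_eps_indep]) auto

lemma pair_law_null:
  assumes "\<beta> = (\<lambda>k\<in>{1..p}. 0)"
  shows "pair_law = distr P (borel_vec p) x \<Otimes>\<^sub>M distr P borel \<epsilon>"
proof -
  interpret X: prob_space "distr P (borel_vec p) x" by (rule pop.prob_space_distr[OF x_rv])
  interpret E: prob_space "distr P borel \<epsilon>" by (rule pop.prob_space_distr[OF eps_rv])
  have v0: "vinner p (x \<omega>) \<beta> = 0" for \<omega> unfolding assms by (simp add: vinner_def)
  have XE: "(\<lambda>\<omega>. (x \<omega>, \<epsilon> \<omega>)) \<in> P \<rightarrow>\<^sub>M borel_vec p \<Otimes>\<^sub>M borel"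
    by (intro measurable_Pair x_rv eps_rv)
  have "distr P (borel_vec p) x \<Otimes>\<^sub>M distr P borel \<epsilon> = distr P (borel_vec p \<Otimes>\<^sub>M borel) (\<lambda>\<omega>. (x \<omega>, \<epsilon> \<omega>))"
  proof (rule pair_measure_eqI)
    show "sigma_finite_measure (distr P (borel_vec p) x)" by unfold_locales
    show "sigma_finite_measure (distr P borel \<epsilon>)" by unfold_locales
    show "sets (distr P (borel_vec p) x \<Otimes>\<^sub>M distr P borel \<epsilon>)
        = sets (distr P (borel_vec p \<Otimes>\<^sub>M borel) (\<lambda>\<omega>. (x \<omega>, \<epsilon> \<omega>)))"
      by (simp add: sets_pair_measure_cong[OF sets_distr sets_distr])
    fix A B assume "A \<in> sets (distr P (borel_vec p) x)" "B \<in> sets (distr P borel \<epsilon>)"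
    then have AB: "A \<in> sets (borel_vec p)" "B \<in> sets borel" by auto
    have "emeasure (distr P (borel_vec p \<Otimes>\<^sub>M borel) (\<lambda>\<omega>. (x \<omega>, \<epsilon> \<omega>))) (A \<times> B)
       = emeasure P ((\<lambda>\<omega>. (x \<omega>, \<epsilon> \<omega>)) -` (A \<times> B) \<inter> space P)"
      using AB by (intro emeasure_distr[OF XE]) auto
    also have "(\<lambda>\<omega>. (x \<omega>, \<epsilon> \<omega>)) -` (A \<times> B) \<inter> space P = (x -` A \<inter> space P) \<inter> (\<epsilon> -` B \<inter> space P)"
      by auto
    also have "emeasure P \<dots> = emeasure P (x -` A \<inter> space P) * emeasure P (\<epsilon> -` B \<inter> space P)"
      using emeasure_x_eps_Int[OF AB] by (simp add: pop.emeasure_eq_measure ennreal_mult')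
    finally show "emeasure (distr P (borel_vec p) x) A * emeasure (distr P borel \<epsilon>) B
       = emeasure (distr P (borel_vec p \<Otimes>\<^sub>M borel) (\<lambda>\<omega>. (x \<omega>, \<epsilon> \<omega>))) (A \<times> B)"
      by (simp only: emeasure_distr[OF x_rv AB(1)] emeasure_distr[OF eps_rv AB(2)])
  qed
  then show ?thesis by (simp add: pair_law_def v0)
qed

text \<open>
  The signal is a measurable function of \<open>x\<close>, so its events are among those of \<open>x\<close>.
\<close>

lemma indep_signal_eps: "pop.indep_var borel signal borel \<epsilon>"
proof -
  have Int_stable: "Int_stable {X -` A \<inter> space P |A. A \<in> sets borel}" for X :: "'b \<Rightarrow> real"
  proof (safe intro!: Int_stableI)
    fix A B :: "real set" assume "A \<in> sets borel" "B \<in> sets borel"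
    then show "\<exists>C. (X -` A \<inter> space P) \<inter> (X -` B \<inter> space P) = (X -` C \<inter> space P) \<and> C \<in> sets borel"
      by (intro exI[of _ "A \<inter> B"]) auto
  qed
  show ?thesis
    unfolding pop.indep_var_eq
  proof (intro conjI measurable_signal eps_rv pop.indep_set_sigma_sets Int_stable pop.indep_setI)
    show "{signal -` A \<inter> space P |A. A \<in> sets borel} \<subseteq> pop.events"
      using measurable_sets[OF measurable_signal] by auto
    show "{\<epsilon> -` A \<inter> space P |A. A \<in> sets borel} \<subseteq> pop.events"
      using measurable_sets[OF eps_rv] by auto
    fix a b assume "a \<in> {signal -` A \<inter> space P |A. A \<in> sets borel}" "b \<in> {\<epsilon> -` A \<inter> space P |A. A \<in> sets borel}"
    then obtain A B where AB: "a = signal -` A \<inter> space P" "A \<in> sets borel"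
      "b = \<epsilon> -` B \<inter> space P" "B \<in> sets borel" by blast
    define A' where "A' = (\<lambda>u. vinner p u \<beta>) -` A \<inter> space (borel_vec p)"
    have A': "A' \<in> sets (borel_vec p)" unfolding A'_def by (rule measurable_sets[OF measurable_vinner AB(2)])
    have "a = x -` A' \<inter> space P"
      using measurable_space[OF x_rv] by (auto simp: AB A'_def signal_def)
    then show "pop.prob (a \<inter> b) = pop.prob a * pop.prob b"
      using emeasure_x_eps_Int[OF A' AB(4)] AB(3) by simp
  qed
qed

text \<open>
  The coordinates are the inner products with the standard unit vectors, hence sub-Gaussian.
\<close>

lemma x_coord_moments:
  assumes K: "0 < K\<^sub>x" and k: "k \<in> {1..p}"
  shows "integrable P (\<lambda>\<omega>. x \<omega> k)" "integrable P (\<lambda>\<omega>. (x \<omega> k)\<^sup>2)"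
proof -
  let ?e = "\<lambda>j\<in>{1..p}. if j = k then 1 else (0::real)"
  have "L2_set ?e {1..p} = 1"
  proof -
    have "(\<Sum>j\<in>{1..p}. (?e j)\<^sup>2) = (\<Sum>j\<in>{1..p}. if j = k then 1 else 0)"
      by (intro sum.cong) auto
    then show ?thesis using k by (simp add: L2_set_def)
  qed
  then have e_in: "?e \<in> {v \<in> Rvec p. L2_set v {1..p} = 1}" by auto
  have eq: "vinner p (x \<omega>) ?e = x \<omega> k" for \<omega>
  proof -
    have "vinner p (x \<omega>) ?e = (\<Sum>j\<in>{1..p}. if j = k then x \<omega> k else 0)"
      unfolding vinner_def by (intro sum.cong) auto
    then show ?thesis using k by simp
  qed
  have "psi2_norm P (\<lambda>\<omega>. vinner p (x \<omega>) ?e) \<le> ennreal K\<^sub>x"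
    using x_sub_gaussian unfolding sub_gaussian_vec_def by (rule SUP_le_iff[THEN iffD1, THEN bspec, OF _ e_in])
  then have "psi2_norm P (\<lambda>\<omega>. x \<omega> k) \<le> ennreal K\<^sub>x" unfolding eq .
  from pop.exp_moment_imp_moments[OF measurable_x_coord[OF k] _ psi2_norm_le_imp_exp_moment[OF this K]] K
  show "integrable P (\<lambda>\<omega>. x \<omega> k)" "integrable P (\<lambda>\<omega>. (x \<omega> k)\<^sup>2)" by auto
qed

lemma integrable_x_coord_product:
  assumes K: "0 < K\<^sub>x" and "j \<in> {1..p}" "k \<in> {1..p}"
  shows "integrable P (\<lambda>\<omega>. x \<omega> j * x \<omega> k)"
proof (rule Bochner_Integration.integrable_bound)
  show "integrable P (\<lambda>\<omega>. (x \<omega> j)\<^sup>2 + (x \<omega> k)\<^sup>2)"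
    using x_coord_moments[OF K] assms by auto
  show "(\<lambda>\<omega>. x \<omega> j * x \<omega> k) \<in> borel_measurable P"
    using measurable_x_coord assms by (intro borel_measurable_times) auto
  have "\<bar>a * b\<bar> \<le> \<bar>a\<^sup>2 + b\<^sup>2\<bar>" for a b :: real
  proof -
    have "2 * (\<bar>a\<bar> * \<bar>b\<bar>) \<le> a\<^sup>2 + b\<^sup>2" using sum_squares_bound[of "\<bar>a\<bar>" "\<bar>b\<bar>"] by (simp add: mult.assoc)
    moreover have "0 \<le> \<bar>a\<bar> * \<bar>b\<bar>" by simp
    ultimately show ?thesis unfolding abs_mult by linarith
  qed
  then show "AE \<omega> in P. norm (x \<omega> j * x \<omega> k) \<le> norm ((x \<omega> j)\<^sup>2 + (x \<omega> k)\<^sup>2)" by simp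
qed

lemma expectation_signal:
  assumes K: "0 < K\<^sub>x"
  shows "pop.expectation signal = 0"
proof -
  have "pop.expectation signal = (\<Sum>k=1..p. pop.expectation (\<lambda>\<omega>. x \<omega> k * \<beta> k))"
    unfolding signal_def[abs_def] vinner_def
    using x_coord_moments(1)[OF K] by (intro Bochner_Integration.integral_sum) auto
  also have "\<dots> = 0" using x_mean by (intro sum.neutral) auto
  finally show ?thesis .
qed

lemma quad_form_covariance:
  assumes K: "0 < K\<^sub>x"
  shows "quad_form p (covariance_matrix P x) \<beta> = signal_var"
proof -
  have cov: "covariance_matrix P x j k = pop.expectation (\<lambda>\<omega>. x \<omega> j * x \<omega> k)" if "j \<in> {1..p}" "k \<in> {1..p}" for j k
    using x_mean that by (simp add: covariance_matrix_def)
  have "signal_var = pop.expectation (\<lambda>\<omega>. \<Sum>j=1..p. \<Sum>k=1..p. \<beta> j * \<beta> k * (x \<omega> j * x \<omega> k))"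
    unfolding signal_var_def signal_def vinner_def power2_eq_square sum_product by (simp only: mult_ac)
  also have "\<dots> = (\<Sum>j=1..p. \<Sum>k=1..p. \<beta> j * \<beta> k * pop.expectation (\<lambda>\<omega>. x \<omega> j * x \<omega> k))"
  proof -
    let ?f = "\<lambda>j k \<omega>. \<beta> j * \<beta> k * (x \<omega> j * x \<omega> k)"
    have i: "integrable P (?f j k)" if "j \<in> {1..p}" "k \<in> {1..p}" for j k
      using integrable_x_coord_product[OF K that] by (rule integrable_mult_right)
    have "pop.expectation (\<lambda>\<omega>. \<Sum>j=1..p. \<Sum>k=1..p. ?f j k \<omega>) = (\<Sum>j=1..p. pop.expectation (\<lambda>\<omega>. \<Sum>k=1..p. ?f j k \<omega>))"
      by (intro Bochner_Integration.integral_sum Bochner_Integration.integrable_sum i)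
    also have "\<dots> = (\<Sum>j=1..p. \<Sum>k=1..p. pop.expectation (?f j k))"
      by (intro sum.cong refl Bochner_Integration.integral_sum i)
    finally show ?thesis by simp
  qed
  also have "\<dots> = quad_form p (covariance_matrix P x) \<beta>"
    unfolding quad_form_def by (intro sum.cong refl) (simp add: cov mult_ac)
  finally show ?thesis by simp
qed

lemma level_under_null:
  assumes n: "1 \<le> n" and \<beta>0: "\<beta> = (\<lambda>k\<in>{1..p}. 0)" and \<alpha>: "0 \<le> \<alpha>"
  shows "rejection_prob M n p est Z \<alpha> \<le> \<alpha>"
  unfolding rejection_prob_sample_law[OF n]
proof (rule permutation_test_level[OF prob_space_sample_law sets_sample_law estimator \<alpha>])
  define X where "X = distr P (borel_vec p) x"
  define Y where "Y = distr P borel \<epsilon>"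
  have XY: "prob_space X" "prob_space Y"
    unfolding X_def Y_def by (intro pop.prob_space_distr x_rv eps_rv)+
  let ?AB = "(\<Pi>\<^sub>M i\<in>{1..n}. X) \<Otimes>\<^sub>M (\<Pi>\<^sub>M i\<in>{1..n}. Y)"
  let ?z = "\<lambda>\<pi> (a, b). \<lambda>i\<in>{1..n}. (a i, b (\<pi> i))"
  have sl: "sample_law = (\<Pi>\<^sub>M i\<in>{1..n}. X \<Otimes>\<^sub>M Y)"
    unfolding sample_law_def pair_law_null[OF \<beta>0] X_def Y_def ..
  have zip: "distr ?AB sample_law (?z \<pi>) = sample_law" if "\<pi> permutes {1..n}" for \<pi>
    unfolding sl by (rule distr_zip_permuted[OF XY that]) simp
  fix \<pi> assume \<pi>: "\<pi> permutes {1..n}"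
  have \<pi>I: "\<pi> i \<in> {1..n}" if "i \<in> {1..n}" for i using permutes_in_image[OF \<pi>] that by simp
  show perm: "permute_responses n \<pi> \<in> sample_law \<rightarrow>\<^sub>M sample_law"
    unfolding sl permute_responses_def[abs_def]
  proof (rule measurable_restrict)
    fix i assume i: "i \<in> {1..n}"
    have "(\<lambda>d. d i) \<in> (\<Pi>\<^sub>M i\<in>{1..n}. X \<Otimes>\<^sub>M Y) \<rightarrow>\<^sub>M X \<Otimes>\<^sub>M Y"
      "(\<lambda>d. d (\<pi> i)) \<in> (\<Pi>\<^sub>M i\<in>{1..n}. X \<Otimes>\<^sub>M Y) \<rightarrow>\<^sub>M X \<Otimes>\<^sub>M Y"
      using i \<pi>I[OF i] by (intro measurable_component_singleton; simp)+
    then show "(\<lambda>d. (fst (d i), snd (d (\<pi> i)))) \<in> (\<Pi>\<^sub>M i\<in>{1..n}. X \<Otimes>\<^sub>M Y) \<rightarrow>\<^sub>M X \<Otimes>\<^sub>M Y"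
      by (intro measurable_Pair measurable_compose[OF _ measurable_fst] measurable_compose[OF _ measurable_snd])
  qed
  have z_id: "?z id \<in> ?AB \<rightarrow>\<^sub>M sample_law"
    unfolding sl case_prod_beta
  proof (rule measurable_restrict)
    fix i assume i: "i \<in> {1..n}"
    have "(\<lambda>w. fst w i) \<in> ?AB \<rightarrow>\<^sub>M X" "(\<lambda>w. snd w i) \<in> ?AB \<rightarrow>\<^sub>M Y"
      using measurable_compose[OF measurable_fst measurable_component_singleton[OF i]]
        measurable_compose[OF measurable_snd measurable_component_singleton[OF i]] by auto
    then show "(\<lambda>w. (fst w i, snd w (id i))) \<in> ?AB \<rightarrow>\<^sub>M X \<Otimes>\<^sub>M Y" by simp
  qed
  have "distr sample_law sample_law (permute_responses n \<pi>)
      = distr (distr ?AB sample_law (?z id)) sample_law (permute_responses n \<pi>)"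
    using zip[OF permutes_id] by simp
  also have "\<dots> = distr ?AB sample_law (permute_responses n \<pi> \<circ> ?z id)"
    by (rule distr_distr[OF perm z_id])
  also have "permute_responses n \<pi> \<circ> ?z id = ?z \<pi>"
    using \<pi>I by (auto simp: fun_eq_iff permute_responses_def)
  finally show "distr sample_law sample_law (permute_responses n \<pi>) = sample_law"
    using zip[OF \<pi>] by simp
qed

section \<open>Moments of the signal, the noise and the responses\<close>

text \<open>
  A common scale at which the signal and the noise both have exponential square moment at most \<open>2\<close>;
  the outer factor \<open>2\<close> is the one lost in \<open>psi2_norm_le_imp_exp_moment\<close>.
\<close>

definition k\<^sub>y :: real where "k\<^sub>y = 2 * (K\<^sub>\<mu> + K\<^sub>\<epsilon>)"

lemma exp_moments_signal_eps:
  assumes K: "0 < K\<^sub>\<mu>" "0 < K\<^sub>\<epsilon>"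
  shows "(\<integral>\<^sup>+\<omega>. ennreal (exp ((signal \<omega>)\<^sup>2 / k\<^sub>y\<^sup>2)) \<partial>P) \<le> 2"
    and "(\<integral>\<^sup>+\<omega>. ennreal (exp ((\<epsilon> \<omega>)\<^sup>2 / k\<^sub>y\<^sup>2)) \<partial>P) \<le> 2"
proof -
  have s: "psi2_norm P signal \<le> ennreal (K\<^sub>\<mu> + K\<^sub>\<epsilon>)"
    unfolding signal_def[abs_def] by (rule order_trans[OF signal_bound]) (use K in \<open>auto intro: ennreal_leI\<close>)
  have e: "psi2_norm P \<epsilon> \<le> ennreal (K\<^sub>\<mu> + K\<^sub>\<epsilon>)"
    by (rule order_trans[OF eps_sub_gaussian[unfolded sub_gaussian_def]]) (use K in \<open>auto intro: ennreal_leI\<close>)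
  show "(\<integral>\<^sup>+\<omega>. ennreal (exp ((signal \<omega>)\<^sup>2 / k\<^sub>y\<^sup>2)) \<partial>P) \<le> 2"
    "(\<integral>\<^sup>+\<omega>. ennreal (exp ((\<epsilon> \<omega>)\<^sup>2 / k\<^sub>y\<^sup>2)) \<partial>P) \<le> 2"
    using psi2_norm_le_imp_exp_moment[OF s] psi2_norm_le_imp_exp_moment[OF e] K
    by (simp_all only: k\<^sub>y_def add_pos_pos)
qed

lemma signal_moments:
  assumes K: "0 < K\<^sub>\<mu>" "0 < K\<^sub>\<epsilon>"
  shows "integrable P signal" "integrable P (\<lambda>\<omega>. (signal \<omega>)\<^sup>2)" "integrable P (\<lambda>\<omega>. (signal \<omega>)^4)"
    "signal_var \<le> 2 * k\<^sub>y\<^sup>2"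
    and "pop.expectation (\<lambda>\<omega>. (signal \<omega>)^4) \<le> 4 * k\<^sub>y^4"
proof -
  have "0 < k\<^sub>y" using K by (simp add: k\<^sub>y_def)
  from pop.exp_moment_imp_moments[OF measurable_signal this exp_moments_signal_eps(1)[OF K]]
  show "integrable P signal" "integrable P (\<lambda>\<omega>. (signal \<omega>)\<^sup>2)" "integrable P (\<lambda>\<omega>. (signal \<omega>)^4)"
    "signal_var \<le> 2 * k\<^sub>y\<^sup>2"
    "pop.expectation (\<lambda>\<omega>. (signal \<omega>)^4) \<le> 4 * k\<^sub>y^4" by (auto simp: signal_var_def)
qed

lemma eps_moments:
  assumes K: "0 < K\<^sub>\<mu>" "0 < K\<^sub>\<epsilon>"
  shows "integrable P \<epsilon>" "integrable P (\<lambda>\<omega>. (\<epsilon> \<omega>)\<^sup>2)" "pop.expectation (\<lambda>\<omega>. (\<epsilon> \<omega>)\<^sup>2) = \<sigma>\<^sub>\<epsilon>\<^sup>2"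
    and "\<sigma>\<^sub>\<epsilon>\<^sup>2 \<le> 2 * k\<^sub>y\<^sup>2"
proof -
  have "0 < k\<^sub>y" using K by (simp add: k\<^sub>y_def)
  from pop.exp_moment_imp_moments[OF eps_rv this exp_moments_signal_eps(2)[OF K]]
  show "integrable P \<epsilon>" "integrable P (\<lambda>\<omega>. (\<epsilon> \<omega>)\<^sup>2)"
    and e: "pop.expectation (\<lambda>\<omega>. (\<epsilon> \<omega>)\<^sup>2) = \<sigma>\<^sub>\<epsilon>\<^sup>2" and "\<sigma>\<^sub>\<epsilon>\<^sup>2 \<le> 2 * k\<^sub>y\<^sup>2"
    using eps_variance eps_mean by auto
qed

lemma pair_law_mgf:
  assumes K: "0 < K\<^sub>x" "0 < K\<^sub>\<mu>" "0 < K\<^sub>\<epsilon>"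
  shows "(\<integral>\<^sup>+z. ennreal (exp (t * snd z)) \<partial>pair_law) \<le> ennreal (exp ((2 * k\<^sub>y)\<^sup>2 * t\<^sup>2))"
proof -
  have k: "0 < k\<^sub>y" using K by (simp add: k\<^sub>y_def)
  have "(\<integral>\<^sup>+z. ennreal (exp (t * snd z)) \<partial>pair_law) = (\<integral>\<^sup>+\<omega>. ennreal (exp (t * (signal \<omega> + \<epsilon> \<omega>))) \<partial>P)"
    unfolding pair_law_def by (subst nn_integral_distr[OF measurable_pair]) (auto simp: signal_def)
  also have "\<dots> \<le> ennreal (exp ((2 * k\<^sub>y)\<^sup>2 * t\<^sup>2))"
    by (rule pop.sub_gaussian_sum_mgf[OF measurable_signal eps_rv k exp_moments_signal_eps(1)[OF K(2,3)]
        expectation_signal[OF K(1)] exp_moments_signal_eps(2)[OF K(2,3)] eps_mean])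
  finally show ?thesis .
qed

lemma pair_law_second_moment:
  assumes K: "0 < K\<^sub>\<mu>" "0 < K\<^sub>\<epsilon>"
  shows "(\<integral>\<^sup>+z. ennreal ((snd z)\<^sup>2) \<partial>pair_law) \<le> ennreal (8 * k\<^sub>y\<^sup>2)"
proof -
  have "(\<integral>\<^sup>+z. ennreal ((snd z)\<^sup>2) \<partial>pair_law) = (\<integral>\<^sup>+\<omega>. ennreal ((signal \<omega> + \<epsilon> \<omega>)\<^sup>2) \<partial>P)"
    unfolding pair_law_def by (subst nn_integral_distr[OF measurable_pair]) (auto simp: signal_def)
  also have "\<dots> \<le> (\<integral>\<^sup>+\<omega>. ennreal (2 * (signal \<omega>)\<^sup>2 + 2 * (\<epsilon> \<omega>)\<^sup>2) \<partial>P)"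
  proof (intro nn_integral_mono ennreal_leI)
    fix \<omega>
    show "(signal \<omega> + \<epsilon> \<omega>)\<^sup>2 \<le> 2 * (signal \<omega>)\<^sup>2 + 2 * (\<epsilon> \<omega>)\<^sup>2"
      using zero_le_power2[of "signal \<omega> - \<epsilon> \<omega>"] unfolding power2_sum power2_diff by linarith
  qed
  also have "\<dots> = ennreal (pop.expectation (\<lambda>\<omega>. 2 * (signal \<omega>)\<^sup>2 + 2 * (\<epsilon> \<omega>)\<^sup>2))"
    using signal_moments(2)[OF K] eps_moments(2)[OF K] by (intro nn_integral_eq_integral) auto
  also have "pop.expectation (\<lambda>\<omega>. 2 * (signal \<omega>)\<^sup>2 + 2 * (\<epsilon> \<omega>)\<^sup>2) = 2 * signal_var + 2 * \<sigma>\<^sub>\<epsilon>\<^sup>2"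
    using signal_moments(2)[OF K] eps_moments(2,3)[OF K] by (simp add: signal_var_def)
  also have "ennreal \<dots> \<le> ennreal (8 * k\<^sub>y\<^sup>2)"
    using signal_moments(4)[OF K] eps_moments(4)[OF K] by (intro ennreal_leI) linarith
  finally show ?thesis .
qed

text \<open>
  If the \<open>\<psi>\<^sub>2\<close>-norm is of the order of the standard deviation, then the fourth moment is of the order of
  the squared variance: the square of the signal fluctuates on the scale of its own mean.
\<close>

lemma signal_fourth_moment_variance_bound:
  assumes \<kappa>: "psi2_variance_bound P p \<kappa> x" "0 < \<kappa>" and signal_var: "0 < signal_var"
  shows "pop.expectation (\<lambda>\<omega>. (signal \<omega>)^4) \<le> 64 * \<kappa>\<^sup>2 * signal_var\<^sup>2"
proof -
  define r where "r = sqrt (\<kappa> * signal_var)"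
  have r: "0 < r" "r\<^sup>2 = \<kappa> * signal_var" using \<kappa> signal_var by (auto simp: r_def)
  have "(psi2_norm P signal)\<^sup>2 \<le> ennreal (r\<^sup>2)"
    using \<kappa>(1) beta_vec unfolding psi2_variance_bound_def signal_def[abs_def] r(2) signal_var_def by blast
  then have "psi2_norm P signal \<le> ennreal r"
  proof (cases "psi2_norm P signal")
    case (real t)
    then have "ennreal (t\<^sup>2) \<le> ennreal (r\<^sup>2)"
      using \<open>(psi2_norm P signal)\<^sup>2 \<le> ennreal (r\<^sup>2)\<close> by (simp add: ennreal_power)
    then have "t\<^sup>2 \<le> r\<^sup>2" by (subst (asm) ennreal_le_iff) auto
    then have "t \<le> r" by (rule power2_le_imp_le) (use r in simp)
    then show ?thesis using real by (simp add: ennreal_leI)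
  next
    case top
    then have "(psi2_norm P signal)\<^sup>2 = \<top>" by (simp add: power2_eq_square ennreal_mult_top)
    then show ?thesis using \<open>(psi2_norm P signal)\<^sup>2 \<le> ennreal (r\<^sup>2)\<close> by (simp add: top_unique)
  qed
  then have "(\<integral>\<^sup>+\<omega>. ennreal (exp ((signal \<omega>)\<^sup>2 / (2 * r)\<^sup>2)) \<partial>P) \<le> 2"
    using r by (intro psi2_norm_le_imp_exp_moment)
  then have "pop.expectation (\<lambda>\<omega>. (signal \<omega>)^4) \<le> 4 * (2 * r)^4"
    by (intro pop.exp_moment_imp_moments(7)[OF measurable_signal]) (simp_all only: r zero_less_mult_iff, simp)
  also have "\<dots> = 64 * (r\<^sup>2)\<^sup>2" by (simp add: power4_eq_xxxx power2_eq_square)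
  also have "\<dots> = 64 * \<kappa>\<^sup>2 * signal_var\<^sup>2" by (simp add: r(2) power_mult_distrib)
  finally show ?thesis .
qed

section \<open>The statistic of the unpermuted data\<close>

text \<open>
  The contribution of a single observation to the gain of the true coefficient vector.
\<close>

definition score :: "(nat \<Rightarrow> real) \<times> real \<Rightarrow> real" where
  "score z = 2 * snd z * vinner p (fst z) \<beta> - (vinner p (fst z) \<beta>)\<^sup>2"

lemma measurable_score: "score \<in> borel_measurable (borel_vec p \<Otimes>\<^sub>M borel)"
proof -
  note [measurable] = measurable_compose[OF measurable_fst measurable_vinner]
  show ?thesis unfolding score_def[abs_def] by measurable
qed

text \<open>
  In terms of the model the score is \<open>\<mu>\<^sup>2 + 2 \<mu> \<epsilon>\<close>, whose cross term has mean zero by independence.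
\<close>

lemma score_moments:
  assumes K: "0 < K\<^sub>x" "0 < K\<^sub>\<mu>" "0 < K\<^sub>\<epsilon>"
  shows "integrable pair_law (\<lambda>z. (score z)\<^sup>2)" "integral\<^sup>L pair_law score = signal_var"
    "integral\<^sup>L pair_law (\<lambda>z. (score z)\<^sup>2) \<le> 2 * pop.expectation (\<lambda>\<omega>. (signal \<omega>)^4) + 8 * signal_var * \<sigma>\<^sub>\<epsilon>\<^sup>2"
proof -
  note sm = signal_moments[OF K(2,3)] and em = eps_moments[OF K(2,3)]
  have sc: "score (x \<omega>, vinner p (x \<omega>) \<beta> + \<epsilon> \<omega>) = (signal \<omega>)\<^sup>2 + 2 * (signal \<omega> * \<epsilon> \<omega>)" for \<omega>
    by (simp add: score_def signal_def power2_eq_square algebra_simps)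
  have c: "integrable P (\<lambda>\<omega>. signal \<omega> * \<epsilon> \<omega>)" "pop.expectation (\<lambda>\<omega>. signal \<omega> * \<epsilon> \<omega>) = 0"
    using pop.indep_var_integrable[OF indep_signal_eps sm(1) em(1)]
      pop.indep_var_lebesgue_integral[OF indep_signal_eps sm(1) em(1)] eps_mean by auto
  have "pop.indep_var borel ((\<lambda>u. u\<^sup>2) \<circ> signal) borel ((\<lambda>u. u\<^sup>2) \<circ> \<epsilon>)"
    by (rule pop.indep_var_compose[OF indep_signal_eps]) auto
  then have ind2: "pop.indep_var borel (\<lambda>\<omega>. (signal \<omega>)\<^sup>2) borel (\<lambda>\<omega>. (\<epsilon> \<omega>)\<^sup>2)" by (simp add: o_def)
  have c2: "integrable P (\<lambda>\<omega>. (signal \<omega>)\<^sup>2 * (\<epsilon> \<omega>)\<^sup>2)" "pop.expectation (\<lambda>\<omega>. (signal \<omega>)\<^sup>2 * (\<epsilon> \<omega>)\<^sup>2) = signal_var * \<sigma>\<^sub>\<epsilon>\<^sup>2"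
    using pop.indep_var_integrable[OF ind2 sm(2) em(2)]
      pop.indep_var_lebesgue_integral[OF ind2 sm(2) em(2)] em(3) by (auto simp: signal_var_def)
  have le: "((signal \<omega>)\<^sup>2 + 2 * (signal \<omega> * \<epsilon> \<omega>))\<^sup>2 \<le> 2 * (signal \<omega>)^4 + 8 * ((signal \<omega>)\<^sup>2 * (\<epsilon> \<omega>)\<^sup>2)" for \<omega>
  proof -
    have "(a + b)\<^sup>2 \<le> 2 * a\<^sup>2 + 2 * b\<^sup>2" for a b :: real
      using zero_le_power2[of "a - b"] unfolding power2_sum power2_diff by linarith
    from this[of "(signal \<omega>)\<^sup>2" "2 * (signal \<omega> * \<epsilon> \<omega>)"] show ?thesis
      by (simp add: power_mult_distrib flip: power_mult)
  qed
  have iR: "integrable P (\<lambda>\<omega>. 2 * (signal \<omega>)^4 + 8 * ((signal \<omega>)\<^sup>2 * (\<epsilon> \<omega>)\<^sup>2))"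
    using sm(3) c2(1) by (intro Bochner_Integration.integrable_add integrable_mult_right)
  have iS: "integrable P (\<lambda>\<omega>. ((signal \<omega>)\<^sup>2 + 2 * (signal \<omega> * \<epsilon> \<omega>))\<^sup>2)"
    by (rule Bochner_Integration.integrable_bound[OF iR]) (use le in auto)
  have ms: "(\<lambda>z. (score z)\<^sup>2) \<in> borel_measurable (borel_vec p \<Otimes>\<^sub>M borel)"
    using measurable_score by measurable
  show "integrable pair_law (\<lambda>z. (score z)\<^sup>2)"
    unfolding pair_law_def using iS by (subst integrable_distr_eq[OF measurable_pair ms]) (simp add: sc)
  have "integral\<^sup>L pair_law score = pop.expectation (\<lambda>\<omega>. (signal \<omega>)\<^sup>2 + 2 * (signal \<omega> * \<epsilon> \<omega>))"
    unfolding pair_law_def by (subst integral_distr[OF measurable_pair measurable_score]) (simp add: sc)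
  also have "\<dots> = signal_var" using sm(2) c by (simp add: signal_var_def)
  finally show "integral\<^sup>L pair_law score = signal_var" .
  have "integral\<^sup>L pair_law (\<lambda>z. (score z)\<^sup>2) = pop.expectation (\<lambda>\<omega>. ((signal \<omega>)\<^sup>2 + 2 * (signal \<omega> * \<epsilon> \<omega>))\<^sup>2)"
    unfolding pair_law_def by (subst integral_distr[OF measurable_pair ms]) (simp add: sc)
  also have "\<dots> \<le> pop.expectation (\<lambda>\<omega>. 2 * (signal \<omega>)^4 + 8 * ((signal \<omega>)\<^sup>2 * (\<epsilon> \<omega>)\<^sup>2))"
    using le by (intro integral_mono iS iR)
  also have "\<dots> = 2 * pop.expectation (\<lambda>\<omega>. (signal \<omega>)^4) + 8 * signal_var * \<sigma>\<^sub>\<epsilon>\<^sup>2"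
    using sm(3) c2 by simp
  finally show "integral\<^sup>L pair_law (\<lambda>z. (score z)\<^sup>2) \<le> \<dots>" .
qed

lemma signal_sum_lower_deviation:
  assumes K: "0 < K\<^sub>x" "0 < K\<^sub>\<mu>" "0 < K\<^sub>\<epsilon>" and n: "1 \<le> n" and signal_var: "0 < signal_var"
  shows "measure sample_law {d \<in> space sample_law. (\<Sum>i=1..n. score (d i)) \<le> n * signal_var / 2}
    \<le> 4 * (2 * pop.expectation (\<lambda>\<omega>. (signal \<omega>)^4) + 8 * signal_var * \<sigma>\<^sub>\<epsilon>\<^sup>2) / (n * signal_var\<^sup>2)"
proof -
  interpret L: prob_space sample_law by (rule prob_space_sample_law)
  note sm = score_moments[OF K]
  have sc: "score \<in> borel_measurable pair_law"
    using measurable_score measurable_cong_sets[OF sets_pair_law refl] by blast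
  have sc2: "(\<lambda>z. (score z)\<^sup>2) \<in> borel_measurable pair_law" using sc by measurable
  have ind: "L.indep_vars (\<lambda>_. borel) (\<lambda>i d. score (d i)) {1..n}"
  proof -
    have "L.indep_vars (\<lambda>_. pair_law) (\<lambda>i d. d i) {1..n}"
    proof (subst L.indep_vars_iff_distr_eq_PiM')
      show "{1..n} \<noteq> {}" using n by simp
      show "\<And>i. i \<in> {1..n} \<Longrightarrow> (\<lambda>d. d i) \<in> sample_law \<rightarrow>\<^sub>M pair_law" by (rule coord_sample_law)
      have "distr sample_law (\<Pi>\<^sub>M i\<in>{1..n}. pair_law) (\<lambda>d. \<lambda>i\<in>{1..n}. d i) = distr sample_law sample_law (\<lambda>d. d)"
      proof (rule distr_cong)
        fix d assume "d \<in> space sample_law"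
        then have "d \<in> extensional {1..n}" unfolding space_sample_law by (simp add: PiE_def)
        then show "(\<lambda>i\<in>{1..n}. d i) = d" by (rule extensional_restrict)
      qed (simp_all add: sample_law_def)
      also have "\<dots> = sample_law" by simp
      also have "\<dots> = (\<Pi>\<^sub>M i\<in>{1..n}. distr sample_law pair_law (\<lambda>d. d i))"
        by (subst sample_law_def) (intro PiM_cong refl coord_sample_law(2)[symmetric])
      finally show "distr sample_law (\<Pi>\<^sub>M i\<in>{1..n}. pair_law) (\<lambda>d. \<lambda>i\<in>{1..n}. d i)
        = (\<Pi>\<^sub>M i\<in>{1..n}. distr sample_law pair_law (\<lambda>d. d i))" .
    qed
    from L.indep_vars_compose2[OF this, of "\<lambda>_. score"] sc show ?thesis by simp
  qed
  have tr: "integrable sample_law (\<lambda>d. f (d i)) = integrable pair_law f"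
    "integral\<^sup>L sample_law (\<lambda>d. f (d i)) = integral\<^sup>L pair_law f"
    if "i \<in> {1..n}" "f \<in> borel_measurable pair_law" for i and f :: "_ \<Rightarrow> real"
    using integrable_distr_eq[OF coord_sample_law(1)[OF that(1)] that(2)]
      integral_distr[OF coord_sample_law(1)[OF that(1)] that(2)] coord_sample_law(2)[OF that(1)] by simp_all
  have "L.prob {d \<in> space sample_law. (\<Sum>i=1..n. score (d i)) \<le> card {1..n} * signal_var / 2}
    \<le> 4 * (2 * pop.expectation (\<lambda>\<omega>. (signal \<omega>)^4) + 8 * signal_var * \<sigma>\<^sub>\<epsilon>\<^sup>2) / (card {1..n} * signal_var\<^sup>2)"
  proof (rule L.iid_sum_lower_deviation[OF _ _ ind signal_var])
    show "{1..n} \<noteq> {}" using n by simp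
    fix i assume i: "i \<in> {1..n}"
    show "integrable sample_law (\<lambda>d. (score (d i))\<^sup>2)" using tr(1)[OF i sc2] sm(1) by simp
    show "L.expectation (\<lambda>d. (score (d i))\<^sup>2) \<le> 2 * pop.expectation (\<lambda>\<omega>. (signal \<omega>)^4) + 8 * signal_var * \<sigma>\<^sub>\<epsilon>\<^sup>2"
      using tr(2)[OF i sc2] sm(3) by simp
    show "L.expectation (\<lambda>d. score (d i)) = signal_var" using tr(2)[OF i sc] sm(2) by simp
  qed simp
  then show ?thesis by simp
qed

section \<open>The statistic of the permuted data and the power\<close>

text \<open>
  Each of the three colour classes contributes one bound for independent rows and responses, each
  fixed point of \<open>\<pi>\<close> the second moment of one response.
\<close>

lemma nn_integral_permuted_gain_le:
  assumes K: "0 < K\<^sub>x" "0 < K\<^sub>\<mu>" "0 < K\<^sub>\<epsilon>" and p: "1 \<le> p" and \<pi>: "\<pi> permutes {1..n}"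
  shows "(\<integral>\<^sup>+d. max_gain p s {1..n} \<pi> d \<partial>sample_law)
    \<le> ennreal ((\<Sum>i\<in>{1..n}. of_bool (\<pi> i = i)) * (8 * k\<^sub>y\<^sup>2)
        + 24 * (2 * k\<^sub>y)\<^sup>2 * (1 + real (min s p) * (ln p + ln 2)))"
proof -
  interpret L: prob_space sample_law by (rule prob_space_sample_law)
  let ?B = "8 * (2 * k\<^sub>y)\<^sup>2 * (1 + real (min s p) * (ln p + ln 2))"
  have B: "0 \<le> ?B" using p by (intro mult_nonneg_nonneg add_nonneg_nonneg) auto
  have k: "0 < 2 * k\<^sub>y" using K by (simp add: k\<^sub>y_def)
  obtain c :: "nat \<Rightarrow> nat" where c: "\<And>i. c i < 3" "\<And>i. i \<in> {1..n} \<Longrightarrow> \<pi> i \<noteq> i \<Longrightarrow> c (\<pi> i) \<noteq> c i"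
    using three_colouring_inj[of "{1..n}" \<pi>] permutes_inj[OF \<pi>] permutes_in_image[OF \<pi>] by blast
  define I where "I k = {i\<in>{1..n}. \<pi> i \<noteq> i \<and> c i = k}" for k
  have I: "I k \<subseteq> {1..n}" "\<pi> ` I k \<inter> I k = {}" for k
  proof -
    show "I k \<subseteq> {1..n}" by (auto simp: I_def)
    have "\<pi> i \<notin> I k" if "i \<in> I k" for i
      using c(2)[of i] that by (simp add: I_def)
    then show "\<pi> ` I k \<inter> I k = {}" by blast
  qed
  have \<pi>I: "\<pi> ` I k \<subseteq> {1..n}" for k
    using I(1)[of k] permutes_in_image[OF \<pi>] by blast
  have [measurable]: "max_gain p s (I k) \<pi> \<in> borel_measurable sample_law" for k
    by (intro measurable_sample_law measurable_max_gain I \<pi>I)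
  have snd_meas: "(\<lambda>z. ennreal ((snd z)\<^sup>2)) \<in> borel_measurable pair_law"
  proof -
    have "(\<lambda>z. ennreal ((snd z)\<^sup>2)) \<in> borel_measurable (borel_vec p \<Otimes>\<^sub>M borel)" by measurable
    then show ?thesis using measurable_cong_sets[OF sets_pair_law refl] by blast
  qed
  have sq_meas[measurable]: "(\<lambda>d. ennreal ((snd (d i))\<^sup>2)) \<in> borel_measurable sample_law" if "i \<in> {1..n}" for i
    by (rule measurable_compose[OF coord_sample_law(1)[OF that] snd_meas])
  have sq: "(\<integral>\<^sup>+d. ennreal ((snd (d i))\<^sup>2) \<partial>sample_law) \<le> ennreal (8 * k\<^sub>y\<^sup>2)" if "i \<in> {1..n}" for i
  proof -
    have "(\<integral>\<^sup>+d. ennreal ((snd (d i))\<^sup>2) \<partial>sample_law)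
        = (\<integral>\<^sup>+z. ennreal ((snd z)\<^sup>2) \<partial>(distr sample_law pair_law (\<lambda>d. d i)))"
      by (rule nn_integral_distr[symmetric, OF coord_sample_law(1)[OF that]]) (simp add: snd_meas)
    then show ?thesis using pair_law_second_moment[OF K(2,3)] by (simp only: coord_sample_law(2)[OF that])
  qed
  have "(\<integral>\<^sup>+d. max_gain p s {1..n} \<pi> d \<partial>sample_law)
     \<le> (\<integral>\<^sup>+d. (\<Sum>i\<in>{1..n}. of_bool (\<pi> i = i) * ennreal ((snd (d i))\<^sup>2)) + (\<Sum>k<3. max_gain p s (I k) \<pi> d) \<partial>sample_law)"
    unfolding I_def by (intro nn_integral_mono max_gain_subadditive \<pi> c)
  also have "\<dots> = (\<integral>\<^sup>+d. (\<Sum>i\<in>{1..n}. of_bool (\<pi> i = i) * ennreal ((snd (d i))\<^sup>2)) \<partial>sample_law)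
      + (\<integral>\<^sup>+d. (\<Sum>k<3. max_gain p s (I k) \<pi> d) \<partial>sample_law)"
    by (rule nn_integral_add) measurable
  also have "(\<integral>\<^sup>+d. (\<Sum>i\<in>{1..n}. of_bool (\<pi> i = i) * ennreal ((snd (d i))\<^sup>2)) \<partial>sample_law)
     = (\<Sum>i\<in>{1..n}. of_bool (\<pi> i = i) * (\<integral>\<^sup>+d. ennreal ((snd (d i))\<^sup>2) \<partial>sample_law))"
  proof -
    have "(\<integral>\<^sup>+d. (\<Sum>i\<in>{1..n}. of_bool (\<pi> i = i) * ennreal ((snd (d i))\<^sup>2)) \<partial>sample_law)
        = (\<Sum>i\<in>{1..n}. (\<integral>\<^sup>+d. of_bool (\<pi> i = i) * ennreal ((snd (d i))\<^sup>2) \<partial>sample_law))"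
      by (intro nn_integral_sum borel_measurable_times_ennreal borel_measurable_const sq_meas)
    also have "\<dots> = (\<Sum>i\<in>{1..n}. of_bool (\<pi> i = i) * (\<integral>\<^sup>+d. ennreal ((snd (d i))\<^sup>2) \<partial>sample_law))"
      by (intro sum.cong refl nn_integral_cmult sq_meas)
    finally show ?thesis .
  qed
  also have "(\<integral>\<^sup>+d. (\<Sum>k<3. max_gain p s (I k) \<pi> d) \<partial>sample_law) = (\<Sum>k<3. (\<integral>\<^sup>+d. max_gain p s (I k) \<pi> d \<partial>sample_law))"
    by (rule nn_integral_sum) measurable
  also have "(\<Sum>i\<in>{1..n}. of_bool (\<pi> i = i) * (\<integral>\<^sup>+d. ennreal ((snd (d i))\<^sup>2) \<partial>sample_law))
      + (\<Sum>k<3. (\<integral>\<^sup>+d. max_gain p s (I k) \<pi> d \<partial>sample_law))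
     \<le> (\<Sum>i\<in>{1..n}. of_bool (\<pi> i = i) * ennreal (8 * k\<^sub>y\<^sup>2)) + (\<Sum>k<(3::nat). ennreal ?B)"
  proof (intro add_mono sum_mono mult_left_mono sq)
    fix k
    show "(\<integral>\<^sup>+d. max_gain p s (I k) \<pi> d \<partial>sample_law) \<le> ennreal ?B"
      unfolding sample_law_def
      by (rule nn_integral_max_gain_le[OF prob_space_pair_law sets_pair_law k pair_law_mgf[OF K] \<pi> I p])
  qed auto
  also have "\<dots> = ennreal ((\<Sum>i\<in>{1..n}. of_bool (\<pi> i = i)) * (8 * k\<^sub>y\<^sup>2)) + ennreal (3 * ?B)"
  proof -
    have "(\<Sum>i\<in>{1..n}. of_bool (\<pi> i = i) * ennreal (8 * k\<^sub>y\<^sup>2)) = (\<Sum>i\<in>{1..n}. ennreal (of_bool (\<pi> i = i) * (8 * k\<^sub>y\<^sup>2)))"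
    proof (rule sum.cong[OF refl])
      fix i
      show "of_bool (\<pi> i = i) * ennreal (8 * k\<^sub>y\<^sup>2) = ennreal (of_bool (\<pi> i = i) * (8 * k\<^sub>y\<^sup>2))"
        by (cases "\<pi> i = i") simp_all
    qed
    also have "\<dots> = ennreal ((\<Sum>i\<in>{1..n}. of_bool (\<pi> i = i)) * (8 * k\<^sub>y\<^sup>2))"
      unfolding sum_distrib_right by (rule sum_ennreal) simp
    finally have a: "(\<Sum>i\<in>{1..n}. of_bool (\<pi> i = i) * ennreal (8 * k\<^sub>y\<^sup>2)) = \<dots>" .
    have b: "(\<Sum>k<(3::nat). ennreal ?B) = ennreal (3 * ?B)"
      using B by (subst sum_ennreal) simp_all
    show ?thesis unfolding a b ..
  qed
  also have "\<dots> = ennreal ((\<Sum>i\<in>{1..n}. of_bool (\<pi> i = i)) * (8 * k\<^sub>y\<^sup>2) + 3 * ?B)"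
  proof (rule ennreal_plus[symmetric])
    show "0 \<le> (\<Sum>i\<in>{1..n}. of_bool (\<pi> i = i)) * (8 * k\<^sub>y\<^sup>2)"
      by (intro mult_nonneg_nonneg sum_nonneg) auto
    show "0 \<le> 3 * ?B" using B by linarith
  qed
  also have "3 * ?B = 24 * (2 * k\<^sub>y)\<^sup>2 * (1 + real (min s p) * (ln p + ln 2))" by algebra
  finally show ?thesis .
qed

text \<open>
  If the permuted statistic is not below the original one, then either the original one is at most
  \<open>n v / 2\<close>, where \<open>v\<close> is the signal variance, or the permuted one is at least \<open>n v / 2\<close>.
\<close>

lemma permuted_stat_exceeds_prob_le:
  assumes K: "0 < K\<^sub>x" "0 < K\<^sub>\<mu>" "0 < K\<^sub>\<epsilon>" and p: "1 \<le> p" and n: "1 \<le> n" and signal_var: "0 < signal_var"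
    and \<pi>: "\<pi> permutes {1..n}"
  shows "measure sample_law {d \<in> space sample_law. perm_stat n p est d id \<le> perm_stat n p est d \<pi>}
    \<le> 4 * (2 * pop.expectation (\<lambda>\<omega>. (signal \<omega>)^4) + 8 * signal_var * \<sigma>\<^sub>\<epsilon>\<^sup>2) / (n * signal_var\<^sup>2)
      + 2 / (n * signal_var) * ((\<Sum>i\<in>{1..n}. of_bool (\<pi> i = i)) * (8 * k\<^sub>y\<^sup>2)
        + 24 * (2 * k\<^sub>y)\<^sup>2 * (1 + real (min s p) * (ln p + ln 2)))"
    (is "_ \<le> ?a + 2 / (n * signal_var) * ?b")
proof -
  interpret L: prob_space sample_law by (rule prob_space_sample_law)
  have nq: "0 < n * signal_var" using n signal_var by simp
  have c0: "0 \<le> 1 + real (min s p) * (ln p + ln 2)"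
    using p by (intro add_nonneg_nonneg mult_nonneg_nonneg) auto
  have b0: "0 \<le> ?b" by (intro add_nonneg_nonneg mult_nonneg_nonneg sum_nonneg c0) auto
  let ?A = "{d \<in> space sample_law. (\<Sum>i=1..n. score (d i)) \<le> n * signal_var / 2}"
  let ?H = "{d \<in> space sample_law. 1 \<le> ennreal (2 / (n * signal_var)) * max_gain p s {1..n} \<pi> d}"
  have [measurable]: "max_gain p s {1..n} \<pi> \<in> borel_measurable sample_law"
    using permutes_image[OF \<pi>] by (intro measurable_sample_law measurable_max_gain) auto
  have [measurable]: "score \<in> borel_measurable pair_law"
    using measurable_score measurable_cong_sets[OF sets_pair_law refl] by blast
  have [measurable]: "(\<lambda>d. score (d i)) \<in> borel_measurable sample_law" if "i \<in> {1..n}" for i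
    by (rule measurable_compose[OF coord_sample_law(1)[OF that]]) measurable
  have A: "?A \<in> sets sample_law" by measurable
  have H: "?H \<in> sets sample_law" by measurable
  have sub: "{d \<in> space sample_law. perm_stat n p est d id \<le> perm_stat n p est d \<pi>} \<subseteq> ?A \<union> ?H"
  proof
    fix d assume "d \<in> {d \<in> space sample_law. perm_stat n p est d id \<le> perm_stat n p est d \<pi>}"
    then have d: "d \<in> space sample_law" "d \<in> datasets n p" "perm_stat n p est d id \<le> perm_stat n p est d \<pi>"
      by (auto simp: space_sample_law)
    show "d \<in> ?A \<union> ?H"
    proof (cases "(\<Sum>i=1..n. score (d i)) \<le> n * signal_var / 2")
      case False
      note ps = perm_stat_eq_gain_of_estimator[OF estimator d(2) permutes_id]
      have "(\<Sum>i=1..n. score (d i)) = gain p {1..n} id d \<beta>"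
        by (simp add: gain_def score_def)
      also have "\<dots> \<le> perm_stat n p est d id"
        unfolding ps(3) using beta_vec beta_sparse tuning_ge by (intro ps(4)) auto
      finally have "n * signal_var / 2 \<le> perm_stat n p est d \<pi>" using False d(3) by linarith
      then have "1 \<le> 2 / (n * signal_var) * perm_stat n p est d \<pi>" using nq by (simp add: field_simps)
      then have "ennreal 1 \<le> ennreal (2 / (n * signal_var) * perm_stat n p est d \<pi>)" by (rule ennreal_leI)
      also have "\<dots> = ennreal (2 / (n * signal_var)) * ennreal (perm_stat n p est d \<pi>)"
        using nq by (intro ennreal_mult') auto
      also have "\<dots> = ennreal (2 / (n * signal_var)) * max_gain p s {1..n} \<pi> d"
        by (simp only: perm_stat_eq_max_gain[OF estimator d(2) \<pi>])
      finally show ?thesis using d(1) by simp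
    qed (use d in simp)
  qed
  have "emeasure sample_law ?H \<le> ennreal (2 / (n * signal_var)) * (\<integral>\<^sup>+d. max_gain p s {1..n} \<pi> d * indicator (space sample_law) d \<partial>sample_law)"
    by (rule nn_integral_Markov_inequality) measurable
  also have "(\<integral>\<^sup>+d. max_gain p s {1..n} \<pi> d * indicator (space sample_law) d \<partial>sample_law) = (\<integral>\<^sup>+d. max_gain p s {1..n} \<pi> d \<partial>sample_law)"
    by (intro nn_integral_cong) simp
  also have "ennreal (2 / (n * signal_var)) * \<dots> \<le> ennreal (2 / (n * signal_var)) * ennreal ?b"
    by (intro mult_left_mono nn_integral_permuted_gain_le K p \<pi>) auto
  also have "\<dots> = ennreal (2 / (n * signal_var) * ?b)" using nq by (intro ennreal_mult'[symmetric]) auto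
  finally have H_le: "measure sample_law ?H \<le> 2 / (n * signal_var) * ?b"
    using nq b0 by (subst (asm) L.emeasure_eq_measure, subst (asm) ennreal_le_iff) (auto intro!: mult_nonneg_nonneg)
  have "measure sample_law {d \<in> space sample_law. perm_stat n p est d id \<le> perm_stat n p est d \<pi>} \<le> measure sample_law (?A \<union> ?H)"
    using sub A H by (intro L.finite_measure_mono) auto
  also have "\<dots> \<le> measure sample_law ?A + measure sample_law ?H"
    by (rule measure_Un_le[OF A H])
  also have "\<dots> \<le> ?a + 2 / (n * signal_var) * ?b"
    by (intro add_mono H_le signal_sum_lower_deviation K n signal_var)
  finally show ?thesis .
qed

text \<open>
  Markov's inequality for the p-value. Only the number of fixed points depends on \<open>\<pi>\<close>, and its average
  is at most one.
\<close>

lemma non_rejection_prob_le: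
  assumes K: "0 < K\<^sub>x" "0 < K\<^sub>\<mu>" "0 < K\<^sub>\<epsilon>" and p: "1 \<le> p" and n: "1 \<le> n" and signal_var: "0 < signal_var" and \<alpha>: "0 < \<alpha>"
  shows "1 - rejection_prob M n p est Z \<alpha> \<le>
    (4 * (2 * pop.expectation (\<lambda>\<omega>. (signal \<omega>)^4) + 8 * signal_var * \<sigma>\<^sub>\<epsilon>\<^sup>2) / (n * signal_var\<^sup>2)
      + 2 / (n * signal_var) * (8 * k\<^sub>y\<^sup>2 + 24 * (2 * k\<^sub>y)\<^sup>2 * (1 + real (min s p) * (ln p + ln 2)))) / \<alpha>"
    (is "_ \<le> (?a + 2 / (n * signal_var) * (?k + ?b)) / \<alpha>")
proof -
  interpret L: prob_space sample_law by (rule prob_space_sample_law)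
  let ?G = "{\<pi>. \<pi> permutes {1..n}}"
  let ?N = "real (card ?G)"
  have finG: "finite ?G" by (rule finite_permutations) simp
  have "id \<in> ?G" using permutes_id by simp
  then have "?G \<noteq> {}" by blast
  then have N: "0 < ?N" using finG by (simp add: card_gt_0_iff)
  have nq: "0 < n * signal_var" using n signal_var by simp
  have average: "(\<Sum>\<pi>\<in>?G. a + t * (f \<pi> * k + b)) = ?N * a + t * (sum f ?G * k + ?N * b)"
    for a t k b :: real and f
    by (simp add: sum.distrib distrib_left flip: sum_distrib_left sum_distrib_right)
  define R where "R \<pi> = {d \<in> space sample_law. perm_stat n p est d id \<le> perm_stat n p est d \<pi>}" for \<pi>
  have pv_meas[measurable]: "perm_pvalue n p est \<in> borel_measurable sample_law"
    by (rule measurable_sample_law[OF measurable_perm_pvalue[OF estimator]])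
  have [measurable]: "(\<lambda>d. perm_stat n p est d \<pi>) \<in> borel_measurable sample_law" if "\<pi> permutes {1..n}" for \<pi>
    by (rule measurable_sample_law[OF measurable_perm_stat[OF estimator that]])
  have R: "R \<pi> \<in> sets sample_law" if "\<pi> \<in> ?G" for \<pi>
    using that permutes_id[of "{1..n}"] unfolding R_def by (intro borel_measurable_le) auto
  have pv: "perm_pvalue n p est d = (\<Sum>\<pi>\<in>?G. indicator (R \<pi>) d) / ?N" if "d \<in> space sample_law" for d
    unfolding perm_pvalue_def R_def using that
    by (intro arg_cong2[where f = "(/)"] sum.cong refl) (auto simp: indicator_def)
  have int_ind: "integrable sample_law (\<lambda>d. (\<Sum>\<pi>\<in>?G. indicator (R \<pi>) d :: real) / ?N)"
    using R by (intro integrable_divide Bochner_Integration.integrable_sum) (auto simp: L.emeasure_eq_measure)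
  have int_pv: "integrable sample_law (perm_pvalue n p est)"
    using int_ind by (rule Bochner_Integration.integrable_cong[THEN iffD2, rotated -1]) (auto simp: pv)
  have "L.expectation (perm_pvalue n p est) = L.expectation (\<lambda>d. (\<Sum>\<pi>\<in>?G. indicator (R \<pi>) d :: real) / ?N)"
    by (intro Bochner_Integration.integral_cong refl pv)
  also have "\<dots> = (\<Sum>\<pi>\<in>?G. L.prob (R \<pi>)) / ?N"
    using R by (simp add: Bochner_Integration.integral_sum L.emeasure_eq_measure)
  also have "\<dots> \<le> (\<Sum>\<pi>\<in>?G. ?a + 2 / (n * signal_var) * ((\<Sum>i\<in>{1..n}. of_bool (\<pi> i = i)) * ?k + ?b)) / ?N"
    unfolding R_def using N by (intro divide_right_mono sum_mono permuted_stat_exceeds_prob_le K p n signal_var) auto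
  also have "(\<Sum>\<pi>\<in>?G. ?a + 2 / (n * signal_var) * ((\<Sum>i\<in>{1..n}. of_bool (\<pi> i = i)) * ?k + ?b))
     = ?N * ?a + 2 / (n * signal_var) * ((\<Sum>\<pi>\<in>?G. \<Sum>i\<in>{1..n}. of_bool (\<pi> i = i)) * ?k + ?N * ?b)"
    by (rule average)
  also have "\<dots> \<le> ?N * ?a + 2 / (n * signal_var) * (?N * ?k + ?N * ?b)"
    using nq sum_card_fixed_points_of_permutations[of "{1..n}"]
    by (intro add_left_mono mult_left_mono add_right_mono mult_right_mono) auto
  also have "\<dots> = (?a + 2 / (n * signal_var) * (?k + ?b)) * ?N" by algebra
  finally have E_le: "L.expectation (perm_pvalue n p est) \<le> ?a + 2 / (n * signal_var) * (?k + ?b)"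
    using N by (simp add: divide_right_mono)
  have "1 - rejection_prob M n p est Z \<alpha> = L.prob {d \<in> space sample_law. \<not> perm_pvalue n p est d \<le> \<alpha>}"
    unfolding rejection_prob_sample_law[OF n] by (subst L.prob_neg) auto
  also have "\<dots> \<le> L.prob {d \<in> space sample_law. \<alpha> \<le> perm_pvalue n p est d}"
    by (intro L.finite_measure_mono) auto
  also have "\<dots> \<le> L.expectation (perm_pvalue n p est) / \<alpha>"
    using \<alpha> by (intro integral_Markov_inequality_measure[where A = "{}"] int_pv)
       (auto simp: perm_pvalue_def intro!: AE_I2 divide_nonneg_nonneg sum_nonneg)
  also have "\<dots> \<le> (?a + 2 / (n * signal_var) * (?k + ?b)) / \<alpha>"
    using E_le \<alpha> by (intro divide_right_mono) auto
  finally show ?thesis .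
qed

lemma tuning_constant:
  shows "real s \<le> C * real s_star" "0 \<le> C"
proof -
  show s: "real s \<le> C * real s_star" using tuning_order(2) sparsity_level by (simp add: field_simps)
  have "0 \<le> C * real s_star" using s by (rule order_trans[rotated]) simp
  then show "0 \<le> C" using sparsity_level by (simp add: zero_le_mult_iff)
qed

text \<open>
  If \<open>p = 1\<close> the logarithm vanishes, but then a support has at most one element, so the constant
  term suffices; if \<open>p \<ge> 2\<close> then \<open>ln 2\<close> is at most \<open>ln p\<close>.
\<close>

lemma log_number_of_supports_le:
  assumes "1 \<le> p"
  shows "1 + real (min s p) * (ln p + ln 2) \<le> 2 * (1 + C) * (1 + real s_star * ln p)"
proof -
  note s = tuning_constant(1) and C = tuning_constant(2)
  have lp: "0 \<le> ln (real p)" using assms by simp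
  have ss: "0 \<le> real s_star * ln p" using lp by simp
  have "real (min s p) * (ln p + ln 2) \<le> 1 + 2 * C * (real s_star * ln p)"
  proof (cases "p = 1")
    case True
    then have "real (min s p) * (ln p + ln 2) \<le> 1 * ln 2" by (intro mult_mono) auto
    then have "real (min s p) * (ln p + ln 2) \<le> 1" using ln_2_less_1 by linarith
    then show ?thesis using True by simp
  next
    case False
    then have "ln 2 \<le> ln (real p)" using assms by simp
    then have "real (min s p) * (ln p + ln 2) \<le> real s * (2 * ln p)" using lp by (intro mult_mono) auto
    also have "\<dots> \<le> (C * real s_star) * (2 * ln p)" using s lp by (intro mult_right_mono) auto
    finally show ?thesis by (simp add: mult_ac)
  qed
  then have "1 + real (min s p) * (ln p + ln 2) \<le> 2 + 2 * C * (real s_star * ln p)" by linarith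
  also have "\<dots> \<le> 2 * (1 + C) * (1 + real s_star * ln p)"
    using C ss by (simp add: algebra_simps)
  finally show ?thesis .
qed

lemma rejection_prob_ge:
  assumes K: "0 < K\<^sub>x" "0 < K\<^sub>\<mu>" "0 < K\<^sub>\<epsilon>" and p: "1 \<le> p" and n: "1 \<le> n" and signal_var: "0 < signal_var" and \<alpha>: "0 < \<alpha>"
  shows "1 - (8 * pop.expectation (\<lambda>\<omega>. (signal \<omega>)^4) / (n * signal_var\<^sup>2)
      + (32 * \<sigma>\<^sub>\<epsilon>\<^sup>2 + 416 * k\<^sub>y\<^sup>2 * (1 + C) * (1 + real s_star * ln p)) / (n * signal_var)) / \<alpha>
    \<le> rejection_prob M n p est Z \<alpha>"
proof -
  let ?c = "1 + real (min s p) * (ln p + ln 2)" and ?r = "(1 + C) * (1 + real s_star * ln p)"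
  have nq: "0 < n * signal_var" using n signal_var by simp
  have cr: "?c \<le> 2 * ?r" using log_number_of_supports_le[OF p] by (simp only: mult.assoc)
  have c1: "1 \<le> ?c" using p by simp
  have "8 * k\<^sub>y\<^sup>2 + 24 * (2 * k\<^sub>y)\<^sup>2 * ?c = k\<^sub>y\<^sup>2 * (8 + 96 * ?c)"
    by (simp add: power_mult_distrib algebra_simps)
  also have "\<dots> \<le> k\<^sub>y\<^sup>2 * (208 * ?r)" using cr c1 by (intro mult_left_mono) auto
  finally have "2 / (n * signal_var) * (8 * k\<^sub>y\<^sup>2 + 24 * (2 * k\<^sub>y)\<^sup>2 * ?c) \<le> 2 / (n * signal_var) * (k\<^sub>y\<^sup>2 * (208 * ?r))"
    using nq by (intro mult_left_mono) auto
  also have "\<dots> = 416 * k\<^sub>y\<^sup>2 * (1 + C) * (1 + real s_star * ln p) / (n * signal_var)"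
    by (simp add: mult_ac)
  finally have 1: "2 / (n * signal_var) * (8 * k\<^sub>y\<^sup>2 + 24 * (2 * k\<^sub>y)\<^sup>2 * ?c) \<le> \<dots>" .
  have 2: "4 * (2 * pop.expectation (\<lambda>\<omega>. (signal \<omega>)^4) + 8 * signal_var * \<sigma>\<^sub>\<epsilon>\<^sup>2) / (n * signal_var\<^sup>2)
     = 8 * pop.expectation (\<lambda>\<omega>. (signal \<omega>)^4) / (n * signal_var\<^sup>2) + 32 * \<sigma>\<^sub>\<epsilon>\<^sup>2 / (n * signal_var)"
    using n signal_var by (simp add: field_simps power2_eq_square)
  have "1 - rejection_prob M n p est Z \<alpha> \<le> (8 * pop.expectation (\<lambda>\<omega>. (signal \<omega>)^4) / (n * signal_var\<^sup>2)
      + 32 * \<sigma>\<^sub>\<epsilon>\<^sup>2 / (n * signal_var) + 2 / (n * signal_var) * (8 * k\<^sub>y\<^sup>2 + 24 * (2 * k\<^sub>y)\<^sup>2 * ?c)) / \<alpha>"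
    using non_rejection_prob_le[OF K p n signal_var \<alpha>] unfolding 2 .
  also have "\<dots> \<le> (8 * pop.expectation (\<lambda>\<omega>. (signal \<omega>)^4) / (n * signal_var\<^sup>2)
      + (32 * \<sigma>\<^sub>\<epsilon>\<^sup>2 + 416 * k\<^sub>y\<^sup>2 * (1 + C) * (1 + real s_star * ln p)) / (n * signal_var)) / \<alpha>"
    using 1 \<alpha> unfolding add_divide_distrib[of "32 * \<sigma>\<^sub>\<epsilon>\<^sup>2"] by (intro divide_right_mono) linarith+
  finally have "1 - rejection_prob M n p est Z \<alpha> \<le> \<dots>" .
  then show ?thesis by linarith
qed

lemma dimension_pos_if_full_support: "l0_norm p \<beta> = s_star \<Longrightarrow> 1 \<le> p"
  using sparsity_level by (cases "p = 0") (auto simp: l0_norm_def)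

text \<open>
  The constant in front of \<open>1 / h\<close> in the bounds on the probability of not rejecting.
\<close>

definition power_const :: real where
  "power_const = 32 * k\<^sub>y^4 + 32 * \<sigma>\<^sub>\<epsilon>\<^sup>2 + 416 * k\<^sub>y\<^sup>2 * (1 + C)"

lemma noise_term_le:
  assumes p: "1 \<le> p" and b: "0 < b" "1 + real s_star * ln p \<le> b"
  shows "32 * \<sigma>\<^sub>\<epsilon>\<^sup>2 + 416 * k\<^sub>y\<^sup>2 * (1 + C) * (1 + real s_star * ln p) \<le> (power_const - 32 * k\<^sub>y^4) * b"
proof -
  have "1 \<le> b" using b p by (simp add: add_increasing2 order_trans[OF _ b(2)])
  then have "32 * \<sigma>\<^sub>\<epsilon>\<^sup>2 * 1 \<le> 32 * \<sigma>\<^sub>\<epsilon>\<^sup>2 * b" by (intro mult_left_mono) auto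
  moreover have "416 * k\<^sub>y\<^sup>2 * (1 + C) * (1 + real s_star * ln p) \<le> 416 * k\<^sub>y\<^sup>2 * (1 + C) * b"
    using tuning_constant(2) b by (intro mult_left_mono mult_nonneg_nonneg) auto
  moreover have "(power_const - 32 * k\<^sub>y^4) * b = 32 * \<sigma>\<^sub>\<epsilon>\<^sup>2 * b + 416 * k\<^sub>y\<^sup>2 * (1 + C) * b"
    unfolding power_const_def by algebra
  ultimately show ?thesis by linarith
qed

text \<open>
  The two summands of the signal strength are used separately: \<open>n v \<ge> h \<surd>n\<close> gives \<open>n v\<^sup>2 \<ge> h\<^sup>2\<close>, which controls
  the fluctuation of the signal, and \<open>n v \<ge> h (1 + s\<^sup>* ln p)\<close> beats the permuted statistic.
\<close>

lemma power_root_n_alternative: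
  assumes K: "0 < K\<^sub>x" "0 < K\<^sub>\<mu>" "0 < K\<^sub>\<epsilon>" and n: "1 \<le> n" and \<alpha>: "0 < \<alpha>" and h: "1 \<le> h"
    and full: "l0_norm p \<beta> = s_star"
    and sig: "quad_form p (covariance_matrix P x) \<beta> = h * (1 / sqrt n + real s_star * ln p / n)"
  shows "1 - power_const / h / \<alpha> \<le> rejection_prob M n p est Z \<alpha>"
proof -
  note p = dimension_pos_if_full_support[OF full]
  have signal_var: "signal_var = h * (1 / sqrt n + real s_star * ln p / n)" using sig quad_form_covariance[OF K(1)] by simp
  have sl: "0 \<le> real s_star * ln p" using p by simp
  have sn: "1 \<le> sqrt n" using n by simp
  have nq: "n * signal_var = h * (sqrt n + real s_star * ln p)"
  proof -
    have "n * (1 / sqrt n) = sqrt n" using n by (simp add: real_div_sqrt)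
    moreover have "n * (real s_star * ln p / n) = real s_star * ln p" using n by simp
    ultimately have "n * (1 / sqrt n + real s_star * ln p / n) = sqrt n + real s_star * ln p"
      by (simp only: distrib_left)
    then show ?thesis unfolding signal_var by (simp add: mult.left_commute)
  qed
  have nq1: "h * (1 + real s_star * ln p) \<le> n * signal_var"
    unfolding nq using sn h by (intro mult_left_mono) auto
  have nq2: "h * sqrt n \<le> n * signal_var" unfolding nq using sl h by (intro mult_left_mono) auto
  have "0 < h * sqrt n" using n h by simp
  then have nq0: "0 < n * signal_var" using nq2 by linarith
  then have q0: "0 < signal_var" using n by (simp add: zero_less_mult_iff)
  have "h * n \<le> h\<^sup>2 * n" using h by (intro mult_right_mono) (auto simp: power2_eq_square)
  also have "\<dots> = (h * sqrt n)\<^sup>2" by (simp add: power_mult_distrib)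
  also have "\<dots> \<le> (n * signal_var)\<^sup>2" using nq2 h by (intro power_mono) auto
  also have "\<dots> = n * (n * signal_var\<^sup>2)" by (simp add: power2_eq_square mult_ac)
  finally have nqq: "h \<le> n * signal_var\<^sup>2" using n by simp
  have "8 * pop.expectation (\<lambda>\<omega>. (signal \<omega>)^4) / (n * signal_var\<^sup>2) \<le> 32 * k\<^sub>y^4 / h"
    using signal_moments(5)[OF K(2,3)] nqq h by (intro frac_le) auto
  moreover have "(32 * \<sigma>\<^sub>\<epsilon>\<^sup>2 + 416 * k\<^sub>y\<^sup>2 * (1 + C) * (1 + real s_star * ln p)) / (n * signal_var) \<le> (power_const - 32 * k\<^sub>y^4) / h"
  proof -
    have "1 + real s_star * ln p \<le> n * signal_var / h" using nq1 h by (simp add: field_simps)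
    then have "32 * \<sigma>\<^sub>\<epsilon>\<^sup>2 + 416 * k\<^sub>y\<^sup>2 * (1 + C) * (1 + real s_star * ln p) \<le> (power_const - 32 * k\<^sub>y^4) * (n * signal_var / h)"
      using nq0 h by (intro noise_term_le p) auto
    then have "(32 * \<sigma>\<^sub>\<epsilon>\<^sup>2 + 416 * k\<^sub>y\<^sup>2 * (1 + C) * (1 + real s_star * ln p)) / (n * signal_var)
        \<le> (power_const - 32 * k\<^sub>y^4) * (n * signal_var / h) / (n * signal_var)"
      using nq0 by (intro divide_right_mono) auto
    also have "\<dots> = (power_const - 32 * k\<^sub>y^4) / h" using q0 n by simp
    finally show ?thesis .
  qed
  ultimately have "(8 * pop.expectation (\<lambda>\<omega>. (signal \<omega>)^4) / (n * signal_var\<^sup>2)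
      + (32 * \<sigma>\<^sub>\<epsilon>\<^sup>2 + 416 * k\<^sub>y\<^sup>2 * (1 + C) * (1 + real s_star * ln p)) / (n * signal_var)) / \<alpha> \<le> power_const / h / \<alpha>"
    using \<alpha> by (intro divide_right_mono) (auto simp: diff_divide_distrib)
  then show ?thesis using rejection_prob_ge[OF K p n q0 \<alpha>] by linarith
qed

text \<open>
  The fluctuation of the signal is now of relative order \<open>1/\<surd>n\<close> and needs no lower bound on its
  strength; since \<open>p \<ge> 2\<close>, the product \<open>s\<^sup>* ln p\<close> is at least \<open>1/2\<close> and dominates the constant \<open>1\<close>.
\<close>

lemma power_variance_bound_alternative:
  assumes K: "0 < K\<^sub>x" "0 < K\<^sub>\<mu>" "0 < K\<^sub>\<epsilon>" and n: "1 \<le> n" and \<alpha>: "0 < \<alpha>" and h: "1 \<le> h"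
    and p: "2 \<le> p" and \<kappa>: "psi2_variance_bound P p \<kappa> x" "0 < \<kappa>"
    and sig: "quad_form p (covariance_matrix P x) \<beta> = h * (real s_star * ln p / n)"
  shows "1 - (512 * \<kappa>\<^sup>2 / n + 3 * power_const / h) / \<alpha> \<le> rejection_prob M n p est Z \<alpha>"
proof -
  have signal_var: "signal_var = h * (real s_star * ln p / n)" using sig quad_form_covariance[OF K(1)] by simp
  have nq: "n * signal_var = h * (real s_star * ln p)" using n by (simp add: signal_var)
  have "ln 2 \<le> ln (real p)" using p by simp
  moreover have "1 / 2 \<le> ln (2 :: real)" using ln2_ge_two_thirds by linarith
  ultimately have lp: "1 / 2 \<le> ln (real p)" by linarith
  have "1 * (1 / 2) \<le> real s_star * ln p" using sparsity_level lp by (intro mult_mono) auto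
  then have sl: "1 / 2 \<le> real s_star * ln p" by simp
  have nq1: "h * (1 + real s_star * ln p) \<le> 3 * (n * signal_var)"
    unfolding nq using sl h by (simp add: mult.left_commute mult_left_mono)
  have nq0: "0 < n * signal_var" unfolding nq using sl h by simp
  then have q0: "0 < signal_var" using n by (simp add: zero_less_mult_iff)
  have "8 * pop.expectation (\<lambda>\<omega>. (signal \<omega>)^4) / (n * signal_var\<^sup>2) \<le> 8 * (64 * \<kappa>\<^sup>2 * signal_var\<^sup>2) / (n * signal_var\<^sup>2)"
    using signal_fourth_moment_variance_bound[OF \<kappa> q0] q0 n by (intro divide_right_mono mult_left_mono) auto
  also have "\<dots> = 512 * \<kappa>\<^sup>2 / n" using q0 by simp
  finally have "8 * pop.expectation (\<lambda>\<omega>. (signal \<omega>)^4) / (n * signal_var\<^sup>2) \<le> 512 * \<kappa>\<^sup>2 / n" .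
  moreover have "(32 * \<sigma>\<^sub>\<epsilon>\<^sup>2 + 416 * k\<^sub>y\<^sup>2 * (1 + C) * (1 + real s_star * ln p)) / (n * signal_var) \<le> 3 * power_const / h"
  proof -
    have "1 + real s_star * ln p \<le> 3 * (n * signal_var) / h" using nq1 h by (simp add: field_simps)
    then have "32 * \<sigma>\<^sub>\<epsilon>\<^sup>2 + 416 * k\<^sub>y\<^sup>2 * (1 + C) * (1 + real s_star * ln p) \<le> (power_const - 32 * k\<^sub>y^4) * (3 * (n * signal_var) / h)"
      using nq0 h p by (intro noise_term_le) auto
    also have "\<dots> \<le> power_const * (3 * (n * signal_var) / h)"
      using nq0 h by (intro mult_right_mono) auto
    finally have "(32 * \<sigma>\<^sub>\<epsilon>\<^sup>2 + 416 * k\<^sub>y\<^sup>2 * (1 + C) * (1 + real s_star * ln p)) / (n * signal_var)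
        \<le> power_const * (3 * (n * signal_var) / h) / (n * signal_var)"
      using nq0 by (intro divide_right_mono) auto
    also have "\<dots> = 3 * power_const / h" using q0 n by simp
    finally show ?thesis .
  qed
  ultimately have "(8 * pop.expectation (\<lambda>\<omega>. (signal \<omega>)^4) / (n * signal_var\<^sup>2)
      + (32 * \<sigma>\<^sub>\<epsilon>\<^sup>2 + 416 * k\<^sub>y\<^sup>2 * (1 + C) * (1 + real s_star * ln p)) / (n * signal_var)) / \<alpha>
     \<le> (512 * \<kappa>\<^sup>2 / n + 3 * power_const / h) / \<alpha>"
    using \<alpha> by (intro divide_right_mono) auto
  then show ?thesis using rejection_prob_ge[OF K _ n q0 \<alpha>] p by linarith
qed

end

section \<open>Asymptotic level and power\<close>

theorem corollary6p1:
  fixes \<alpha> K\<^sub>x K\<^sub>\<epsilon> K\<^sub>\<mu> \<sigma>\<^sub>\<epsilon> c C :: real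
  assumes "0 < \<alpha>" "\<alpha> < 1"
    and "0 < K\<^sub>x" "0 < K\<^sub>\<epsilon>" "0 < K\<^sub>\<mu>" "0 < c" "0 < C"
  shows
    "(\<forall>(p :: nat \<Rightarrow> nat) s_star s \<beta> (P :: nat \<Rightarrow> 'b measure) x \<epsilon> (M :: nat \<Rightarrow> 'a measure) Z est.
        (\<forall>\<^sub>F n in sequentially.
           sparse_regression K\<^sub>x K\<^sub>\<epsilon> K\<^sub>\<mu> \<sigma>\<^sub>\<epsilon> c C
             n (p n) (s_star n) (s n) (\<beta> n) (P n) (x n) (\<epsilon> n) (M n) (Z n) (est n) \<and>
           \<beta> n = (\<lambda>k\<in>{1..p n}. 0))
        \<longrightarrow> limsup (\<lambda>n. ereal (rejection_prob (M n) n (p n) (est n) (Z n) \<alpha>)) \<le> ereal \<alpha>)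
   \<and> (\<exists>h\<^sub>0>0. \<forall>h\<ge>h\<^sub>0.
      \<forall>(p :: nat \<Rightarrow> nat) s_star s \<beta> (P :: nat \<Rightarrow> 'b measure) x \<epsilon> (M :: nat \<Rightarrow> 'a measure) Z est.
        (\<forall>\<^sub>F n in sequentially.
           sparse_regression K\<^sub>x K\<^sub>\<epsilon> K\<^sub>\<mu> \<sigma>\<^sub>\<epsilon> c C
             n (p n) (s_star n) (s n) (\<beta> n) (P n) (x n) (\<epsilon> n) (M n) (Z n) (est n) \<and>
           l0_norm (p n) (\<beta> n) = s_star n \<and>
           quad_form (p n) (covariance_matrix (P n) (x n)) (\<beta> n) =
             h * (1 / sqrt (real n) + real (s_star n) * ln (real (p n)) / real n))
        \<longrightarrow> liminf (\<lambda>n. ereal (rejection_prob (M n) n (p n) (est n) (Z n) \<alpha>)) > ereal \<alpha>)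
   \<and> (\<forall>\<kappa>>0. \<exists>h\<^sub>0>0. \<forall>h\<ge>h\<^sub>0.
      \<forall>(p :: nat \<Rightarrow> nat) s_star s \<beta> (P :: nat \<Rightarrow> 'b measure) x \<epsilon> (M :: nat \<Rightarrow> 'a measure) Z est.
        (\<forall>\<^sub>F n in sequentially.
           sparse_regression K\<^sub>x K\<^sub>\<epsilon> K\<^sub>\<mu> \<sigma>\<^sub>\<epsilon> c C
             n (p n) (s_star n) (s n) (\<beta> n) (P n) (x n) (\<epsilon> n) (M n) (Z n) (est n) \<and>
           2 \<le> p n \<and>
           psi2_variance_bound (P n) (p n) \<kappa> (x n) \<and>
           l0_norm (p n) (\<beta> n) = s_star n \<and>
           quad_form (p n) (covariance_matrix (P n) (x n)) (\<beta> n) =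
             h * (real (s_star n) * ln (real (p n)) / real n))
        \<longrightarrow> liminf (\<lambda>n. ereal (rejection_prob (M n) n (p n) (est n) (Z n) \<alpha>)) > ereal \<alpha>)"
proof (intro conjI)
  show "\<forall>(p :: nat \<Rightarrow> nat) s_star s \<beta> (P :: nat \<Rightarrow> 'b measure) x \<epsilon> (M :: nat \<Rightarrow> 'a measure) Z est.
        (\<forall>\<^sub>F n in sequentially.
           sparse_regression K\<^sub>x K\<^sub>\<epsilon> K\<^sub>\<mu> \<sigma>\<^sub>\<epsilon> c C
             n (p n) (s_star n) (s n) (\<beta> n) (P n) (x n) (\<epsilon> n) (M n) (Z n) (est n) \<and>
           \<beta> n = (\<lambda>k\<in>{1..p n}. 0))
        \<longrightarrow> limsup (\<lambda>n. ereal (rejection_prob (M n) n (p n) (est n) (Z n) \<alpha>)) \<le> ereal \<alpha>"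
  proof (intro allI impI)
    fix p s_star s :: "nat \<Rightarrow> nat" and \<beta> and P :: "nat \<Rightarrow> 'b measure" and x \<epsilon> and M :: "nat \<Rightarrow> 'a measure" and Z est
    assume "\<forall>\<^sub>F n in sequentially.
           sparse_regression K\<^sub>x K\<^sub>\<epsilon> K\<^sub>\<mu> \<sigma>\<^sub>\<epsilon> c C
             n (p n) (s_star n) (s n) (\<beta> n) (P n) (x n) (\<epsilon> n) (M n) (Z n) (est n) \<and>
           \<beta> n = (\<lambda>k\<in>{1..p n}. 0)"
    then have "\<forall>\<^sub>F n in sequentially. ereal (rejection_prob (M n) n (p n) (est n) (Z n) \<alpha>) \<le> ereal \<alpha>"
      using eventually_ge_at_top[of "1::nat"]
    proof eventually_elim
      case (elim n)
      then interpret sparse_regression K\<^sub>x K\<^sub>\<epsilon> K\<^sub>\<mu> \<sigma>\<^sub>\<epsilon> c C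
        n "p n" "s_star n" "s n" "\<beta> n" "P n" "x n" "\<epsilon> n" "M n" "Z n" "est n" by blast
      show ?case using elim assms level_under_null by simp
    qed
    then show "limsup (\<lambda>n. ereal (rejection_prob (M n) n (p n) (est n) (Z n) \<alpha>)) \<le> ereal \<alpha>"
      by (rule Limsup_bounded)
  qed
next
  define k where "k = 2 * (K\<^sub>\<mu> + K\<^sub>\<epsilon>)"
  define A where "A = 32 * k^4 + 32 * \<sigma>\<^sub>\<epsilon>\<^sup>2 + 416 * k\<^sup>2 * (1 + C)"
  have A: "0 \<le> A" using assms by (simp add: A_def)
  \<comment> \<open>the probability of not rejecting is at most \<open>A / (h \<alpha>)\<close>; this threshold makes it at most \<open>(1 - \<alpha>) / 2\<close>\<close>
  define h0 where "h0 = max 1 (2 * A / (\<alpha> * (1 - \<alpha>)))"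
  show "\<exists>h\<^sub>0>0. \<forall>h\<ge>h\<^sub>0.
      \<forall>(p :: nat \<Rightarrow> nat) s_star s \<beta> (P :: nat \<Rightarrow> 'b measure) x \<epsilon> (M :: nat \<Rightarrow> 'a measure) Z est.
        (\<forall>\<^sub>F n in sequentially.
           sparse_regression K\<^sub>x K\<^sub>\<epsilon> K\<^sub>\<mu> \<sigma>\<^sub>\<epsilon> c C
             n (p n) (s_star n) (s n) (\<beta> n) (P n) (x n) (\<epsilon> n) (M n) (Z n) (est n) \<and>
           l0_norm (p n) (\<beta> n) = s_star n \<and>
           quad_form (p n) (covariance_matrix (P n) (x n)) (\<beta> n) =
             h * (1 / sqrt (real n) + real (s_star n) * ln (real (p n)) / real n))
        \<longrightarrow> liminf (\<lambda>n. ereal (rejection_prob (M n) n (p n) (est n) (Z n) \<alpha>)) > ereal \<alpha>"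
  proof (intro exI[of _ h0] conjI allI impI)
    show "0 < h0" by (simp add: h0_def)
    fix h and p s_star s :: "nat \<Rightarrow> nat" and \<beta> and P :: "nat \<Rightarrow> 'b measure" and x \<epsilon> and M :: "nat \<Rightarrow> 'a measure" and Z est
    assume h: "h0 \<le> h"
    have h1: "1 \<le> h" and "2 * A / (\<alpha> * (1 - \<alpha>)) \<le> h" using h by (simp_all add: h0_def)
    then have small: "A / h / \<alpha> \<le> (1 - \<alpha>) / 2" using assms by (simp add: field_simps)
    assume "\<forall>\<^sub>F n in sequentially.
           sparse_regression K\<^sub>x K\<^sub>\<epsilon> K\<^sub>\<mu> \<sigma>\<^sub>\<epsilon> c C
             n (p n) (s_star n) (s n) (\<beta> n) (P n) (x n) (\<epsilon> n) (M n) (Z n) (est n) \<and>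
           l0_norm (p n) (\<beta> n) = s_star n \<and>
           quad_form (p n) (covariance_matrix (P n) (x n)) (\<beta> n) =
             h * (1 / sqrt (real n) + real (s_star n) * ln (real (p n)) / real n)"
    then have "\<forall>\<^sub>F n in sequentially. ereal ((1 + \<alpha>) / 2) \<le> ereal (rejection_prob (M n) n (p n) (est n) (Z n) \<alpha>)"
      using eventually_ge_at_top[of "1::nat"]
    proof eventually_elim
      case (elim n)
      then interpret sparse_regression K\<^sub>x K\<^sub>\<epsilon> K\<^sub>\<mu> \<sigma>\<^sub>\<epsilon> c C
        n "p n" "s_star n" "s n" "\<beta> n" "P n" "x n" "\<epsilon> n" "M n" "Z n" "est n" by blast
      have "1 - A / h / \<alpha> \<le> rejection_prob (M n) n (p n) (est n) (Z n) \<alpha>"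
        using power_root_n_alternative[of \<alpha> h] elim assms h1
        by (simp add: power_const_def k\<^sub>y_def A_def k_def)
      with small have "(1 + \<alpha>) / 2 \<le> rejection_prob (M n) n (p n) (est n) (Z n) \<alpha>" by argo
      then show ?case by simp
    qed
    then have "ereal ((1 + \<alpha>) / 2) \<le> liminf (\<lambda>n. ereal (rejection_prob (M n) n (p n) (est n) (Z n) \<alpha>))"
      by (rule Liminf_bounded)
    moreover have "ereal \<alpha> < ereal ((1 + \<alpha>) / 2)" using assms by simp
    ultimately show "ereal \<alpha> < liminf (\<lambda>n. ereal (rejection_prob (M n) n (p n) (est n) (Z n) \<alpha>))"
      by (rule order_less_le_trans[rotated])
  qed
next
  define k where "k = 2 * (K\<^sub>\<mu> + K\<^sub>\<epsilon>)"
  define A where "A = 32 * k^4 + 32 * \<sigma>\<^sub>\<epsilon>\<^sup>2 + 416 * k\<^sup>2 * (1 + C)"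
  have A: "0 \<le> A" using assms by (simp add: A_def)
  \<comment> \<open>the threshold makes \<open>3 A / (h \<alpha>)\<close> at most \<open>(1 - \<alpha>) / 4\<close>; the term with \<open>\<kappa>\<close> tends to zero with \<open>n\<close>\<close>
  define h0 where "h0 = max 1 (12 * A / (\<alpha> * (1 - \<alpha>)))"
  show "\<forall>\<kappa>>0. \<exists>h\<^sub>0>0. \<forall>h\<ge>h\<^sub>0.
      \<forall>(p :: nat \<Rightarrow> nat) s_star s \<beta> (P :: nat \<Rightarrow> 'b measure) x \<epsilon> (M :: nat \<Rightarrow> 'a measure) Z est.
        (\<forall>\<^sub>F n in sequentially.
           sparse_regression K\<^sub>x K\<^sub>\<epsilon> K\<^sub>\<mu> \<sigma>\<^sub>\<epsilon> c C
             n (p n) (s_star n) (s n) (\<beta> n) (P n) (x n) (\<epsilon> n) (M n) (Z n) (est n) \<and>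
           2 \<le> p n \<and>
           psi2_variance_bound (P n) (p n) \<kappa> (x n) \<and>
           l0_norm (p n) (\<beta> n) = s_star n \<and>
           quad_form (p n) (covariance_matrix (P n) (x n)) (\<beta> n) =
             h * (real (s_star n) * ln (real (p n)) / real n))
        \<longrightarrow> liminf (\<lambda>n. ereal (rejection_prob (M n) n (p n) (est n) (Z n) \<alpha>)) > ereal \<alpha>"
  proof (intro allI impI exI[of _ h0] conjI)
    show "0 < h0" by (simp add: h0_def)
    fix \<kappa> h :: real and p s_star s :: "nat \<Rightarrow> nat" and \<beta> and P :: "nat \<Rightarrow> 'b measure" and x \<epsilon> and M :: "nat \<Rightarrow> 'a measure" and Z est
    assume \<kappa>: "0 < \<kappa>" and h: "h0 \<le> h"
    have h1: "1 \<le> h" and "12 * A / (\<alpha> * (1 - \<alpha>)) \<le> h" using h by (simp_all add: h0_def)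
    then have small: "3 * A / h / \<alpha> \<le> (1 - \<alpha>) / 4" using assms by (simp add: field_simps)
    have ev: "\<forall>\<^sub>F n in sequentially. 512 * \<kappa>\<^sup>2 / real n / \<alpha> < (1 - \<alpha>) / 4"
    proof (rule order_tendstoD(2))
      show "(\<lambda>n. 512 * \<kappa>\<^sup>2 / real n / \<alpha>) \<longlonglongrightarrow> 0 / \<alpha>"
        by (intro tendsto_divide lim_const_over_n tendsto_const) (use assms in auto)
      show "0 / \<alpha> < (1 - \<alpha>) / 4" using assms by simp
    qed
    assume "\<forall>\<^sub>F n in sequentially.
           sparse_regression K\<^sub>x K\<^sub>\<epsilon> K\<^sub>\<mu> \<sigma>\<^sub>\<epsilon> c C
             n (p n) (s_star n) (s n) (\<beta> n) (P n) (x n) (\<epsilon> n) (M n) (Z n) (est n) \<and>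
           2 \<le> p n \<and>
           psi2_variance_bound (P n) (p n) \<kappa> (x n) \<and>
           l0_norm (p n) (\<beta> n) = s_star n \<and>
           quad_form (p n) (covariance_matrix (P n) (x n)) (\<beta> n) =
             h * (real (s_star n) * ln (real (p n)) / real n)"
    then have "\<forall>\<^sub>F n in sequentially. ereal ((1 + \<alpha>) / 2) \<le> ereal (rejection_prob (M n) n (p n) (est n) (Z n) \<alpha>)"
      using eventually_ge_at_top[of "1::nat"] ev
    proof eventually_elim
      case (elim n)
      then interpret sparse_regression K\<^sub>x K\<^sub>\<epsilon> K\<^sub>\<mu> \<sigma>\<^sub>\<epsilon> c C
        n "p n" "s_star n" "s n" "\<beta> n" "P n" "x n" "\<epsilon> n" "M n" "Z n" "est n" by blast
      have "1 - (512 * \<kappa>\<^sup>2 / n + 3 * A / h) / \<alpha> \<le> rejection_prob (M n) n (p n) (est n) (Z n) \<alpha>"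
        using power_variance_bound_alternative[of \<alpha> h \<kappa>] elim assms h1 \<kappa>
        by (simp add: power_const_def k\<^sub>y_def A_def k_def)
      moreover have "(512 * \<kappa>\<^sup>2 / n + 3 * A / h) / \<alpha> = 512 * \<kappa>\<^sup>2 / real n / \<alpha> + 3 * A / h / \<alpha>"
        by (rule add_divide_distrib)
      moreover have "512 * \<kappa>\<^sup>2 / real n / \<alpha> < (1 - \<alpha>) / 4" using elim by simp
      ultimately have "(1 + \<alpha>) / 2 \<le> rejection_prob (M n) n (p n) (est n) (Z n) \<alpha>" using small by argo
      then show ?case by simp
    qed
    then have "ereal ((1 + \<alpha>) / 2) \<le> liminf (\<lambda>n. ereal (rejection_prob (M n) n (p n) (est n) (Z n) \<alpha>))"
      by (rule Liminf_bounded)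
    moreover have "ereal \<alpha> < ereal ((1 + \<alpha>) / 2)" using assms by simp
    ultimately show "ereal \<alpha> < liminf (\<lambda>n. ereal (rejection_prob (M n) n (p n) (est n) (Z n) \<alpha>))"
      by (rule order_less_le_trans[rotated])
  qed
qed

end
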